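(* Let $A,B$ be finite-dimensional Hilbert spaces, $\rho_{AB}\in \mathrm{S}(A\otimes B)$ and $\sigma_A\in\mathrm{S}(A)$. Let $\beta_0(t):=\frac{\pi}{2}(\cosh(\pi t)+1)^{-1}$, which is a probability distribution on $\mathbb{R}$. Then $$\bar\sigma_{AB}:=\int_{-\infty}^{\infty}\beta_0(t)\,\sigma_A^{\frac{1+\mathrm{i}t}{2}}\rho_A^{-\frac{1+\mathrm{i}t}{2}}\rho_{AB}\,\rho_A^{-\frac{1-\mathrm{i}t}{2}}\sigma_A^{\frac{1-\mathrm{i}t}{2}}\,\mathrm{d}t$$ is an extension of $\sigma_A$ that satisfies $$D_{\mathbb{M}}(\rho_A\|\sigma_A)\le D_{\mathbb{M}}(\rho_{AB}\|\bar\sigma_{AB})\le D(\rho_A\|\sigma_A).$$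
   Context: $\mathrm{S}(A)$ is the set of density matrices (positive semidefinite, trace one) on the finite-dimensional Hilbert space $A$; $\rho_A=\mathrm{tr}_B[\rho_{AB}]$. Operators on $A$ act on $A\otimes B$ as $X\otimes\mathbb{1}_B$. The inverse (in the negative powers of $\rho_A$) is only relevant on the support of $\rho_A$. An extension of $\sigma_A$ is a density matrix $\sigma'_{AB}$ on $A\otimes B$ with $\mathrm{tr}_B[\sigma'_{AB}]=\sigma_A$. The relative entropy is $D(\rho\|\sigma):=\mathrm{tr}[\rho(\log\rho-\log\sigma)]$ if $\mathrm{supp}\,\rho\subseteq\mathrm{supp}\,\sigma$, and $+\infty$ otherwise. The measured relative entropy is $D_{\mathbb{M}}(\rho\|\sigma):=\sup_{\mathcal{M}}D(\mathcal{M}(\rho)\|\mathcal{M}(\sigma))$, the supremum being over all POVM channels $\mathcal{M}(X)=\sum_x\mathrm{tr}[M_xX]\,|x\rangle\langle x|$ with $\{M_x\}$ a (finite) POVM and $\{|x\rangle\}$ orthonormal. The construction arises from a proof, based on the multivariate Golden-Thompson inequality, of the statement that $D_{\mathbb{M}}(\rho_A\|\sigma_A)\le\min_{\sigma_{AB}}D_{\mathbb{M}}(\rho_{AB}\|\sigma_{AB})\le D(\rho_A\|\sigma_A)$, the minimum being over all extensions $\sigma_{AB}$ of $\sigma_A$.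
   Formalization: That the integral is an extension of σ_A is claimed only when supp σ_A ⊆ supp ρ_A; otherwise it fails (B trivial, ρ_A = |0⟩⟨0|, σ_A = 1/2 gives trace 1/2). Both inequalities are proved without this condition. *)

theory Defs
  imports
    "HOL-Probability.Probability_Measure"
    "Jordan_Normal_Form.Schur_Decomposition"
    "Jordan_Normal_Form.Matrix_Kernel"
begin

text \<open>
  A finite-dimensional Hilbert space of dimension \<open>n\<close> is represented as \<open>carrier_vec n\<close> over the
  complex numbers, with inner product \<open>v \<bullet>c w\<close>. The space \<open>A \<otimes> B\<close> with \<open>dim A = m\<close>, \<open>dim B = n\<close> is
  \<open>carrier_vec (m * n)\<close>, the product basis vector \<open>e\<^sub>i \<otimes> e\<^sub>k\<close> being the one with index \<open>i * n + k\<close>.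
\<close>

definition mat_trace :: "complex mat \<Rightarrow> complex" where
  "mat_trace X = (\<Sum>i<dim_row X. X $$ (i, i))"

definition psd_mat :: "nat \<Rightarrow> complex mat \<Rightarrow> bool" where
  "psd_mat n X \<longleftrightarrow> X \<in> carrier_mat n n \<and> mat_adjoint X = X \<and>
     (\<forall>v\<in>carrier_vec n. 0 \<le> Re ((X *\<^sub>v v) \<bullet>c v))"

definition density_mat :: "nat \<Rightarrow> complex mat \<Rightarrow> bool" where
  "density_mat n \<rho> \<longleftrightarrow> psd_mat n \<rho> \<and> mat_trace \<rho> = 1"

definition kronecker :: "complex mat \<Rightarrow> complex mat \<Rightarrow> complex mat" where
  "kronecker X Y = mat (dim_row X * dim_row Y) (dim_col X * dim_col Y)
     (\<lambda>(i, j). X $$ (i div dim_row Y, j div dim_col Y) * Y $$ (i mod dim_row Y, j mod dim_col Y))"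

definition ptrace_snd :: "nat \<Rightarrow> nat \<Rightarrow> complex mat \<Rightarrow> complex mat" where
  "ptrace_snd m n X = mat m m (\<lambda>(i, j). \<Sum>k<n. X $$ (i * n + k, j * n + k))"

definition is_extension :: "nat \<Rightarrow> nat \<Rightarrow> complex mat \<Rightarrow> complex mat \<Rightarrow> bool" where
  "is_extension m n \<sigma>' \<sigma> \<longleftrightarrow> density_mat (m * n) \<sigma>' \<and> ptrace_snd m n \<sigma>' = \<sigma>"

definition unitary_mat :: "nat \<Rightarrow> complex mat \<Rightarrow> bool" where
  "unitary_mat n U \<longleftrightarrow> U \<in> carrier_mat n n \<and>
     U * mat_adjoint U = 1\<^sub>m n \<and> mat_adjoint U * U = 1\<^sub>m n"

text \<open>
  Functional calculus for a Hermitian matrix: \<open>f(\<Sum>\<^sub>i d\<^sub>i |u\<^sub>i\<rangle>\<langle>u\<^sub>i|) = \<Sum>\<^sub>i f(d\<^sub>i) |u\<^sub>i\<rangle>\<langle>u\<^sub>i|\<close> for any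
  spectral decomposition (the \<open>u\<^sub>i\<close> are the columns of \<open>U\<close>). The result does not depend on the choice
  of the decomposition; for a matrix that is not Hermitian the value is unspecified.
\<close>

definition mat_fun :: "(real \<Rightarrow> complex) \<Rightarrow> complex mat \<Rightarrow> complex mat" where
  "mat_fun f X = (THE Y. \<exists>U d. unitary_mat (dim_row X) U \<and>
     X = U * mat_diag (dim_row X) (\<lambda>i. complex_of_real (d i)) * mat_adjoint U \<and>
     Y = U * mat_diag (dim_row X) (\<lambda>i. f (d i)) * mat_adjoint U)"

text \<open>
  Since \<open>0 powr z = 0\<close> and \<open>ln 0 = 0\<close>, powers (in particular those with negative real part) and
  logarithms of positive semidefinite matrices are taken on the support and vanish on the kernel.
\<close>

definition mat_powr :: "complex mat \<Rightarrow> complex \<Rightarrow> complex mat" where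
  "mat_powr X z = mat_fun (\<lambda>x. complex_of_real x powr z) X"

definition mat_ln :: "complex mat \<Rightarrow> complex mat" where
  "mat_ln X = mat_fun (\<lambda>x. complex_of_real (ln x)) X"

definition mat_supp :: "complex mat \<Rightarrow> complex vec set" where
  "mat_supp X = {v \<in> carrier_vec (dim_row X). \<forall>w\<in>mat_kernel X. v \<bullet>c w = 0}"

definition rel_entropy :: "complex mat \<Rightarrow> complex mat \<Rightarrow> ereal" where
  "rel_entropy \<rho> \<sigma> =
     (if mat_supp \<rho> \<subseteq> mat_supp \<sigma>
      then ereal (Re (mat_trace (\<rho> * (mat_ln \<rho> - mat_ln \<sigma>)))) else \<infinity>)"

text \<open>A POVM on \<open>\<complex>\<^sup>n\<close> with outcomes \<open>0, \<dots>, k - 1\<close>.\<close>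

definition povm :: "nat \<Rightarrow> nat \<Rightarrow> (nat \<Rightarrow> complex mat) \<Rightarrow> bool" where
  "povm n k M \<longleftrightarrow> (\<forall>x<k. psd_mat n (M x)) \<and>
     mat n n (\<lambda>(i, j). \<Sum>x<k. M x $$ (i, j)) = 1\<^sub>m n"

definition povm_channel :: "nat \<Rightarrow> (nat \<Rightarrow> complex mat) \<Rightarrow> complex mat \<Rightarrow> complex mat" where
  "povm_channel k M X = mat_diag k (\<lambda>x. mat_trace (M x * X))"

definition measured_rel_entropy :: "nat \<Rightarrow> complex mat \<Rightarrow> complex mat \<Rightarrow> ereal" where
  "measured_rel_entropy n \<rho> \<sigma> =
     (SUP (k, M)\<in>{(k, M). povm n k M}. rel_entropy (povm_channel k M \<rho>) (povm_channel k M \<sigma>))"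

definition beta0 :: "real \<Rightarrow> real" where
  "beta0 t = pi / 2 * inverse (cosh (pi * t) + 1)"

definition rotated_integrand ::
    "nat \<Rightarrow> nat \<Rightarrow> complex mat \<Rightarrow> complex mat \<Rightarrow> real \<Rightarrow> complex mat" where
  "rotated_integrand m n \<rho> \<sigma> t =
     (let \<rho>A = ptrace_snd m n \<rho>; z = (1 + \<i> * complex_of_real t) / 2;
          z' = (1 - \<i> * complex_of_real t) / 2
      in kronecker (mat_powr \<sigma> z) (1\<^sub>m n) * kronecker (mat_powr \<rho>A (- z)) (1\<^sub>m n) * \<rho> *
         kronecker (mat_powr \<rho>A (- z')) (1\<^sub>m n) * kronecker (mat_powr \<sigma> z') (1\<^sub>m n))"

text \<open>
  The matrix-valued integral is taken entrywise. The trace of the result is \<open>tr[P \<sigma>]\<close>, where \<open>P\<close>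
  projects onto the support of \<open>\<rho>\<^sub>A\<close>; hence it is an extension of \<open>\<sigma>\<close> only if
  \<open>supp \<sigma> \<subseteq> supp \<rho>\<^sub>A\<close>, and is subnormalised otherwise.
\<close>

definition sigma_bar :: "nat \<Rightarrow> nat \<Rightarrow> complex mat \<Rightarrow> complex mat \<Rightarrow> complex mat" where
  "sigma_bar m n \<rho> \<sigma> = mat (m * n) (m * n)
     (\<lambda>(i, j). \<integral>t. complex_of_real (beta0 t) * rotated_integrand m n \<rho> \<sigma> t $$ (i, j) \<partial>lborel)"

end

theory Submission
  imports
    Defs
    "HOL-Complex_Analysis.Residue_Theorem"
    "Jordan_Normal_Form.Spectral_Radius"
begin

text \<open>
  For a POVM \<open>M\<close> on \<open>A \<otimes> B\<close> and real \<open>l\<^sub>x\<close> consider the entire function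
  \<open>f(z) = \<Sum>\<^sub>x exp(z l\<^sub>x / 2) tr[M\<^sub>x \<sigma>\<^sub>A\<^sup>z\<^sup>/\<^sup>2 \<rho>\<^sub>A\<^sup>-\<^sup>z\<^sup>/\<^sup>2 \<rho>\<^sub>A\<^sub>B]\<close>, which is bounded on the strip
  \<open>0 \<le> Re z \<le> 1\<close> and satisfies \<open>f(0) = 1\<close>. By the arithmetic-geometric mean inequality
  \<open>Re f \<le> 1\<close> on the left edge, and \<open>2 Re f(1 + it)\<close> is at most 1 plus the \<open>M\<close>-average of
  \<open>exp(l\<^sub>x)\<close> in the integrand of \<open>\<sigma>\<^sub>A\<^sub>B\<close>. The Poisson formula of the strip bounds \<open>f\<close> at interior
  points \<open>\<theta>\<close> by its boundary values; as \<open>\<theta> \<rightarrow> 0\<close> the kernel of the right edge, divided by \<open>\<theta>\<close>,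
  tends to \<open>\<beta>\<^sub>0\<close>, so \<open>Re f'(0) \<le> \<integral> \<beta>\<^sub>0(t) (Re f(1 + it) - 1) dt\<close>. With \<open>p\<close>, \<open>q\<close> the outcome
  distributions of \<open>\<rho>\<^sub>A\<^sub>B\<close> and \<open>\<sigma>\<^sub>A\<^sub>B\<close> this reads
  \<open>\<Sum>\<^sub>x p\<^sub>x l\<^sub>x - D(\<rho>\<^sub>A\<parallel>\<sigma>\<^sub>A) \<le> \<Sum>\<^sub>x exp(l\<^sub>x) q\<^sub>x - 1\<close>, and \<open>l\<^sub>x = ln(p\<^sub>x / q\<^sub>x)\<close> gives the upper bound. For the lower bound, \<open>M\<close> on \<open>A\<close> is
  replaced by \<open>M \<otimes> 1\<close>; the marginal of \<open>\<sigma>\<^sub>A\<^sub>B\<close> is dominated by \<open>\<sigma>\<^sub>A\<close> even if the support of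
  \<open>\<sigma>\<^sub>A\<close> is not contained in that of \<open>\<rho>\<^sub>A\<close>.
\<close>

text \<open>Why real parts suffice: the dual form of the classical relative entropy is linear in p
  and q, so a bound on Re f'(0) is enough. No logarithm of |f| enters, and the Poisson formula for a
  bounded entire function replaces the Hirschman-type interpolation behind the multivariate
  Golden-Thompson inequality. Halving the exponents compensates the squaring in the
  arithmetic-geometric mean step: on the right edge the squared weight is exp(l_x), and conjugating
  rho_AB by sigma_A^(z/2) rho_A^(-z/2) gives the rotated integrand itself.

  The obstacle is singular states. Powers vanish on kernels, so X^0 is the support projection and
  not the identity, and imaginary powers are only partial isometries. The normalisation f(0) = 1
  therefore needs that both support projections leave rho_AB unchanged: for rho_A this always holds,
  for sigma_A it follows from supp rho_A inside supp sigma_A, and outside that case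
  D(rho_A||sigma_A) is infinite. On the left edge partial isometries still do not increase the trace
  of a positive operator, which yields Re f <= 1.\<close>

unbundle no vec_syntax

section \<open>Adjoints, traces and positive semidefinite matrices\<close>

lemma mat_adjoint_dim [simp]:
  "dim_row (mat_adjoint A) = dim_col A" "dim_col (mat_adjoint A) = dim_row A"
  unfolding mat_adjoint_def by auto

lemma mat_adjoint_carrier [simp]:
  "A \<in> carrier_mat n k \<Longrightarrow> mat_adjoint A \<in> carrier_mat k n"
  by (intro carrier_matI) auto

lemma mat_adjoint_index [simp]:
  fixes A :: "complex mat"
  shows "i < dim_col A \<Longrightarrow> j < dim_row A \<Longrightarrow> mat_adjoint A $$ (i, j) = cnj (A $$ (j, i))"
  unfolding mat_adjoint_def by (subst mat_of_rows_index) auto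

lemma mult_mat_index:
  assumes "A \<in> carrier_mat n k" "B \<in> carrier_mat k l" "i < n" "j < l"
  shows "(A * B) $$ (i, j) = (\<Sum>t<k. A $$ (i, t) * B $$ (t, j))"
  using assms by (auto simp: scalar_prod_def atLeast0LessThan intro!: sum.cong)

lemma mat_adjoint_adjoint [simp]: "mat_adjoint (mat_adjoint A) = (A :: complex mat)"
  by (rule eq_matI) auto

lemma mat_adjoint_mult:
  fixes A B :: "complex mat"
  assumes "A \<in> carrier_mat n k" "B \<in> carrier_mat k l"
  shows "mat_adjoint (A * B) = mat_adjoint B * mat_adjoint A"
proof (rule eq_matI)
  fix i j assume "i < dim_row (mat_adjoint B * mat_adjoint A)" "j < dim_col (mat_adjoint B * mat_adjoint A)"
  then have ij: "i < l" "j < n" using assms by auto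
  have "mat_adjoint (A * B) $$ (i, j) = cnj ((A * B) $$ (j, i))"
    using assms ij by (subst mat_adjoint_index) auto
  also have "\<dots> = (\<Sum>t<k. mat_adjoint B $$ (i, t) * mat_adjoint A $$ (t, j))"
    using assms ij by (subst mult_mat_index) (auto simp: mult.commute)
  also have "\<dots> = (mat_adjoint B * mat_adjoint A) $$ (i, j)"
    using assms ij by (subst mult_mat_index[of _ l k _ n]) auto
  finally show "mat_adjoint (A * B) $$ (i, j) = (mat_adjoint B * mat_adjoint A) $$ (i, j)" .
qed (use assms in auto)

context
  fixes n :: nat
begin

text \<open>Matrix associativity is conditional on carriers whose dimensions do not occur in the
  rewritten terms. Fixing all of them to one n lets the simplifier solve the side conditions; use
  sites choose n by \<open>[where n = ...]\<close>.\<close>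

lemmas square_mat_simps =
  assoc_mult_mat[of _ n n _ n _ n] mult_carrier_mat[of _ n n _ n] mat_diag_dim[of n]
  left_mult_one_mat[of _ n n] right_mult_one_mat[of _ n n]

end

lemma mat_adjoint_one [simp]: "mat_adjoint (1\<^sub>m n) = (1\<^sub>m n :: complex mat)"
  by (rule eq_matI) auto

lemma mat_adjoint_minus:
  fixes A B :: "complex mat"
  assumes "A \<in> carrier_mat n k" "B \<in> carrier_mat n k"
  shows "mat_adjoint (A - B) = mat_adjoint A - mat_adjoint B"
  using assms by (intro eq_matI) auto

lemma mat_adjoint_smult:
  fixes A :: "complex mat"
  shows "mat_adjoint (c \<cdot>\<^sub>m A) = cnj c \<cdot>\<^sub>m mat_adjoint A"
  by (intro eq_matI) auto

lemma mat_adjoint_diag [simp]: "mat_adjoint (mat_diag n f) = mat_diag n (\<lambda>i. cnj (f i))"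
  by (rule eq_matI) (auto simp: mat_diag_def)

lemma mat_trace_carrier:
  "X \<in> carrier_mat n n \<Longrightarrow> mat_trace X = (\<Sum>i<n. X $$ (i, i))"
  unfolding mat_trace_def by auto

lemma mat_trace_mult:
  assumes "A \<in> carrier_mat n k" "B \<in> carrier_mat k n"
  shows "mat_trace (A * B) = (\<Sum>i<n. \<Sum>j<k. A $$ (i, j) * B $$ (j, i))"
  using assms by (subst mat_trace_carrier[of _ n]) (auto simp: mult_mat_index simp del: index_mult_mat(1))

lemma mat_trace_comm:
  assumes "A \<in> carrier_mat n k" "B \<in> carrier_mat k n"
  shows "mat_trace (A * B) = mat_trace (B * A)"
  unfolding mat_trace_mult[OF assms] mat_trace_mult[OF assms(2,1)]
  by (subst sum.swap) (simp add: mult.commute)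

lemma mat_trace_minus:
  assumes "A \<in> carrier_mat n n" "B \<in> carrier_mat n n"
  shows "mat_trace (A - B) = mat_trace A - mat_trace B"
  using assms by (auto simp: mat_trace_def sum_subtractf)

lemma mat_trace_add:
  assumes "A \<in> carrier_mat n n" "B \<in> carrier_mat n n"
  shows "mat_trace (A + B) = mat_trace A + mat_trace B"
  using assms by (auto simp: mat_trace_def sum.distrib)

lemma mat_trace_smult:
  "A \<in> carrier_mat n n \<Longrightarrow> mat_trace (c \<cdot>\<^sub>m A) = c * mat_trace A"
  by (auto simp: mat_trace_def sum_distrib_left)

lemma mat_trace_adjoint:
  "A \<in> carrier_mat n n \<Longrightarrow> mat_trace (mat_adjoint A) = cnj (mat_trace A)"
  by (auto simp: mat_trace_def)

lemma mat_trace_mult_adjoint: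
  assumes "A \<in> carrier_mat n k"
  shows "mat_trace (A * mat_adjoint A) = of_real (\<Sum>i<n. \<Sum>j<k. (cmod (A $$ (i, j)))\<^sup>2)"
  using assms by (subst mat_trace_mult[of _ n k]) (auto simp: complex_norm_square simp flip: of_real_power intro!: sum.cong)

lemma mat_trace_mult_adjoint_eq_0:
  assumes "A \<in> carrier_mat n k" "mat_trace (A * mat_adjoint A) = 0"
  shows "A = 0\<^sub>m n k"
proof -
  have "(\<Sum>i<n. \<Sum>j<k. (cmod (A $$ (i, j)))\<^sup>2) = 0"
    using assms mat_trace_mult_adjoint by (metis of_real_eq_0_iff)
  then have "\<And>i j. i < n \<Longrightarrow> j < k \<Longrightarrow> A $$ (i, j) = 0"
    by (subst (asm) sum_nonneg_eq_0_iff) (auto intro: sum_nonneg simp: sum_nonneg_eq_0_iff)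
  then show ?thesis using assms by (intro eq_matI) auto
qed

lemma quadratic_form_index:
  fixes X :: "complex mat"
  assumes "X \<in> carrier_mat n n" "v \<in> carrier_vec n"
  shows "(X *\<^sub>v v) \<bullet>c v = (\<Sum>i<n. \<Sum>j<n. X $$ (i, j) * v $ j * cnj (v $ i))"
  using assms by (auto simp: scalar_prod_def atLeast0LessThan sum_distrib_right intro!: sum.cong)

lemma psd_mat_carrier: "psd_mat n X \<Longrightarrow> X \<in> carrier_mat n n"
  and psd_mat_adjoint: "psd_mat n X \<Longrightarrow> mat_adjoint X = X"
  unfolding psd_mat_def by auto

text \<open>The quadratic form at v is the squared norm of K^* v; the sums are regrouped by columns
  of K to expose these squares.\<close>

lemma psd_mat_mult_adjoint:
  fixes K :: "complex mat"
  assumes K: "K \<in> carrier_mat n k"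
  shows "psd_mat n (K * mat_adjoint K)"
  unfolding psd_mat_def
proof (intro conjI ballI)
  show "K * mat_adjoint K \<in> carrier_mat n n" using K by auto
  show "mat_adjoint (K * mat_adjoint K) = K * mat_adjoint K"
    using K by (subst mat_adjoint_mult[of _ n k _ n]) auto
  fix v :: "complex vec" assume v: "v \<in> carrier_vec n"
  have "(K * mat_adjoint K *\<^sub>v v) \<bullet>c v =
      (\<Sum>i<n. \<Sum>j<n. (\<Sum>t<k. K $$ (i, t) * cnj (K $$ (j, t))) * v $ j * cnj (v $ i))"
    using K v by (subst quadratic_form_index[of _ n]) (auto simp: mult_mat_index[of _ n k _ n] simp del: index_mult_mat(1) intro!: sum.cong)
  also have "\<dots> = (\<Sum>i<n. \<Sum>j<n. \<Sum>t<k. (cnj (v $ i) * K $$ (i, t)) * cnj (cnj (v $ j) * K $$ (j, t)))"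
    by (simp add: sum_distrib_left sum_distrib_right mult_ac)
  also have "\<dots> = (\<Sum>i<n. \<Sum>t<k. \<Sum>j<n. (cnj (v $ i) * K $$ (i, t)) * cnj (cnj (v $ j) * K $$ (j, t)))"
    by (intro sum.cong refl sum.swap)
  also have "\<dots> = (\<Sum>t<k. \<Sum>i<n. \<Sum>j<n. (cnj (v $ i) * K $$ (i, t)) * cnj (cnj (v $ j) * K $$ (j, t)))"
    by (rule sum.swap)
  also have "\<dots> = (\<Sum>t<k. (\<Sum>i<n. cnj (v $ i) * K $$ (i, t)) * cnj (\<Sum>j<n. cnj (v $ j) * K $$ (j, t)))"
    by (simp add: sum_product)
  also have "\<dots> = of_real (\<Sum>t<k. (cmod (\<Sum>i<n. cnj (v $ i) * K $$ (i, t)))\<^sup>2)"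
    by (simp only: complex_norm_square of_real_sum)
  finally show "0 \<le> Re ((K * mat_adjoint K *\<^sub>v v) \<bullet>c v)"
    by (simp add: sum_nonneg)
qed

section \<open>The spectral theorem and functional calculus\<close>

text \<open>Gram-Schmidt leaves the head of the completed basis in place, so the only change to v is
  the scalar c from normalisation. This supplies the change of basis for deflating a Hermitian
  matrix.\<close>

lemma unitary_with_first_col:
  fixes v :: "complex vec"
  assumes v: "v \<in> carrier_vec n" "v \<noteq> 0\<^sub>v n"
  shows "\<exists>W c. unitary_mat n W \<and> c \<noteq> 0 \<and> col W 0 = c \<cdot>\<^sub>v v"
proof -
  interpret cof_vec_space n "TYPE(complex)" .
  define b where "b = basis_completion v"
  define ws where "ws = gram_schmidt n b"
  define W where "W = mat_of_cols n ws"
  from basis_completion[OF v, folded b_def]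
  have span_b: "span (set b) = carrier_vec n" and dist_b: "distinct b"
    and indep: "\<not> lin_dep (set b)" and b: "set b \<subseteq> carrier_vec n" and hdb: "hd b = v"
    and len_b: "length b = n" by auto
  have n: "n > 0"
  proof (rule ccontr)
    assume "\<not> n > 0"
    then have "v = 0\<^sub>v n" using v(1) by (intro eq_vecI) auto
    then show False using v(2) by simp
  qed
  from hdb len_b n obtain vs where bv: "b = v # vs" by (cases b) auto
  from gram_schmidt_result[OF b dist_b indep refl, folded ws_def]
  have ws: "set ws \<subseteq> carrier_vec n" "corthogonal ws" "length ws = n"
    by (auto simp: len_b)
  from gram_schmidt_hd[OF v(1), of vs, folded bv] have hdws: "hd ws = v" unfolding ws_def .
  have orth: "corthogonal_mat W" using orthogonal_mat_of_cols ws unfolding W_def .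
  have W: "W \<in> carrier_mat n n"
    using ws unfolding W_def using mat_of_cols_carrier(1)[of n ws] by auto
  have col0: "col W 0 = v"
    using ws hdws n unfolding W_def by (cases ws) auto
  \<comment> \<open>The columns of W are orthogonal and nonzero but not of unit length; s i is the
    norm of column i, divided out in V.\<close>
  define s where "s i = complex_of_real (sqrt (Re (col W i \<bullet>c col W i)))" for i
  have inner: "col W i \<bullet>c col W j = (\<Sum>t<n. W $$ (t, i) * cnj (W $$ (t, j)))" if "i < n" "j < n" for i j
    using W that by (auto simp: scalar_prod_def atLeast0LessThan intro!: sum.cong)
  have sq: "col W i \<bullet>c col W i = of_real (\<Sum>t<n. (cmod (W $$ (t, i)))\<^sup>2)" if "i < n" for i
    using inner[OF that that] by (simp only: complex_norm_square of_real_sum)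
  have s2: "s i * s i = col W i \<bullet>c col W i" if "i < n" for i
    unfolding s_def sq[OF that] by (simp add: sum_nonneg flip: of_real_mult)
  have s0: "s i \<noteq> 0" if "i < n" for i
    using s2[OF that] corthogonal_matD[OF orth, of i i] W that by auto
  have cs: "cnj (s i) = s i" for i unfolding s_def by simp
  define V where "V = W * mat_diag n (\<lambda>i. inverse (s i))"
  have V: "V \<in> carrier_mat n n" unfolding V_def using W by (auto simp: mat_diag_dim)
  have Vi: "V $$ (i, j) = W $$ (i, j) * inverse (s j)" if "i < n" "j < n" for i j
    unfolding V_def using W that by (subst mat_diag_mult_right[OF W]) auto
  have VV: "mat_adjoint V * V = 1\<^sub>m n"
  proof (rule eq_matI)
    fix i j assume "i < dim_row (1\<^sub>m n)" "j < dim_col (1\<^sub>m n)"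
    then have ij: "i < n" "j < n" by auto
    have "(mat_adjoint V * V) $$ (i, j) = (\<Sum>t<n. cnj (W $$ (t, i) * inverse (s i)) * (W $$ (t, j) * inverse (s j)))"
      using V ij by (subst mult_mat_index[of _ n n _ n]) (auto simp: Vi)
    also have "\<dots> = inverse (s i) * inverse (s j) * (col W j \<bullet>c col W i)"
      unfolding inner[OF ij(2,1)] by (simp add: sum_distrib_left mult_ac cs)
    also have "\<dots> = (if i = j then 1 else 0)"
      using corthogonal_matD[OF orth, of j i] W ij s2[of i] s0[of i]
      by (auto simp: field_simps)
    finally show "(mat_adjoint V * V) $$ (i, j) = 1\<^sub>m n $$ (i, j)" using ij by simp
  qed (use V in auto)
  then have "V * mat_adjoint V = 1\<^sub>m n"
    using mat_mult_left_right_inverse[of "mat_adjoint V" n V] V by auto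
  with VV V have "unitary_mat n V" unfolding unitary_mat_def by auto
  moreover have "col V 0 = inverse (s 0) \<cdot>\<^sub>v v"
    using n V W by (intro eq_vecI) (auto simp: Vi col0[symmetric])
  ultimately show ?thesis using s0[OF n] by (intro exI[of _ V] exI[of _ "inverse (s 0)"]) auto
qed

lemma unitary_mat_mult:
  assumes "unitary_mat n U" "unitary_mat n V"
  shows "unitary_mat n (U * V)"
proof -
  have c: "U \<in> carrier_mat n n" "V \<in> carrier_mat n n" "mat_adjoint U \<in> carrier_mat n n"
    "mat_adjoint V \<in> carrier_mat n n"
    using assms unfolding unitary_mat_def by auto
  have "U * V * (mat_adjoint V * mat_adjoint U) = U * (V * mat_adjoint V) * mat_adjoint U"
    "mat_adjoint V * mat_adjoint U * (U * V) = mat_adjoint V * (mat_adjoint U * U) * V"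
    using c by (simp_all add: square_mat_simps[where n = n])
  then show ?thesis
    using assms c unfolding unitary_mat_def by (auto simp: mat_adjoint_mult[of U n n V n])
qed

text \<open>Deflation: in an orthonormal basis that starts with an eigenvector, the first column of
  B is a multiple of the first unit vector, and Hermitian symmetry clears the first row as well. The
  remaining n by n block C is Hermitian and is diagonalised by the induction hypothesis.\<close>

theorem hermitian_spectral:
  fixes A :: "complex mat"
  assumes "A \<in> carrier_mat n n" "mat_adjoint A = A"
  shows "\<exists>U d. unitary_mat n U \<and> A = U * mat_diag n (\<lambda>i. complex_of_real (d i)) * mat_adjoint U"
  using assms
proof (induction n arbitrary: A)
  case 0
  then show ?case
    by (intro exI[of _ "1\<^sub>m 0"] exI[of _ "\<lambda>_. 0"]) (auto simp: unitary_mat_def intro!: eq_matI)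
next
  case (Suc n A)
  note A = Suc.prems
  from spectrum_non_empty[OF A(1)] obtain e v where ev: "eigenvector A v e"
    unfolding spectrum_def eigenvalue_def by auto
  then have v: "v \<in> carrier_vec (Suc n)" "v \<noteq> 0\<^sub>v (Suc n)" and Av: "A *\<^sub>v v = e \<cdot>\<^sub>v v"
    using A unfolding eigenvector_def by auto
  from unitary_with_first_col[OF v] obtain W c where W: "unitary_mat (Suc n) W"
    and c: "c \<noteq> 0" "col W 0 = c \<cdot>\<^sub>v v" by auto
  have Wc: "W \<in> carrier_mat (Suc n) (Suc n)" "mat_adjoint W \<in> carrier_mat (Suc n) (Suc n)"
    and WW: "mat_adjoint W * W = 1\<^sub>m (Suc n)" "W * mat_adjoint W = 1\<^sub>m (Suc n)"
    using W unfolding unitary_mat_def by auto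
  define B where "B = mat_adjoint W * A * W"
  have B: "B \<in> carrier_mat (Suc n) (Suc n)" unfolding B_def using Wc A by auto
  have Bh: "mat_adjoint B = B"
    unfolding B_def using Wc A
    by (simp add: mat_adjoint_mult[of _ "Suc n" "Suc n" _ "Suc n"] square_mat_simps[where n = "Suc n"])
  have "col B 0 = mat_adjoint W * A *\<^sub>v col W 0"
    unfolding B_def using Wc A by (subst col_mult2[of _ "Suc n" "Suc n" _ "Suc n"]) auto
  also have "\<dots> = mat_adjoint W *\<^sub>v (A *\<^sub>v (c \<cdot>\<^sub>v v))"
    unfolding c using Wc A v by (subst assoc_mult_mat_vec[of _ "Suc n" "Suc n" _ "Suc n"]) auto
  also have "A *\<^sub>v (c \<cdot>\<^sub>v v) = e \<cdot>\<^sub>v col W 0"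
    unfolding c using A v Av by (subst mult_mat_vec[of _ "Suc n" "Suc n"]) (auto simp: smult_smult_assoc mult.commute)
  also have "mat_adjoint W *\<^sub>v (e \<cdot>\<^sub>v col W 0) = e \<cdot>\<^sub>v (mat_adjoint W *\<^sub>v col W 0)"
    using Wc by (subst mult_mat_vec[of _ "Suc n" "Suc n"]) (auto intro: col_carrier_vec)
  also have "mat_adjoint W *\<^sub>v col W 0 = col (mat_adjoint W * W) 0"
    using Wc by (subst col_mult2[of _ "Suc n" "Suc n" _ "Suc n"]) auto
  finally have colB: "col B 0 = e \<cdot>\<^sub>v unit_vec (Suc n) 0" unfolding WW by simp
  have B0: "B $$ (i, 0) = (if i = 0 then e else 0)" if "i < Suc n" for i
  proof -
    have "B $$ (i, 0) = col B 0 $ i" using B that by auto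
    then show ?thesis unfolding colB using that by (auto simp: unit_vec_def)
  qed
  have Bcnj: "B $$ (j, i) = cnj (B $$ (i, j))" if "i < Suc n" "j < Suc n" for i j
    using mat_adjoint_index[of j B i] B Bh that by auto
  \<comment> \<open>A diagonal entry of a Hermitian matrix is real, so the eigenvalue may enter the
    real sequence D.\<close>
  have e: "e = of_real (Re e)"
    using Bcnj[of 0 0] B0[of 0] by (auto simp: complex_eq_iff)
  define C where "C = mat n n (\<lambda>(i, j). B $$ (Suc i, Suc j))"
  have C: "C \<in> carrier_mat n n" unfolding C_def by auto
  have "mat_adjoint C = C"
    unfolding C_def by (rule eq_matI) (auto intro!: Bcnj[symmetric])
  from Suc.IH[OF C this] obtain V d where V: "unitary_mat n V"
    and CV: "C = V * mat_diag n (\<lambda>i. complex_of_real (d i)) * mat_adjoint V" by auto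
  have Vc: "V \<in> carrier_mat n n" using V unfolding unitary_mat_def by auto
  let ?F = "\<lambda>X Y. four_block_mat (X::complex mat) (0\<^sub>m 1 n) (0\<^sub>m n 1) Y"
  have FF: "?F X Y * ?F X' Y' = ?F (X * X') (Y * Y')"
    if "X \<in> carrier_mat 1 1" "X' \<in> carrier_mat 1 1" "Y \<in> carrier_mat n n" "Y' \<in> carrier_mat n n" for X X' Y Y'
    using that by (subst mult_four_block_mat[of _ 1 1 _ n _ n _ _ 1 _ n]) auto
  have Fadj: "mat_adjoint (?F (1\<^sub>m 1) Y) = ?F (1\<^sub>m 1) (mat_adjoint Y)" if "Y \<in> carrier_mat n n" for Y
    using that by (intro eq_matI) auto
  define D where "D i = (case i of 0 \<Rightarrow> Re e | Suc i \<Rightarrow> d i)" for i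
  have FD: "mat_diag (Suc n) (\<lambda>i. complex_of_real (D i)) = ?F (mat 1 1 (\<lambda>_. e)) (mat_diag n (\<lambda>i. complex_of_real (d i)))"
    using e by (intro eq_matI) (auto simp: D_def mat_diag_def split: nat.splits)
  define V' where "V' = ?F (1\<^sub>m 1) V"
  have V'c: "V' \<in> carrier_mat (Suc n) (Suc n)" unfolding V'_def using Vc by auto
  have FF1: "?F (1\<^sub>m 1) Y * ?F (1\<^sub>m 1) Y' = ?F (1\<^sub>m 1) (Y * Y')"
    if "Y \<in> carrier_mat n n" "Y' \<in> carrier_mat n n" for Y Y'
    using that by (subst FF) auto
  have F1: "?F (1\<^sub>m 1) (1\<^sub>m n) = 1\<^sub>m (Suc n)" by (intro eq_matI) auto
  have V': "unitary_mat (Suc n) V'"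
    using V V'c Vc F1 unfolding unitary_mat_def V'_def Fadj[OF Vc]
      FF1[OF Vc mat_adjoint_carrier[OF Vc]] FF1[OF mat_adjoint_carrier[OF Vc] Vc] by metis
  have "?F (mat 1 1 (\<lambda>_. e)) C = B"
    using B complex_cnj_complex_of_real[of "Re e", unfolded e[symmetric]]
    by (intro eq_matI) (auto simp: C_def B0 Bcnj[of _ 0] Bcnj[of 0])
  moreover have "V' * mat_diag (Suc n) (\<lambda>i. complex_of_real (D i)) * mat_adjoint V' = ?F (1\<^sub>m 1 * mat 1 1 (\<lambda>_. e) * 1\<^sub>m 1) C"
  proof -
    have c: "1\<^sub>m 1 \<in> carrier_mat 1 1" "mat 1 1 (\<lambda>_. e) \<in> carrier_mat 1 1" by auto
    note d = mat_diag_dim[of n "\<lambda>i. complex_of_real (d i)"]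
    show ?thesis
      unfolding V'_def Fadj[OF Vc] FD FF[OF c Vc d] CV
        FF[OF mult_carrier_mat[OF c] c(1) mult_carrier_mat[OF Vc d] mat_adjoint_carrier[OF Vc]] ..
  qed
  moreover have "1\<^sub>m 1 * mat 1 1 (\<lambda>_. e) * 1\<^sub>m 1 = mat 1 1 (\<lambda>_. e)"
    by (rule eq_matI) (auto simp: scalar_prod_def)
  ultimately have BV: "B = V' * mat_diag (Suc n) (\<lambda>i. complex_of_real (D i)) * mat_adjoint V'"
    by simp
  have "W * B * mat_adjoint W = (W * mat_adjoint W) * A * (W * mat_adjoint W)"
    unfolding B_def using Wc A
    by (simp add: square_mat_simps[where n = "Suc n"])
  then have "A = W * B * mat_adjoint W" unfolding WW using A by simp
  also have "\<dots> = (W * V') * mat_diag (Suc n) (\<lambda>i. complex_of_real (D i)) * mat_adjoint (W * V')"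
    unfolding BV using Wc V'c A mat_diag_dim[of "Suc n" "\<lambda>i. complex_of_real (D i)"]
    by (simp add: mat_adjoint_mult[of _ "Suc n" "Suc n" _ "Suc n"] square_mat_simps[where n = "Suc n"])
  finally show ?case using unitary_mat_mult[OF W V'] by blast
qed



lemma psd_mat_spectral:
  assumes X: "psd_mat n X"
  shows "\<exists>U d. unitary_mat n U \<and> (\<forall>i. 0 \<le> d i) \<and>
    X = U * mat_diag n (\<lambda>i. complex_of_real (d i)) * mat_adjoint U"
proof -
  have Xc: "X \<in> carrier_mat n n" using X psd_mat_carrier by auto
  obtain U d where U: "unitary_mat n U" and XU: "X = U * mat_diag n (\<lambda>i. complex_of_real (d i)) * mat_adjoint U"
    using hermitian_spectral[OF Xc psd_mat_adjoint[OF X]] by blast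
  have Uc: "U \<in> carrier_mat n n" "mat_adjoint U * U = 1\<^sub>m n" using U unfolding unitary_mat_def by auto
  have "mat_adjoint U * X * U = (mat_adjoint U * U) * mat_diag n (\<lambda>i. complex_of_real (d i)) * (mat_adjoint U * U)"
    unfolding XU using Uc(1)
    by (simp add: square_mat_simps[where n = n])
  then have D: "mat_adjoint U * (X * U) = mat_diag n (\<lambda>i. complex_of_real (d i))"
    using Uc Xc by (simp add: square_mat_simps[where n = n])
  have "0 \<le> d i" if i: "i < n" for i
  proof -
    have XUi: "(X * U) $$ (t, i) = (\<Sum>j<n. X $$ (t, j) * U $$ (j, i))" if "t < n" for t
      using Xc Uc i that by (subst mult_mat_index) auto
    have "complex_of_real (d i) = (mat_adjoint U * (X * U)) $$ (i, i)"
      unfolding D using i by (simp add: mat_diag_def)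
    also have "\<dots> = (\<Sum>t<n. \<Sum>j<n. X $$ (t, j) * U $$ (j, i) * cnj (U $$ (t, i)))"
      using Xc Uc i by (subst mult_mat_index[of _ n n _ n])
        (auto simp: XUi sum_distrib_left mult_ac simp del: index_mult_mat(1) intro!: sum.cong)
    also have "\<dots> = (X *\<^sub>v col U i) \<bullet>c col U i"
      using Xc Uc i by (subst quadratic_form_index[of _ n]) (auto intro!: sum.cong)
    finally have "d i = Re ((X *\<^sub>v col U i) \<bullet>c col U i)" by (metis Re_complex_of_real)
    then show ?thesis using X Uc i unfolding psd_mat_def by auto
  qed
  \<comment> \<open>Only indices below n enter the matrix, so cutting off at 0 leaves it unchanged
    and makes the sequence nonnegative everywhere.\<close>
  then have "mat_diag n (\<lambda>i. complex_of_real (d i)) = mat_diag n (\<lambda>i. complex_of_real (max 0 (d i)))"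
    by (intro eq_matI) (auto simp: mat_diag_def)
  then show ?thesis using U XU by (intro exI[of _ U] exI[of _ "\<lambda>i. max 0 (d i)"]) auto
qed

lemma mat_fun_eq:
  assumes U: "unitary_mat n U" and X: "X = U * mat_diag n (\<lambda>i. complex_of_real (d i)) * mat_adjoint U"
  shows "mat_fun f X = U * mat_diag n (\<lambda>i. f (d i)) * mat_adjoint U"
proof -
  have Uc: "U \<in> carrier_mat n n" "mat_adjoint U * U = 1\<^sub>m n" "U * mat_adjoint U = 1\<^sub>m n"
    using U unfolding unitary_mat_def by auto
  have dim: "dim_row X = n" using X Uc by auto
  show ?thesis
    unfolding mat_fun_def dim
  proof (rule the_equality)
    show "\<exists>U' d'. unitary_mat n U' \<and> X = U' * mat_diag n (\<lambda>i. complex_of_real (d' i)) * mat_adjoint U' \<and>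
        U * mat_diag n (\<lambda>i. f (d i)) * mat_adjoint U = U' * mat_diag n (\<lambda>i. f (d' i)) * mat_adjoint U'"
      using U X by blast
  next
    fix Y assume "\<exists>V e. unitary_mat n V \<and> X = V * mat_diag n (\<lambda>i. complex_of_real (e i)) * mat_adjoint V \<and>
        Y = V * mat_diag n (\<lambda>i. f (e i)) * mat_adjoint V"
    then obtain V e where V: "unitary_mat n V"
      and XV: "X = V * mat_diag n (\<lambda>i. complex_of_real (e i)) * mat_adjoint V"
      and Y: "Y = V * mat_diag n (\<lambda>i. f (e i)) * mat_adjoint V" by blast
    have Vc: "V \<in> carrier_mat n n" "mat_adjoint V * V = 1\<^sub>m n" "V * mat_adjoint V = 1\<^sub>m n"
      using V unfolding unitary_mat_def by auto
    \<comment> \<open>\<open>W\<close> intertwines the two diagonal matrices, entry by entry, and hence also their images under \<open>f\<close>.\<close>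
    define W where "W = mat_adjoint V * U"
    have W: "W \<in> carrier_mat n n" unfolding W_def using Uc Vc by auto
    note as = square_mat_simps[where n = n]
    have "W * mat_diag n (\<lambda>i. complex_of_real (d i)) = mat_adjoint V * X * U"
      unfolding X W_def using Uc Vc by (simp add: as)
    also have "\<dots> = (mat_adjoint V * V) * mat_diag n (\<lambda>i. complex_of_real (e i)) * W"
      unfolding XV W_def using Uc(1) Vc(1) by (simp add: as)
    also have "\<dots> = mat_diag n (\<lambda>i. complex_of_real (e i)) * W" using Vc W by (simp add: as)
    finally have WW: "W * mat_diag n (\<lambda>i. complex_of_real (d i)) = mat_diag n (\<lambda>i. complex_of_real (e i)) * W" .
    have ent: "W $$ (i, j) * complex_of_real (d j) = complex_of_real (e i) * W $$ (i, j)" if "i < n" "j < n" for i j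
      using arg_cong[OF WW, of "\<lambda>A. A $$ (i, j)"] that W
      by (simp add: mat_diag_mult_left[OF W] mat_diag_mult_right[OF W])
    \<comment> \<open>A nonzero entry of W forces d j = e i, hence f agrees on the two
      eigenvalues.\<close>
    have "W $$ (i, j) * f (d j) = f (e i) * W $$ (i, j)" if "i < n" "j < n" for i j
      using ent[OF that] by (cases "W $$ (i, j) = 0") auto
    then have Wf: "W * mat_diag n (\<lambda>i. f (d i)) = mat_diag n (\<lambda>i. f (e i)) * W"
      using W by (auto simp: mat_diag_mult_left[OF W] mat_diag_mult_right[OF W] intro!: eq_matI)
    have "Y = V * (mat_diag n (\<lambda>i. f (e i)) * W) * mat_adjoint U"
      unfolding Y W_def using Uc Vc by (simp add: as)
    also have "\<dots> = (V * mat_adjoint V) * (U * mat_diag n (\<lambda>i. f (d i)) * mat_adjoint U)"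
      unfolding Wf[symmetric] unfolding W_def using Uc(1) Vc(1) by (simp add: as)
    also have "\<dots> = U * mat_diag n (\<lambda>i. f (d i)) * mat_adjoint U" using Uc Vc by (simp add: as)
    finally show "Y = U * mat_diag n (\<lambda>i. f (d i)) * mat_adjoint U" .
  qed
qed

context
  fixes n :: nat and X :: "complex mat"
  assumes X: "psd_mat n X"
begin

lemma mat_fun_carrier: "mat_fun f X \<in> carrier_mat n n"
proof -
  obtain U d where U: "unitary_mat n U" and XU: "X = U * mat_diag n (\<lambda>i. complex_of_real (d i)) * mat_adjoint U"
    using psd_mat_spectral[OF X] by blast
  show ?thesis unfolding mat_fun_eq[OF U XU]
    using U mat_diag_dim[of n "\<lambda>i. f (d i)"] unfolding unitary_mat_def by auto
qed

text \<open>The order of quantifiers matters: one pair U, d serves all f at once, so a family such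
  as z -> X^z can be differentiated and bounded with the spectral data held fixed.\<close>

lemma mat_fun_index:
  "\<exists>U d. (\<forall>i. 0 \<le> d i) \<and> (\<forall>f. \<forall>i<n. \<forall>j<n. mat_fun f X $$ (i, j) = (\<Sum>t<n. U $$ (i, t) * f (d t) * cnj (U $$ (j, t))))"
proof -
  obtain U d where U: "unitary_mat n U" and d: "\<forall>i. 0 \<le> d i" and XU: "X = U * mat_diag n (\<lambda>i. complex_of_real (d i)) * mat_adjoint U"
    using psd_mat_spectral[OF X] by blast
  have Uc: "U \<in> carrier_mat n n" using U unfolding unitary_mat_def by auto
  have "mat_fun f X $$ (i, j) = (\<Sum>t<n. U $$ (i, t) * f (d t) * cnj (U $$ (j, t)))" if "i < n" "j < n" for f i j
    unfolding mat_fun_eq[OF U XU] using that Uc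
    by (subst mult_mat_index[of _ n n _ n])
      (auto simp: mat_diag_dim mat_diag_mult_right[OF Uc] simp del: index_mult_mat(1))
  then show ?thesis using d by blast
qed

lemma mat_fun_cong: "(\<And>x. 0 \<le> x \<Longrightarrow> f x = g x) \<Longrightarrow> mat_fun f X = mat_fun g X"
  using mat_fun_index mat_fun_carrier[of f] mat_fun_carrier[of g]
  by (intro eq_matI) auto

lemma mat_fun_mult: "mat_fun f X * mat_fun g X = mat_fun (\<lambda>x. f x * g x) X"
proof -
  obtain U d where U: "unitary_mat n U" and XU: "X = U * mat_diag n (\<lambda>i. complex_of_real (d i)) * mat_adjoint U"
    using psd_mat_spectral[OF X] by blast
  have Uc: "U \<in> carrier_mat n n" "mat_adjoint U * U = 1\<^sub>m n" using U unfolding unitary_mat_def by auto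
  note as = square_mat_simps[where n = n]
  have "mat_fun f X * mat_fun g X =
      U * mat_diag n (\<lambda>i. f (d i)) * (mat_adjoint U * U) * mat_diag n (\<lambda>i. g (d i)) * mat_adjoint U"
    unfolding mat_fun_eq[OF U XU] using Uc(1) by (simp add: as del: mat_diag_diag)
  also have "\<dots> = U * (mat_diag n (\<lambda>i. f (d i)) * mat_diag n (\<lambda>i. g (d i))) * mat_adjoint U"
    using Uc by (simp add: as del: mat_diag_diag)
  finally show ?thesis unfolding mat_fun_eq[OF U XU] by simp
qed

lemma mat_fun_adjoint: "mat_adjoint (mat_fun f X) = mat_fun (\<lambda>x. cnj (f x)) X"
proof -
  obtain U d where U: "unitary_mat n U" and XU: "X = U * mat_diag n (\<lambda>i. complex_of_real (d i)) * mat_adjoint U"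
    using psd_mat_spectral[OF X] by blast
  have Uc: "U \<in> carrier_mat n n" using U unfolding unitary_mat_def by auto
  show ?thesis unfolding mat_fun_eq[OF U XU] using Uc
    by (simp add: mat_adjoint_mult[of _ n n _ n] square_mat_simps[where n = n])
qed

lemma mat_fun_ident: "mat_fun complex_of_real X = X"
proof -
  obtain U d where U: "unitary_mat n U" and XU: "X = U * mat_diag n (\<lambda>i. complex_of_real (d i)) * mat_adjoint U"
    using psd_mat_spectral[OF X] by blast
  show ?thesis unfolding mat_fun_eq[OF U XU] by (rule XU[symmetric])
qed

lemma psd_mat_factor: "\<exists>K\<in>carrier_mat n n. X = K * mat_adjoint K"
proof (intro bexI)
  have "mat_fun (\<lambda>x. complex_of_real (sqrt x)) X * mat_adjoint (mat_fun (\<lambda>x. complex_of_real (sqrt x)) X)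
      = mat_fun complex_of_real X"
    unfolding mat_fun_adjoint mat_fun_mult by (rule mat_fun_cong) (simp flip: of_real_mult)
  then show "X = mat_fun (\<lambda>x. complex_of_real (sqrt x)) X * mat_adjoint (mat_fun (\<lambda>x. complex_of_real (sqrt x)) X)"
    using mat_fun_ident by simp
qed (rule mat_fun_carrier)

end

text \<open>With M = K K^* and N = L L^* the trace is the squared Hilbert-Schmidt norm of K^* L.
  Reality is kept in the conclusion because outcome probabilities must become real
  diagonals.\<close>

lemma mat_trace_mult_psd:
  assumes "psd_mat n M" "psd_mat n N"
  shows "\<exists>r\<ge>0. mat_trace (M * N) = complex_of_real r"
proof -
  obtain K L where K: "K \<in> carrier_mat n n" "M = K * mat_adjoint K" and L: "L \<in> carrier_mat n n" "N = L * mat_adjoint L"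
    using assms psd_mat_factor by metis
  have "mat_trace (M * N) = mat_trace (K * (mat_adjoint K * L * mat_adjoint L))"
    unfolding K(2) L(2) using K(1) L(1) by (simp add: square_mat_simps[where n = n])
  also have "\<dots> = mat_trace ((mat_adjoint K * L * mat_adjoint L) * K)"
    using K(1) L(1) by (intro mat_trace_comm[of _ n n]) auto
  also have "\<dots> = mat_trace ((mat_adjoint K * L) * mat_adjoint (mat_adjoint K * L))"
    using K(1) L(1) by (simp add: mat_adjoint_mult[of _ n n _ n] square_mat_simps[where n = n])
  also have "\<dots> = of_real (\<Sum>i<n. \<Sum>j<n. (cmod ((mat_adjoint K * L) $$ (i, j)))\<^sup>2)"
    using K(1) L(1) by (intro mat_trace_mult_adjoint) auto
  finally show ?thesis by (intro exI[of _ "\<Sum>i<n. \<Sum>j<n. (cmod ((mat_adjoint K * L) $$ (i, j)))\<^sup>2"] conjI)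
    (auto intro!: sum_nonneg)
qed

lemma psd_mat_conj:
  assumes "psd_mat n X" "Y \<in> carrier_mat k n"
  shows "psd_mat k (Y * X * mat_adjoint Y)"
proof -
  obtain K where K: "K \<in> carrier_mat n n" "X = K * mat_adjoint K" using psd_mat_factor[OF assms(1)] by blast
  have "mat_adjoint K * mat_adjoint Y \<in> carrier_mat n k" using K(1) assms(2) by auto
  then have "Y * X * mat_adjoint Y = (Y * K) * mat_adjoint (Y * K)"
    unfolding K(2) using K(1) assms(2)
    by (simp add: mat_adjoint_mult[of Y k n K n] assoc_mult_mat[of Y k n K n _ k] assoc_mult_mat[of Y k n _ n _ k] assoc_mult_mat[of K n n _ n _ k])
  then show ?thesis using psd_mat_mult_adjoint[of "Y * K" k n] K(1) assms(2) by simp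
qed

text \<open>For X = K K^* and a projection P the trace of P X is the squared Hilbert-Schmidt norm of
  P K. This turns a vanishing expectation on a marginal into an operator identity for the bipartite
  state.\<close>

lemma mat_trace_mult_psd_eq_0:
  assumes P: "P \<in> carrier_mat n n" "mat_adjoint P = P" "P * P = P" and X: "psd_mat n X"
    and 0: "mat_trace (P * X) = 0"
  shows "P * X = 0\<^sub>m n n"
proof -
  obtain K where K: "K \<in> carrier_mat n n" "X = K * mat_adjoint K" using psd_mat_factor[OF X] by blast
  note as = square_mat_simps[where n = n]
  have "mat_trace ((P * K) * mat_adjoint (P * K)) = mat_trace (P * (K * mat_adjoint K * P))"
    using K(1) P(1,2) by (simp add: as mat_adjoint_mult[of P n n K n])
  also have "\<dots> = mat_trace (K * mat_adjoint K * P * P)"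
    using K(1) P(1) by (intro mat_trace_comm[of _ n n]) auto
  also have "\<dots> = mat_trace (X * P)"
    unfolding K(2) using K(1) P(1,3) by (simp add: as)
  also have "\<dots> = mat_trace (P * X)"
    using psd_mat_carrier[OF X] P(1) by (intro mat_trace_comm[of _ n n]) auto
  finally have "P * K = 0\<^sub>m n n"
    using 0 K(1) P(1) mat_trace_mult_adjoint_eq_0[of "P * K" n n] by simp
  moreover have "P * X = (P * K) * mat_adjoint K"
    unfolding K(2) using K(1) P(1) by (simp add: as)
  ultimately show ?thesis using K(1) by simp
qed

section \<open>The Poisson formula for the strip\<close>

lemma cosh_add_one_pos: "0 < cosh x + (1::real)"
  using cosh_real_pos[of x] by linarith

lemma beta0_nonneg: "0 \<le> beta0 t"
  unfolding beta0_def using cosh_add_one_pos[of "pi * t"] by simp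

text \<open>Since cosh(2u) + 1 = 2 cosh(u)^2, the weight is (pi/4) / cosh(pi t / 2)^2. The limits
  1/2 and -1/2 of this primitive give total mass 1.\<close>

lemma beta0_has_antiderivative:
  "((\<lambda>t. tanh (pi / 2 * t) / 2) has_real_derivative beta0 t) (at t)"
proof -
  define u where "u = pi / 2 * t"
  have c: "cosh u \<noteq> 0" using cosh_real_pos[of u] by linarith
  have "pi * t = 2 * u" unfolding u_def by simp
  then have "beta0 t = pi / 2 * inverse (2 * (cosh u)\<^sup>2)"
    unfolding beta0_def by (simp add: cosh_double_cosh)
  also have "inverse (2 * (cosh u)\<^sup>2) = ((cosh u)\<^sup>2 - (sinh u)\<^sup>2) / (cosh u)\<^sup>2 / 2"
    unfolding hyperbolic_pythagoras by (simp add: field_simps)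
  also have "\<dots> = (1 - (tanh u)\<^sup>2) / 2"
    using c by (simp add: tanh_def power_divide diff_divide_distrib)
  finally have "(1 - (tanh (pi / 2 * t))\<^sup>2) * (pi / 2) / 2 = beta0 t" unfolding u_def by simp
  then show ?thesis
    using c unfolding u_def by (auto intro!: derivative_eq_intros)
qed

lemma continuous_beta0: "continuous_on S beta0"
  unfolding beta0_def
  by (intro continuous_intros ballI) (use cosh_add_one_pos in \<open>auto simp: less_imp_neq[symmetric]\<close>)

lemma beta0_measurable [measurable]: "beta0 \<in> borel_measurable borel"
  by (rule borel_measurable_continuous_onI) (rule continuous_beta0)

lemma integrable_beta0: "integrable lborel beta0"
  and integral_beta0: "(\<integral>t. beta0 t \<partial>lborel) = 1"
proof -
  have 1: "((\<lambda>t. tanh (pi / 2 * t) / 2 :: real) \<longlongrightarrow> 1 / 2) at_top"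
    by (intro tendsto_divide tendsto_const filterlim_compose[OF tanh_real_at_top]
        filterlim_tendsto_pos_mult_at_top[OF tendsto_const] filterlim_ident) auto
  have 2: "((\<lambda>t. tanh (pi / 2 * t) / 2 :: real) \<longlongrightarrow> - 1 / 2) at_bot"
    by (intro tendsto_divide tendsto_const filterlim_compose[OF tanh_real_at_bot]
        filterlim_tendsto_pos_mult_at_bot[OF tendsto_const] filterlim_ident) auto
  have a: "set_integrable lborel (einterval (-\<infinity>) \<infinity>) beta0"
    and b: "(LBINT t=-\<infinity>..\<infinity>. beta0 t) = 1 / 2 - (- 1 / 2)"
    by (rule interval_integral_FTC_nonneg[where F = "\<lambda>t. tanh (pi / 2 * t) / 2"];
      use 1 2 beta0_has_antiderivative beta0_nonneg continuous_beta0[of UNIV] in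
        \<open>auto simp: ereal_tendsto_simps continuous_on_eq_continuous_at\<close>)+
  show "integrable lborel beta0" using a by (simp add: set_integrable_def)
  show "(\<integral>t. beta0 t \<partial>lborel) = 1"
    using b by (simp add: interval_lebesgue_integral_def set_lebesgue_integral_def)
qed

text \<open>The Poisson kernel at the point \<open>\<theta>\<close>, for the left edge (\<open>s = -1\<close>) and the right edge (\<open>s = 1\<close>).\<close>

definition strip_kernel :: "real \<Rightarrow> real \<Rightarrow> real \<Rightarrow> real" where
  "strip_kernel s \<theta> t = sin (pi * \<theta>) / (2 * (cosh (pi * t) + s * cos (pi * \<theta>)))"

lemma abs_cos_less_one:
  assumes "0 < \<theta>" "\<theta> < 1"
  shows "\<bar>cos (pi * \<theta>)\<bar> < 1"
proof -
  have "0 < sin (pi * \<theta>)" using assms by (intro sin_gt_zero) auto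
  then have "(cos (pi * \<theta>))\<^sup>2 < 1\<^sup>2" using sin_cos_squared_add[of "pi * \<theta>"] by (simp add: power2_eq_square) (smt (verit) mult_pos_pos)
  then show ?thesis by (metis abs_1 abs_le_square_iff not_le)
qed

context
  fixes s \<theta> :: real
  assumes s: "\<bar>s\<bar> = 1" and \<theta>: "0 < \<theta>" "\<theta> < 1"
begin

text \<open>With a = |cos(pi theta)| and c = cosh(pi t), the right side is at least c - a, which
  exceeds the left side by (1 + a)(c - 1)/2. Comparison with the denominator of \<open>beta0\<close>
  reduces integrability of both kernels to that of \<open>beta0\<close>.\<close>

lemma strip_kernel_denominator:
  "(1 - \<bar>cos (pi * \<theta>)\<bar>) / 2 * (cosh (pi * t) + 1) \<le> cosh (pi * t) + s * cos (pi * \<theta>)"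
proof -
  define a where "a = \<bar>cos (pi * \<theta>)\<bar>"
  define c where "c = cosh (pi * t)"
  have "a < 1" "0 \<le> a" unfolding a_def using abs_cos_less_one[OF \<theta>] by auto
  moreover have "1 \<le> c" unfolding c_def by (rule cosh_real_ge_1)
  ultimately have "0 \<le> (1 + a) * (c - 1)" by simp
  then have "(1 - a) / 2 * (c + 1) \<le> c - a" by (simp add: field_simps)
  moreover have "- a \<le> s * cos (pi * \<theta>)"
    unfolding a_def using s by (cases "s = 1") (auto simp: abs_if split: if_splits)
  ultimately show ?thesis unfolding a_def c_def by linarith
qed

lemma strip_kernel_denominator_pos: "0 < cosh (pi * t) + s * cos (pi * \<theta>)"
  using strip_kernel_denominator[of t] cosh_add_one_pos[of "pi * t"] abs_cos_less_one[OF \<theta>]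
  by (smt (verit) divide_pos_pos mult_pos_pos)

lemma strip_kernel_nonneg: "0 \<le> strip_kernel s \<theta> t"
proof -
  have "0 < sin (pi * \<theta>)" using \<theta> by (intro sin_gt_zero) auto
  then show ?thesis unfolding strip_kernel_def using strip_kernel_denominator_pos[of t] by simp
qed

lemma strip_kernel_measurable [measurable]: "strip_kernel s \<theta> \<in> borel_measurable borel"
  unfolding strip_kernel_def
  by (intro borel_measurable_continuous_onI continuous_intros ballI)
    (metis strip_kernel_denominator_pos less_irrefl mult_eq_0_iff zero_neq_numeral)

lemma strip_kernel_le:
  "strip_kernel s \<theta> t \<le> 2 / (1 - \<bar>cos (pi * \<theta>)\<bar>) * beta0 t"
proof -
  define a where "a = 1 - \<bar>cos (pi * \<theta>)\<bar>"
  have a: "a > 0" unfolding a_def using abs_cos_less_one[OF \<theta>] by simp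
  have p: "cosh (pi * t) + 1 > 0" by (rule cosh_add_one_pos)
  have "0 < sin (pi * \<theta>)" using \<theta> by (intro sin_gt_zero) auto
  have "strip_kernel s \<theta> t \<le> 1 / (2 * (cosh (pi * t) + s * cos (pi * \<theta>)))"
    unfolding strip_kernel_def using strip_kernel_denominator_pos[of t] by (intro divide_right_mono) auto
  also have "\<dots> \<le> 1 / (a * (cosh (pi * t) + 1))"
    using strip_kernel_denominator[of t] a p unfolding a_def[symmetric]
    by (intro divide_left_mono mult_pos_pos) (auto simp: strip_kernel_denominator_pos)
  \<comment> \<open>The lossy factor pi >= 1 turns the bound into a multiple of
    \<open>beta0\<close>, whose numerator is pi/2.\<close>
  also have "\<dots> \<le> pi / (a * (cosh (pi * t) + 1))"
    using pi_ge_two a p by (intro divide_right_mono mult_nonneg_nonneg) auto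
  also have "\<dots> = 2 / a * beta0 t"
  proof -
    have "pi / (a * c) = 2 / a * (pi / 2 * inverse c)" if "c > 0" for c
      using a that by (simp add: field_simps)
    then show ?thesis unfolding beta0_def using p by blast
  qed
  finally show ?thesis unfolding a_def .
qed

lemma integrable_strip_kernel_mult:
  fixes g :: "real \<Rightarrow> 'a :: {banach, second_countable_topology}"
  assumes [measurable]: "g \<in> borel_measurable borel" and B: "\<And>t. norm (g t) \<le> B"
  shows "integrable lborel (\<lambda>t. strip_kernel s \<theta> t *\<^sub>R g t)"
proof (rule Bochner_Integration.integrable_bound)
  show "integrable lborel (\<lambda>t. 2 / (1 - \<bar>cos (pi * \<theta>)\<bar>) * beta0 t * B)"
    by (intro integrable_mult_left integrable_mult_right integrable_beta0)
  have "norm (strip_kernel s \<theta> t *\<^sub>R g t) \<le> 2 / (1 - \<bar>cos (pi * \<theta>)\<bar>) * beta0 t * B" for t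
    using mult_mono[OF strip_kernel_le[of t] B[of t]] strip_kernel_nonneg[of t] order.trans[OF strip_kernel_nonneg[of t] strip_kernel_le[of t]]
    by simp
  then have "norm (strip_kernel s \<theta> t *\<^sub>R g t) \<le> norm (2 / (1 - \<bar>cos (pi * \<theta>)\<bar>) * beta0 t * B)" for t
    unfolding real_norm_def using abs_ge_self order.trans by blast
  then show "AE t in lborel. norm (strip_kernel s \<theta> t *\<^sub>R g t) \<le> norm (2 / (1 - \<bar>cos (pi * \<theta>)\<bar>) * beta0 t * B)"
    by simp
qed measurable

end

section \<open>The Poisson formula by residues on rectangles\<close>

lemma entire_line_continuous:
  "h holomorphic_on UNIV \<Longrightarrow> continuous_on UNIV (\<lambda>t. h (Complex c t))"
  by (rule continuous_on_compose2[OF holomorphic_on_imp_continuous_on[of h UNIV]])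
    (auto simp: Complex_eq intro!: continuous_intros)

lemma entire_line_measurable:
  "h holomorphic_on UNIV \<Longrightarrow> (\<lambda>t. h (Complex c t)) \<in> borel_measurable borel"
  by (intro borel_measurable_continuous_onI entire_line_continuous)

text \<open>The solutions of cos(pi z) = cos(pi theta) are theta + 2k and -theta + 2k. The bounds
  -theta and 2 - theta are the solutions next to theta, so this is the widest open vertical strip
  around the closed unit strip with a single pole.\<close>

lemma cos_ne_in_strip:
  assumes \<theta>: "0 < \<theta>" "\<theta> < 1" and z: "- \<theta> < Re z" "Re z < 2 - \<theta>" "z \<noteq> of_real \<theta>"
  shows "cos (of_real (pi * \<theta>)) \<noteq> cos (of_real pi * z)"
proof
  assume "cos (of_real (pi * \<theta>)) = cos (of_real pi * z)"
  then obtain k where "of_real pi * z = of_real (pi * \<theta>) + of_real (2 * of_int k * pi) \<or>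
      of_real pi * z = - of_real (pi * \<theta>) + of_real (2 * of_int k * pi)"
    using complex_cos_eq[of "of_real pi * z" "of_real (pi * \<theta>)"]
    by (metis (no_types, lifting) Ints_cases of_real_of_int_eq)
  then have "z = of_real (\<theta> + 2 * of_int k) \<or> z = of_real (- \<theta> + 2 * of_int k)"
    by (auto simp: complex_eq_iff algebra_simps) (metis distrib_left mult_cancel_left pi_neq_zero mult.left_commute mult.commute minus_mult_right)+
  then consider "z = of_real (\<theta> + 2 * of_int k)" | "z = of_real (- \<theta> + 2 * of_int k)" by blast
  then show False
  proof cases
    case 1
    then have "- 1 < real_of_int k" "real_of_int k < 1" using z \<theta> by auto
    then have "k = 0" by linarith
    then show False using 1 z by simp
  next
    case 2
    then have "0 < real_of_int k" "real_of_int k < 1" using z \<theta> by auto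
    then have "0 < k" "k < 1" by linarith+
    then show False by simp
  qed
qed

context
  fixes h :: "complex \<Rightarrow> complex" and B \<theta> :: real
  assumes holo: "h holomorphic_on UNIV"
    and bdd: "\<And>z. 0 \<le> Re z \<Longrightarrow> Re z \<le> 1 \<Longrightarrow> norm (h z) \<le> B"
    and \<theta>: "0 < \<theta>" "\<theta> < 1"
begin

text \<open>The constant pi sin(pi theta) is the derivative of the denominator at theta, so the
  residue there is h(theta). On the two edges cos(pi z) equals cosh(pi t) and -cosh(pi t), which
  produces the two Poisson kernels.\<close>

definition strip_integrand :: "complex \<Rightarrow> complex" where
  "strip_integrand z = (h z * of_real (pi * sin (pi * \<theta>))) / (cos (of_real (pi * \<theta>)) - cos (of_real pi * z))"

lemma strip_integrand_contour:
  assumes R: "0 < R"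
  shows "contour_integral (rectpath (Complex 0 (- R)) (Complex 1 R)) strip_integrand = 2 * pi * \<i> * h (of_real \<theta>)"
proof -
  define S where "S = {z. - \<theta> < Re z \<and> Re z < 2 - \<theta>}"
  have S: "open S" "connected S" "convex S"
  proof -
    have "S = {z. - \<theta> < Re z} \<inter> {z. Re z < 2 - \<theta>}" unfolding S_def by auto
    then show "open S" "convex S"
      by (auto intro!: open_Int convex_Int open_halfspace_Re_gt open_halfspace_Re_lt
          convex_halfspace_Re_gt convex_halfspace_Re_lt)
    then show "connected S" using convex_connected by blast
  qed
  let ?p = "of_real \<theta> :: complex" and ?\<gamma> = "rectpath (Complex 0 (- R)) (Complex 1 R)"
  let ?d = "\<lambda>z. cos (of_real (pi * \<theta>)) - cos (of_real pi * z) :: complex"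
  have sub: "cbox (Complex 0 (- R)) (Complex 1 R) \<subseteq> S"
    unfolding S_def using \<theta> by (auto simp: in_cbox_complex_iff)
  have box: "?p \<in> box (Complex 0 (- R)) (Complex 1 R)" using \<theta> R by (auto simp: in_box_complex_iff)
  have pS: "?p \<in> S" using \<theta> unfolding S_def by auto
  have im: "path_image ?\<gamma> \<subseteq> S - {?p}"
    using path_image_rectpath_cbox_minus_box[of "Complex 0 (- R)" "Complex 1 R"] R sub box by auto
  have "contour_integral ?\<gamma> strip_integrand =
      2 * pi * \<i> * (\<Sum>p\<in>{?p}. winding_number ?\<gamma> p * residue strip_integrand p)"
  proof (rule Residue_theorem)
    show "strip_integrand holomorphic_on S - {?p}"
      unfolding strip_integrand_def
      using cos_ne_in_strip[OF \<theta>]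
      by (intro holomorphic_intros holomorphic_on_subset[OF holo]) (auto simp: S_def)
    show "\<forall>z. z \<notin> S \<longrightarrow> winding_number ?\<gamma> z = 0"
      using sub path_image_rectpath_subset_cbox[of "Complex 0 (- R)" "Complex 1 R"] R
      by (intro allI impI winding_number_zero_outside[of _ "cbox (Complex 0 (- R)) (Complex 1 R)"]) auto
  qed (use S im in auto)
  also have "\<dots> = 2 * pi * \<i> * residue strip_integrand ?p"
    using winding_number_rectpath[OF box] by simp
  also have "residue strip_integrand ?p = h ?p"
  proof -
    define w where "w = of_real (pi * sin (pi * \<theta>)) * (1::complex)"
    have s: "0 < sin (pi * \<theta>)" using \<theta> by (intro sin_gt_zero) auto
    have w: "w \<noteq> 0" unfolding w_def using s by simp
    have der: "(?d has_field_derivative w) (at ?p)"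
      unfolding w_def by (auto intro!: derivative_eq_intros simp: sin_of_real mult.commute simp flip: of_real_mult)
    have res: "residue (\<lambda>z. (h z * of_real (pi * sin (pi * \<theta>))) / ?d z) ?p = (h ?p * of_real (pi * sin (pi * \<theta>))) / w"
      if "h ?p \<noteq> 0"
      by (rule residue_simple_pole_deriv[of _ S])
        (use der S pS that s w in \<open>auto intro!: holomorphic_intros holomorphic_on_subset[OF holo]\<close>)
    \<comment> \<open>The residue rule needs a nonzero numerator at the pole, so a vanishing \<open>h\<close> is shifted by 1.\<close>
    have "residue strip_integrand ?p = 0" if "h ?p = 0"
    proof -
      let ?c = "of_real (pi * sin (pi * \<theta>)) :: complex"
      have hol: "(\<lambda>z. g z * ?c / ?d z) holomorphic_on S - {?p}" if "g holomorphic_on UNIV" for g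
        using cos_ne_in_strip[OF \<theta>]
        by (intro holomorphic_intros holomorphic_on_subset[OF that]) (auto simp: S_def)
      have r: "residue (\<lambda>z. g z * ?c / ?d z) ?p = ?c / w" if "g holomorphic_on UNIV" "g ?p = 1" for g
        using residue_simple_pole_deriv[of "\<lambda>z. g z * ?c" S ?d ?p w] der S pS s w that
        by (force intro!: holomorphic_intros holomorphic_on_subset[OF that(1)])
      have "strip_integrand = (\<lambda>z. (h z + 1) * ?c / ?d z - 1 * ?c / ?d z)"
        unfolding strip_integrand_def by (auto simp: fun_eq_iff algebra_simps simp flip: diff_divide_distrib)
      then have "residue strip_integrand ?p =
          residue (\<lambda>z. (h z + 1) * ?c / ?d z) ?p - residue (\<lambda>z. 1 * ?c / ?d z) ?p"
        using residue_diff[of S ?p "\<lambda>z. (h z + 1) * ?c / ?d z" "\<lambda>z. 1 * ?c / ?d z"]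
          hol[of "\<lambda>z. h z + 1"] hol[of "\<lambda>_. 1"] S pS holo by (simp add: holomorphic_on_add)
      also have "\<dots> = 0"
        using r[of "\<lambda>z. h z + 1"] r[of "\<lambda>_. 1"] holo that by (simp add: holomorphic_on_add)
      finally show ?thesis .
    qed
    with res w show ?thesis unfolding strip_integrand_def w_def by (cases "h ?p = 0") auto
  qed
  finally show ?thesis by simp
qed

text \<open>The two exponentials in the cosine have moduli exp(y) and exp(-y), and the reverse
  triangle inequality leaves their difference. This makes the integrand decay on the horizontal
  sides of tall rectangles.\<close>

lemma norm_cos_ge_sinh:
  fixes z :: complex
  assumes "0 \<le> y" "\<bar>Im z\<bar> = y"
  shows "sinh y \<le> norm (cos z)"
proof -
  have e: "norm (exp (\<i> * z)) = exp (- Im z)" "norm (exp (- (\<i> * z))) = exp (Im z)"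
    by (simp_all add: norm_exp_eq_Re)
  have "norm (exp (\<i> * z) + exp (- (\<i> * z))) \<ge> \<bar>exp (- Im z) - exp (Im z)\<bar>"
    using norm_triangle_ineq3[of "exp (\<i> * z)" "- exp (- (\<i> * z))"] by (simp only: norm_minus_cancel e) simp
  moreover have "\<bar>exp (- Im z) - exp (Im z)\<bar> = 2 * sinh y"
    using assms by (auto simp: sinh_field_def abs_if)
  ultimately show ?thesis by (simp add: cos_exp_eq norm_divide)
qed

lemma strip_integrand_right: "strip_integrand (Complex 1 t) = 2 * pi * (strip_kernel 1 \<theta> t *\<^sub>R h (Complex 1 t))"
proof -
  have "cos (of_real pi * Complex 1 t) = - of_real (cosh (pi * t))"
    by (simp add: complex_eq_iff Re_cos Im_cos cosh_field_def field_simps)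
  then have "strip_integrand (Complex 1 t) =
      h (Complex 1 t) * of_real (pi * sin (pi * \<theta>)) / of_real (cosh (pi * t) + cos (pi * \<theta>))"
    unfolding strip_integrand_def cos_of_real by (simp add: add.commute)
  also have "\<dots> = h (Complex 1 t) * of_real (2 * pi * strip_kernel 1 \<theta> t)"
  proof -
    have "2 * pi * strip_kernel 1 \<theta> t = pi * sin (pi * \<theta>) / (cosh (pi * t) + cos (pi * \<theta>))"
    proof -
      have "2 * pi * (a / (2 * b)) = pi * a / b" for a b :: real by simp
      then show ?thesis unfolding strip_kernel_def mult_1 .
    qed
    then show ?thesis by simp
  qed
  finally show ?thesis by (simp add: scaleR_conv_of_real)
qed

text \<open>The minus sign comes from cos(pi theta) - cosh(pi t) being negative; it cancels against
  the downward orientation of the left edge in the contour.\<close>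

lemma strip_integrand_left: "strip_integrand (Complex 0 t) = - (2 * pi * (strip_kernel (- 1) \<theta> t *\<^sub>R h (Complex 0 t)))"
proof -
  have "cos (of_real pi * Complex 0 t) = of_real (cosh (pi * t))"
    by (simp add: complex_eq_iff Re_cos Im_cos cosh_field_def)
  moreover have "complex_of_real (cosh (pi * t)) - of_real (cos (pi * \<theta>)) \<noteq> 0"
    using strip_kernel_denominator_pos[of "- 1" \<theta> t] \<theta> by (simp flip: of_real_diff)
  ultimately show ?thesis
    unfolding strip_integrand_def strip_kernel_def cos_of_real
    by (simp add: scaleR_conv_of_real divide_simps) (simp add: algebra_simps)
qed

lemma strip_integrand_horizontal:
  assumes z: "0 \<le> Re z" "Re z \<le> 1" "\<bar>Im z\<bar> = R" and R: "1 < sinh (pi * R)" "0 < R"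
  shows "norm (strip_integrand z) \<le> B * pi / (sinh (pi * R) - 1)"
proof -
  have "sinh (pi * R) \<le> norm (cos (of_real pi * z))"
    using z R by (intro norm_cos_ge_sinh) (auto simp: abs_mult)
  moreover have "norm (cos (of_real (pi * \<theta>)) :: complex) \<le> 1" by (simp only: cos_of_real norm_of_real) simp
  ultimately have d: "sinh (pi * R) - 1 \<le> norm (cos (of_real (pi * \<theta>)) - cos (of_real pi * z))"
    using norm_triangle_ineq3[of "cos (of_real (pi * \<theta>))" "cos (of_real pi * z)"] by linarith
  have "\<bar>pi * sin (pi * \<theta>)\<bar> \<le> pi" using abs_sin_le_one[of "pi * \<theta>"] by (simp add: abs_mult)
  then have "norm (h z * of_real (pi * sin (pi * \<theta>))) \<le> B * pi"
    unfolding norm_mult norm_of_real using bdd[OF z(1,2)] order.trans[OF norm_ge_zero bdd[OF z(1,2)]]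
    by (intro mult_mono) auto
  then show ?thesis
    unfolding strip_integrand_def norm_divide using d R order.trans[OF norm_ge_zero bdd[OF z(1,2)]]
    by (intro frac_le) auto
qed

text \<open>In the residue theorem on the rectangles [0,1] x [-k,k] the horizontal sides vanish as k
  grows, and the vertical sides tend to the two full-line integrals.\<close>

theorem strip_poisson:
  "h (of_real \<theta>) = (\<integral>t. strip_kernel (- 1) \<theta> t *\<^sub>R h (Complex 0 t) \<partial>lborel) +
     (\<integral>t. strip_kernel 1 \<theta> t *\<^sub>R h (Complex 1 t) \<partial>lborel)"
proof -
  define F where "F c s t = strip_kernel s \<theta> t *\<^sub>R h (Complex c t)" for c s t
  have int: "integrable lborel (F 0 (- 1))" "integrable lborel (F 1 1)"
    unfolding F_def using \<theta>
    by (auto intro!: integrable_strip_kernel_mult[where B = B] entire_line_measurable[OF holo] bdd)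
  have lim: "(\<lambda>k::nat. \<integral>t\<in>{- real k..real k}. f t \<partial>lborel) \<longlonglongrightarrow> (\<integral>t. f t \<partial>lborel)"
    if f: "integrable lborel f" for f :: "real \<Rightarrow> complex"
    unfolding set_lebesgue_integral_def
  proof (rule integral_dominated_convergence[where w = "\<lambda>t. norm (f t)"])
    show "AE t in lborel. (\<lambda>k. indicat_real {- real k..real k} t *\<^sub>R f t) \<longlonglongrightarrow> f t"
    proof (rule AE_I2)
      fix t
      obtain N :: nat where "\<bar>t\<bar> \<le> real N" using real_arch_simple by blast
      then have "\<forall>\<^sub>F k in sequentially. indicat_real {- real k..real k} t *\<^sub>R f t = f t"
        by (intro eventually_sequentiallyI[of N]) (auto simp: indicator_def)
      then show "(\<lambda>k. indicat_real {- real k..real k} t *\<^sub>R f t) \<longlonglongrightarrow> f t" by (rule tendsto_eventually)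
    qed
  qed (use f in \<open>auto simp: indicator_def\<close>)
  \<comment> \<open>This is 2 pi i times the defect of the formula truncated to [-k, k]; it equals
    the contribution of the two horizontal sides.\<close>
  let ?E = "\<lambda>k::nat. 2 * pi * \<i> * (h (of_real \<theta>) -
     ((\<integral>t\<in>{- real k..real k}. F 0 (- 1) t \<partial>lborel) + (\<integral>t\<in>{- real k..real k}. F 1 1 t \<partial>lborel)))"
  have bound: "norm (?E k) \<le> 2 * (B * pi / (sinh (pi * k) - 1))" if k: "0 < k" "1 < sinh (pi * real k)" for k
  proof -
    let ?a = "Complex 0 (- real k)" and ?b = "Complex 1 (- real k)" and ?c = "Complex 1 (real k)" and ?d = "Complex 0 (real k)"
    have k0: "0 < real k" using k by simp
    have cont: "continuous_on T strip_integrand" if "T \<subseteq> {z. - \<theta> < Re z \<and> Re z < 2 - \<theta>} - {of_real \<theta>}" for T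
      using that cos_ne_in_strip[OF \<theta>] unfolding strip_integrand_def
      by (intro continuous_intros continuous_on_subset[OF holomorphic_on_imp_continuous_on[OF holo]]) auto
    have B0: "0 \<le> B" using order.trans[OF norm_ge_zero bdd[of 0]] by simp
    have ci: "strip_integrand contour_integrable_on linepath ?a ?b" "strip_integrand contour_integrable_on linepath ?b ?c"
      "strip_integrand contour_integrable_on linepath ?c ?d" "strip_integrand contour_integrable_on linepath ?d ?a"
      using \<theta> k0
      by (auto intro!: contour_integrable_continuous_linepath cont
          simp: closed_segment_same_Im closed_segment_same_Re closed_segment_eq_real_ivl)
    have SI: "set_integrable lborel {- real k..real k} (F 0 (- 1))" "set_integrable lborel {- real k..real k} (F 1 1)"
      unfolding set_integrable_def by (intro integrable_mult_indicator int; simp)+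
    have alg: "p * \<i> * (H - (Y + X)) = I1 + I3"
      if "p * \<i> * H = I1 + \<i> * (p * X) + I3 + - (\<i> * - (p * Y))" for p H I1 I3 X Y :: complex
      using that by (simp add: algebra_simps)
    have "2 * pi * \<i> * h (of_real \<theta>) = contour_integral (linepath ?a ?b) strip_integrand +
        contour_integral (linepath ?b ?c) strip_integrand + contour_integral (linepath ?c ?d) strip_integrand +
        contour_integral (linepath ?d ?a) strip_integrand"
      unfolding strip_integrand_contour[OF k0, symmetric]
      by (simp add: rectpath_def Let_def ci add.assoc)
    also have "contour_integral (linepath ?b ?c) strip_integrand = \<i> * integral {- real k..real k} (\<lambda>t. strip_integrand (Complex 1 t))"
      using k0 by (intro contour_integral_linepath_same_Re) auto
    also have "(\<lambda>t. strip_integrand (Complex 1 t)) = (\<lambda>t. 2 * pi * F 1 1 t)"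
      unfolding strip_integrand_right F_def ..
    also have "integral {- real k..real k} (\<lambda>t. 2 * pi * F 1 1 t) = 2 * pi * (\<integral>t\<in>{- real k..real k}. F 1 1 t \<partial>lborel)"
      by (simp add: set_borel_integral_eq_integral(2)[OF SI(1)] set_borel_integral_eq_integral(2)[OF SI(2)])
    also have "contour_integral (linepath ?d ?a) strip_integrand = - contour_integral (linepath ?a ?d) strip_integrand"
      using contour_integral_reversepath[OF valid_path_linepath, of ?a ?d strip_integrand] by simp
    also have "contour_integral (linepath ?a ?d) strip_integrand = \<i> * integral {- real k..real k} (\<lambda>t. strip_integrand (Complex 0 t))"
      using k0 by (intro contour_integral_linepath_same_Re) auto
    also have "(\<lambda>t. strip_integrand (Complex 0 t)) = (\<lambda>t. - (2 * pi * F 0 (- 1) t))"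
      unfolding strip_integrand_left F_def ..
    also have "integral {- real k..real k} (\<lambda>t. - (2 * pi * F 0 (- 1) t)) = - (2 * pi * (\<integral>t\<in>{- real k..real k}. F 0 (- 1) t \<partial>lborel))"
      by (simp add: set_borel_integral_eq_integral(2)[OF SI(1)] set_borel_integral_eq_integral(2)[OF SI(2)])
    finally have E: "?E k = contour_integral (linepath ?a ?b) strip_integrand + contour_integral (linepath ?c ?d) strip_integrand"
      by (rule alg)
    have n: "norm (?b - ?a) = 1" "norm (?d - ?c) = 1" by (simp_all add: cmod_def)
    have 1: "norm (contour_integral (linepath ?a ?b) strip_integrand) \<le> B * pi / (sinh (pi * k) - 1) * norm (?b - ?a)"
      using k k0 ci(1,3) B0
      by (intro contour_integral_bound_linepath strip_integrand_horizontal)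
        (auto simp: closed_segment_same_Im closed_segment_eq_real_ivl)
    have 2: "norm (contour_integral (linepath ?c ?d) strip_integrand) \<le> B * pi / (sinh (pi * k) - 1) * norm (?d - ?c)"
      using k k0 ci(1,3) B0
      by (intro contour_integral_bound_linepath strip_integrand_horizontal)
        (auto simp: closed_segment_same_Im closed_segment_eq_real_ivl)
    show ?thesis
      unfolding E
      by (rule order.trans[OF norm_triangle_ineq], rule order.trans[OF add_mono[OF 1 2]]) (simp add: n)
  qed
  have sinh: "filterlim (\<lambda>k::nat. sinh (pi * real k)) at_top sequentially"
    by (intro filterlim_compose[OF sinh_real_at_top] filterlim_tendsto_pos_mult_at_top[OF tendsto_const]
        filterlim_real_sequentially) auto
  have "?E \<longlonglongrightarrow> 0"
  proof (rule Lim_null_comparison)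
    show "\<forall>\<^sub>F k in sequentially. norm (?E k) \<le> 2 * (B * pi / (sinh (pi * real k) - 1))"
      using eventually_gt_at_top[of 0] filterlim_at_top_dense[THEN iffD1, OF sinh, rule_format, of 1]
      by eventually_elim (rule bound)
    have "filterlim (\<lambda>k::nat. sinh (pi * real k) - 1) at_top sequentially"
      using filterlim_tendsto_add_at_top[OF tendsto_const sinh, of "- 1"] by simp
    then show "(\<lambda>k. 2 * (B * pi / (sinh (pi * real k) - 1))) \<longlonglongrightarrow> 0"
      by (intro tendsto_mult_right_zero tendsto_divide_0[OF tendsto_const] filterlim_at_top_imp_at_infinity)
  qed
  moreover have "?E \<longlonglongrightarrow> 2 * pi * \<i> * (h (of_real \<theta>) - ((\<integral>t. F 0 (- 1) t \<partial>lborel) + (\<integral>t. F 1 1 t \<partial>lborel)))"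
    by (intro tendsto_intros lim int)
  ultimately have "2 * pi * \<i> * (h (of_real \<theta>) - ((\<integral>t. F 0 (- 1) t \<partial>lborel) + (\<integral>t. F 1 1 t \<partial>lborel))) = 0"
    using LIMSEQ_unique by blast
  then have "h (of_real \<theta>) - ((\<integral>t. F 0 (- 1) t \<partial>lborel) + (\<integral>t. F 1 1 t \<partial>lborel)) = 0"
    by (subst (asm) mult_eq_0_iff) auto
  then show ?thesis unfolding F_def by (rule eq_iff_diff_eq_0[THEN iffD2])
qed

end

text \<open>Nonnegative kernels of joint mass 1 make Re f(theta) - 1 at most the right-edge integral
  of Re f - 1. That kernel carries the factor sin(pi theta), so division by theta keeps it bounded
  and dominated convergence applies.\<close>

theorem strip_derivative_bound:
  fixes f :: "complex \<Rightarrow> complex"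
  assumes holo: "f holomorphic_on UNIV"
    and bdd: "\<And>z. 0 \<le> Re z \<Longrightarrow> Re z \<le> 1 \<Longrightarrow> norm (f z) \<le> B"
    and f0: "f 0 = 1" and left: "\<And>t. Re (f (Complex 0 t)) \<le> 1"
    and der: "(f has_field_derivative f') (at 0)"
  shows "Re f' \<le> (\<integral>t. beta0 t * (Re (f (Complex 1 t)) - 1) \<partial>lborel)"
proof -
  define g where "g t = Re (f (Complex 1 t)) - 1" for t
  have meas [measurable]: "(\<lambda>t. f (Complex c t)) \<in> borel_measurable borel" for c
    by (rule entire_line_measurable[OF holo])
  have g [measurable]: "g \<in> borel_measurable borel" unfolding g_def by measurable
  have gB: "\<bar>g t\<bar> \<le> B + 1" for t
    unfolding g_def using bdd[of "Complex 1 t"] abs_Re_le_cmod[of "f (Complex 1 t)"] by simp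
  have step: "Re (f (of_real \<theta>)) - 1 \<le> (\<integral>t. strip_kernel 1 \<theta> t * g t \<partial>lborel)"
    if \<theta>: "0 < \<theta>" "\<theta> < 1" for \<theta>
  proof -
    have int: "integrable lborel (\<lambda>t. strip_kernel (- 1) \<theta> t *\<^sub>R f (Complex 0 t))"
      "integrable lborel (\<lambda>t. strip_kernel 1 \<theta> t *\<^sub>R f (Complex 1 t))"
      using \<theta> by (auto intro!: integrable_strip_kernel_mult[where B = B] bdd meas)
    have int1: "integrable lborel (\<lambda>t. strip_kernel (- 1) \<theta> t)" "integrable lborel (\<lambda>t. strip_kernel 1 \<theta> t)"
      using integrable_strip_kernel_mult[of "- 1" \<theta> "\<lambda>_. 1 :: real" 1]
        integrable_strip_kernel_mult[of 1 \<theta> "\<lambda>_. 1 :: real" 1] \<theta> by auto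
    \<comment> \<open>The formula for the constant function 1 yields the joint mass of the two
      kernels.\<close>
    have "(1::complex) = (\<integral>t. strip_kernel (- 1) \<theta> t *\<^sub>R 1 \<partial>lborel) + (\<integral>t. strip_kernel 1 \<theta> t *\<^sub>R 1 \<partial>lborel)"
      by (rule strip_poisson[of "\<lambda>_. 1" 1 \<theta>]) (use \<theta> in auto)
    then have one: "1 = (\<integral>t. strip_kernel (- 1) \<theta> t \<partial>lborel) + (\<integral>t. strip_kernel 1 \<theta> t \<partial>lborel)"
      using int1 by (simp add: scaleR_conv_of_real flip: of_real_add)
    have "Re (f (of_real \<theta>)) = (\<integral>t. strip_kernel (- 1) \<theta> t * Re (f (Complex 0 t)) \<partial>lborel) +
        (\<integral>t. strip_kernel 1 \<theta> t * Re (f (Complex 1 t)) \<partial>lborel)"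
      using strip_poisson[OF holo bdd \<theta>] integral_Re[OF int(1)] integral_Re[OF int(2)] by simp
    also have "(\<integral>t. strip_kernel (- 1) \<theta> t * Re (f (Complex 0 t)) \<partial>lborel) \<le> (\<integral>t. strip_kernel (- 1) \<theta> t \<partial>lborel)"
      using integrable_Re[OF int(1)] int1(1) left strip_kernel_nonneg[of "- 1" \<theta>] \<theta>
      by (intro integral_mono) (auto intro!: mult_left_le)
    also have "(\<integral>t. strip_kernel 1 \<theta> t * Re (f (Complex 1 t)) \<partial>lborel) =
        (\<integral>t. strip_kernel 1 \<theta> t * g t \<partial>lborel) + (\<integral>t. strip_kernel 1 \<theta> t \<partial>lborel)"
      using integrable_Re[OF int(2)] int1(2) unfolding g_def right_diff_distrib mult_1_right by simp
    finally show ?thesis using one by simp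
  qed
  \<comment> \<open>The shift by 2 keeps e k at most 1/2, so cos(pi e k) >= 0 and one dominating
    function serves all k.\<close>
  define e where "e k = 1 / real (k + 2)" for k
  have e: "0 < e k" "e k \<le> 1 / 2" for k unfolding e_def by (auto simp: field_simps)
  have e_lim: "e \<longlonglongrightarrow> 0" unfolding e_def by (rule LIMSEQ_ignore_initial_segment[OF lim_1_over_n])
  have "(\<lambda>k. (f (of_real (e k)) - f 0) / of_real (e k)) \<longlonglongrightarrow> f'"
  proof -
    have "((\<lambda>w. (f w - f 0) / w) \<longlongrightarrow> f') (at 0)" using der by (simp add: has_field_derivative_iff)
    moreover have "filterlim (\<lambda>k. complex_of_real (e k)) (at 0) sequentially"
      using tendsto_of_real[OF e_lim] e(1) by (auto simp: filterlim_at intro!: always_eventually) (metis less_irrefl)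
    ultimately show ?thesis by (rule filterlim_compose)
  qed
  then have lhs: "(\<lambda>k. Re ((f (of_real (e k)) - f 0) / of_real (e k))) \<longlonglongrightarrow> Re f'" by (rule tendsto_Re)
  have rhs: "(\<lambda>k. \<integral>t. strip_kernel 1 (e k) t / e k * g t \<partial>lborel) \<longlonglongrightarrow> (\<integral>t. beta0 t * g t \<partial>lborel)"
  proof (rule integral_dominated_convergence[where w = "\<lambda>t. 2 * (beta0 t * (B + 1))"])
    show "integrable lborel (\<lambda>t. 2 * (beta0 t * (B + 1)))"
      by (intro integrable_mult_left integrable_mult_right integrable_beta0)
    have sinc: "(\<lambda>k. sin (pi * e k) / e k) \<longlonglongrightarrow> pi"
    proof -
      have "((\<lambda>x. sin (pi * x)) has_real_derivative pi) (at 0)" by (auto intro!: derivative_eq_intros)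
      then have "((\<lambda>x. sin (pi * x) / x) \<longlongrightarrow> pi) (at 0)" by (simp add: has_field_derivative_iff)
      moreover have "filterlim e (at 0) sequentially"
        using e_lim e(1) by (auto simp: filterlim_at intro!: always_eventually) (metis less_irrefl)
      ultimately show ?thesis by (rule filterlim_compose)
    qed
    show "AE t in lborel. (\<lambda>k. strip_kernel 1 (e k) t / e k * g t) \<longlonglongrightarrow> beta0 t * g t"
    proof (rule AE_I2)
      fix t
      have "(\<lambda>k. sin (pi * e k) / e k / (2 * (cosh (pi * t) + 1 * cos (pi * e k))) * g t)
          \<longlonglongrightarrow> pi / (2 * (cosh (pi * t) + 1 * cos (pi * 0))) * g t"
      proof (rule tendsto_mult[OF tendsto_divide[OF sinc] tendsto_const])
        show "(\<lambda>k. 2 * (cosh (pi * t) + 1 * cos (pi * e k))) \<longlonglongrightarrow> 2 * (cosh (pi * t) + 1 * cos (pi * 0))"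
          by (intro tendsto_intros e_lim)
        show "2 * (cosh (pi * t) + 1 * cos (pi * 0)) \<noteq> 0"
          using cosh_add_one_pos[of "pi * t"] by simp
      qed
      moreover have "pi / (2 * (cosh (pi * t) + 1 * cos (pi * 0))) = beta0 t"
      proof -
        have "pi / (2 * c) = pi / 2 * inverse c" for c by (cases "c = 0") (auto simp: field_simps)
        then show ?thesis unfolding beta0_def mult_zero_right cos_zero mult_1_right .
      qed
      moreover have "sin (pi * e k) / e k / (2 * (cosh (pi * t) + 1 * cos (pi * e k))) = strip_kernel 1 (e k) t / e k" for k
        unfolding strip_kernel_def divide_divide_eq_left by (simp only: mult.commute)
      ultimately show "(\<lambda>k. strip_kernel 1 (e k) t / e k * g t) \<longlonglongrightarrow> beta0 t * g t"
        by (simp only:)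
    qed
    show "AE t in lborel. norm (strip_kernel 1 (e k) t / e k * g t) \<le> 2 * (beta0 t * (B + 1))" for k
    proof (rule AE_I2)
      fix t
      have nn: "0 \<le> strip_kernel 1 (e k) t" using e[of k] by (intro strip_kernel_nonneg) auto
      have "0 \<le> cos (pi * e k)" 
      proof (rule cos_ge_zero)
        have "0 \<le> pi * e k" using e(1)[of k] by simp
        then show "- (pi / 2) \<le> pi * e k" using pi_gt_zero by linarith
        show "pi * e k \<le> pi / 2" using mult_left_mono[OF e(2)[of k], of pi] by simp
      qed
      moreover have c: "1 \<le> cosh (pi * t)" by (rule cosh_real_ge_1)
      \<comment> \<open>The numerator uses sin x <= x; for the denominator, a nonnegative cosine and
        cosh >= 1 give 2 (cosh + cos) >= cosh + 1.\<close>
      ultimately have "strip_kernel 1 (e k) t \<le> (pi * e k) / (cosh (pi * t) + 1)"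
        unfolding strip_kernel_def using sin_x_le_x[of "pi * e k"] e[of k]
        by (intro frac_le) auto
      also have "\<dots> = 2 * beta0 t * e k" 
      proof -
        have "pi * x / c = 2 * (pi / 2 * inverse c) * x" for x c by (cases "c = 0") (auto simp: field_simps)
        then show ?thesis unfolding beta0_def .
      qed
      finally have "strip_kernel 1 (e k) t / e k \<le> 2 * beta0 t" using e[of k] by (simp add: field_simps)
      then have "\<bar>strip_kernel 1 (e k) t / e k\<bar> * \<bar>g t\<bar> \<le> 2 * beta0 t * (B + 1)"
        using gB[of t] nn e[of k] beta0_nonneg[of t] by (intro mult_mono) auto
      then show "norm (strip_kernel 1 (e k) t / e k * g t) \<le> 2 * (beta0 t * (B + 1))"
        by (simp add: abs_mult)
    qed
    show "(\<lambda>t. strip_kernel 1 (e k) t / e k * g t) \<in> borel_measurable lborel" for k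
      using strip_kernel_measurable[of 1 "e k"] e[of k] by simp
  qed simp
  have "Re ((f (of_real (e k)) - f 0) / of_real (e k)) \<le> (\<integral>t. strip_kernel 1 (e k) t / e k * g t \<partial>lborel)" for k
  proof -
    have "Re ((f (of_real (e k)) - f 0) / of_real (e k)) = (Re (f (of_real (e k))) - 1) / e k"
      using f0 by (simp add: Re_divide_of_real)
    also have "\<dots> \<le> (\<integral>t. strip_kernel 1 (e k) t * g t \<partial>lborel) / e k"
      using step[of "e k"] e[of k] by (intro divide_right_mono) auto
    also have "\<dots> = (\<integral>t. strip_kernel 1 (e k) t / e k * g t \<partial>lborel)" by simp
    finally show ?thesis .
  qed
  with lhs rhs have "Re f' \<le> (\<integral>t. beta0 t * g t \<partial>lborel)" by (intro LIMSEQ_le) auto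
  then show ?thesis unfolding g_def .
qed

section \<open>Amplification and partial trace\<close>

abbreviation tensor_one :: "nat \<Rightarrow> complex mat \<Rightarrow> complex mat" where
  "tensor_one n X \<equiv> kronecker X (1\<^sub>m n)"

lemma sum_lessThan_times:
  "(\<Sum>i<m * n. f i) = (\<Sum>i<m. \<Sum>k<n. f (i * n + k :: nat))"
proof -
  have "(\<Sum>k<n. f (i * n + k)) = sum f {i * n..<i * n + n}" for i
    using sum.shift_bounds_nat_ivl[of f 0 "i * n" n] by (simp add: atLeast0LessThan add.commute)
  then show ?thesis using sum.nat_group[of f n m] by simp
qed

lemma times_add_less: "i < m \<Longrightarrow> k < n \<Longrightarrow> i * n + k < m * (n::nat)"
  by (metis add.commute add_lessD1 less_iff_Suc_add mult.commute mult_Suc_right nat_add_left_cancel_less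
      less_le_trans mult_le_mono2 Suc_leI)

lemma nat_less_times_E:
  assumes "i < m * (n::nat)"
  obtains a k where "a < m" "k < n" "i = a * n + k"
proof
  show "i div n < m" using assms by (simp add: less_mult_imp_div_less)
  show "i mod n < n" using assms by (cases n) auto
  show "i = i div n * n + i mod n" by simp
qed

lemma tensor_one_carrier:
  "X \<in> carrier_mat a b \<Longrightarrow> tensor_one n X \<in> carrier_mat (a * n) (b * n)"
  unfolding kronecker_def by auto

lemma tensor_one_index:
  assumes "X \<in> carrier_mat a b" "i < a" "k < n" "j < b" "l < n"
  shows "tensor_one n X $$ (i * n + k, j * n + l) = (if k = l then X $$ (i, j) else 0)"
  using assms times_add_less[of i a k n] times_add_less[of j b l n] unfolding kronecker_def by auto

lemma tensor_one_mult_index: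
  assumes X: "X \<in> carrier_mat a b" and Y: "Y \<in> carrier_mat (b * n) c" and i: "i < a" "k < n" "j < c"
  shows "(tensor_one n X * Y) $$ (i * n + k, j) = (\<Sum>s<b. X $$ (i, s) * Y $$ (s * n + k, j))"
proof -
  have "(tensor_one n X * Y) $$ (i * n + k, j) =
      (\<Sum>s<b. \<Sum>l<n. tensor_one n X $$ (i * n + k, s * n + l) * Y $$ (s * n + l, j))"
    using tensor_one_carrier[OF X] Y i times_add_less[OF i(1,2)]
    by (subst mult_mat_index[of _ "a * n" "b * n" _ c]) (auto simp: sum_lessThan_times)
  also have "\<dots> = (\<Sum>s<b. \<Sum>l<n. if k = l then X $$ (i, s) * Y $$ (s * n + l, j) else 0)"
    using X i by (intro sum.cong refl) (auto simp: tensor_one_index)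
  finally show ?thesis using i by simp
qed

lemma tensor_one_mult:
  assumes X: "X \<in> carrier_mat a b" and Y: "Y \<in> carrier_mat b c"
  shows "tensor_one n X * tensor_one n Y = tensor_one n (X * Y)"
proof (rule eq_matI)
  note Xc = tensor_one_carrier[OF X, of n] and Yc = tensor_one_carrier[OF Y, of n]
  have XY: "X * Y \<in> carrier_mat a c" using X Y by auto
  note XYc = tensor_one_carrier[OF XY, of n]
  fix i j assume "i < dim_row (tensor_one n (X * Y))" "j < dim_col (tensor_one n (X * Y))"
  then have "i < a * n" "j < c * n" using XYc by auto
  then obtain i' k j' l where ij: "i' < a" "k < n" "i = i' * n + k" "j' < c" "l < n" "j = j' * n + l"
    by (metis nat_less_times_E)
  have "(tensor_one n X * tensor_one n Y) $$ (i, j) = (\<Sum>s<b. X $$ (i', s) * tensor_one n Y $$ (s * n + k, j))"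
    using tensor_one_mult_index[OF X Yc, of i' k j] ij times_add_less[OF ij(4,5)] by simp
  also have "\<dots> = tensor_one n (X * Y) $$ (i, j)"
    using ij X Y XY
    by (auto simp: tensor_one_index[OF XY] tensor_one_index[OF Y] mult_mat_index[OF X Y] simp del: index_mult_mat(1))
  finally show "(tensor_one n X * tensor_one n Y) $$ (i, j) = tensor_one n (X * Y) $$ (i, j)" .
qed (use tensor_one_carrier[OF X, of n] tensor_one_carrier[OF Y, of n]
    tensor_one_carrier[OF mult_carrier_mat[OF X Y], of n] in auto)

lemma tensor_one_eqI:
  assumes X: "X \<in> carrier_mat (a * n) (b * n)" and Y: "Y \<in> carrier_mat (a * n) (b * n)"
    and "\<And>i k j l. i < a \<Longrightarrow> k < n \<Longrightarrow> j < b \<Longrightarrow> l < n \<Longrightarrow> X $$ (i * n + k, j * n + l) = Y $$ (i * n + k, j * n + l)"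
  shows "X = Y"
proof (rule eq_matI)
  fix i j assume "i < dim_row Y" "j < dim_col Y"
  then have "i < a * n" "j < b * n" using Y by auto
  then show "X $$ (i, j) = Y $$ (i, j)" using assms(3) by (metis nat_less_times_E)
qed (use X Y in auto)

lemma tensor_one_adjoint:
  assumes X: "X \<in> carrier_mat a b"
  shows "mat_adjoint (tensor_one n X) = tensor_one n (mat_adjoint X)"
  using tensor_one_carrier[OF X, of n] tensor_one_carrier[OF mat_adjoint_carrier[OF X], of n] X
  by (intro tensor_one_eqI[where a = b and b = a])
    (auto simp: tensor_one_index[OF X] tensor_one_index[OF mat_adjoint_carrier[OF X]] times_add_less)

lemma tensor_one_one: "tensor_one n (1\<^sub>m a) = 1\<^sub>m (a * n)"
proof (rule tensor_one_eqI[where a = a and b = a and n = n])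
  fix i k j l assume "i < a" "k < n" "j < a" "l < n"
  moreover then have "i * n + k = j * n + l \<longleftrightarrow> i = j \<and> k = l"
    by (metis add_diff_cancel_left' div_mult_self3 div_less less_nat_zero_code add.commute add_0 nat_less_le zero_less_iff_neq_zero)
  ultimately show "tensor_one n (1\<^sub>m a) $$ (i * n + k, j * n + l) = 1\<^sub>m (a * n) $$ (i * n + k, j * n + l)"
    by (auto simp: tensor_one_index[of _ a a] times_add_less)
qed (auto intro: tensor_one_carrier)

lemma tensor_one_minus:
  assumes "X \<in> carrier_mat a b" "Y \<in> carrier_mat a b"
  shows "tensor_one n (X - Y) = tensor_one n X - tensor_one n Y"
  using assms tensor_one_carrier[of X a b n] tensor_one_carrier[of Y a b n]
    tensor_one_index[OF minus_carrier_mat[OF assms(2)], of _ _ n]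
  by (intro tensor_one_eqI[where a = a and b = b and n = n])
    (auto simp: tensor_one_index[of _ a b] times_add_less intro!: tensor_one_carrier)

section \<open>The partial trace as the dual of amplification\<close>

lemma ptrace_snd_carrier [simp]: "ptrace_snd m n X \<in> carrier_mat m m"
  unfolding ptrace_snd_def by simp

lemma ptrace_snd_index: "i < m \<Longrightarrow> j < m \<Longrightarrow> ptrace_snd m n X $$ (i, j) = (\<Sum>k<n. X $$ (i * n + k, j * n + k))"
  unfolding ptrace_snd_def by simp

lemma mat_trace_ptrace_snd:
  "X \<in> carrier_mat (m * n) (m * n) \<Longrightarrow> mat_trace (ptrace_snd m n X) = mat_trace X"
  by (simp add: mat_trace_carrier[OF ptrace_snd_carrier] mat_trace_carrier[of X "m * n"]
      sum_lessThan_times ptrace_snd_index)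

lemma ptrace_snd_adjoint:
  "X \<in> carrier_mat (m * n) (m * n) \<Longrightarrow> ptrace_snd m n (mat_adjoint X) = mat_adjoint (ptrace_snd m n X)"
  by (rule eq_matI) (auto simp: ptrace_snd_index times_add_less ptrace_snd_def)

lemma ptrace_snd_mult_left:
  assumes X: "X \<in> carrier_mat m m" and Y: "Y \<in> carrier_mat (m * n) (m * n)"
  shows "ptrace_snd m n (tensor_one n X * Y) = X * ptrace_snd m n Y"
proof (rule eq_matI)
  fix i j assume "i < dim_row (X * ptrace_snd m n Y)" "j < dim_col (X * ptrace_snd m n Y)"
  then have ij: "i < m" "j < m" using X by (auto simp: ptrace_snd_def)
  have "ptrace_snd m n (tensor_one n X * Y) $$ (i, j) = (\<Sum>k<n. \<Sum>s<m. X $$ (i, s) * Y $$ (s * n + k, j * n + k))"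
    using ij by (simp add: ptrace_snd_index tensor_one_mult_index[OF X Y] times_add_less)
  also have "\<dots> = (\<Sum>s<m. \<Sum>k<n. X $$ (i, s) * Y $$ (s * n + k, j * n + k))" by (rule sum.swap)
  also have "\<dots> = (X * ptrace_snd m n Y) $$ (i, j)"
    using ij X by (subst mult_mat_index[OF X ptrace_snd_carrier]) (auto simp: ptrace_snd_index sum_distrib_left)
  finally show "ptrace_snd m n (tensor_one n X * Y) $$ (i, j) = (X * ptrace_snd m n Y) $$ (i, j)" .
qed (use X in \<open>auto simp: ptrace_snd_def\<close>)

lemma ptrace_snd_mult_right:
  assumes X: "X \<in> carrier_mat m m" and Y: "Y \<in> carrier_mat (m * n) (m * n)"
  shows "ptrace_snd m n (Y * tensor_one n X) = ptrace_snd m n Y * X"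
proof -
  note Xc = tensor_one_carrier[OF X, of n]
  have "ptrace_snd m n (Y * tensor_one n X) = mat_adjoint (ptrace_snd m n (mat_adjoint (Y * tensor_one n X)))"
    using Xc Y by (subst ptrace_snd_adjoint) auto
  also have "mat_adjoint (Y * tensor_one n X) = tensor_one n (mat_adjoint X) * mat_adjoint Y"
    by (simp add: mat_adjoint_mult[OF Y Xc] tensor_one_adjoint[OF X])
  also have "mat_adjoint (ptrace_snd m n \<dots>) = ptrace_snd m n Y * X"
    using X Y by (subst ptrace_snd_mult_left)
      (auto simp: ptrace_snd_adjoint mat_adjoint_mult[OF mat_adjoint_carrier[OF X] mat_adjoint_carrier[OF ptrace_snd_carrier]])
  finally show ?thesis .
qed

text \<open>Under the trace pairing the partial trace is dual to X -> X tensor 1. Expectations on a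
  marginal are moved to the bipartite space and back through this identity.\<close>

lemma mat_trace_tensor_one_mult:
  assumes X: "X \<in> carrier_mat m m" and Y: "Y \<in> carrier_mat (m * n) (m * n)"
  shows "mat_trace (tensor_one n X * Y) = mat_trace (X * ptrace_snd m n Y)"
  using mat_trace_ptrace_snd[of "tensor_one n X * Y" m n] ptrace_snd_mult_left[OF X Y]
    tensor_one_carrier[OF X, of n] Y by auto

lemma psd_mat_tensor_one:
  assumes "psd_mat m X"
  shows "psd_mat (m * n) (tensor_one n X)"
proof -
  obtain K where K: "K \<in> carrier_mat m m" "X = K * mat_adjoint K" using psd_mat_factor[OF assms] by blast
  have "tensor_one n X = tensor_one n K * mat_adjoint (tensor_one n K)"
    unfolding K(2) tensor_one_adjoint[OF K(1)] using K(1) by (simp add: tensor_one_mult[of K m m _ m])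
  then show ?thesis using psd_mat_mult_adjoint[OF tensor_one_carrier[OF K(1)]] by simp
qed

text \<open>The positive cone is self-dual: the rank-one test M = v v^* recovers the quadratic form
  at v. Traces are linear, so this test passes through partial traces and integrals.\<close>

lemma psd_matI_trace:
  assumes X: "X \<in> carrier_mat n n" "mat_adjoint X = X"
    and tr: "\<And>M. psd_mat n M \<Longrightarrow> 0 \<le> Re (mat_trace (M * X))"
  shows "psd_mat n X"
  unfolding psd_mat_def
proof (intro conjI ballI X)
  fix v :: "complex vec" assume v: "v \<in> carrier_vec n"
  define V where "V = mat n 1 (\<lambda>(i, j). v $ i)"
  have V: "V \<in> carrier_mat n 1" unfolding V_def by simp
  have VV: "V * mat_adjoint V \<in> carrier_mat n n" using V by auto
  have "mat_trace (V * mat_adjoint V * X) = (\<Sum>j<n. \<Sum>i<n. v $ j * cnj (v $ i) * X $$ (i, j))"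
  proof -
    have "(V * mat_adjoint V) $$ (i, j) = v $ i * cnj (v $ j)" if "i < n" "j < n" for i j
      using that V by (subst mult_mat_index[OF V mat_adjoint_carrier[OF V]]) (auto simp: V_def)
    then show ?thesis by (simp add: mat_trace_mult[OF VV X(1)] del: index_mult_mat(1))
  qed
  also have "\<dots> = (X *\<^sub>v v) \<bullet>c v"
    unfolding quadratic_form_index[OF X(1) v] by (subst sum.swap) (simp add: mult_ac)
  finally show "0 \<le> Re ((X *\<^sub>v v) \<bullet>c v)"
    using tr[OF psd_mat_mult_adjoint[OF V]] by simp
qed

lemma psd_mat_ptrace_snd:
  assumes X: "psd_mat (m * n) X"
  shows "psd_mat m (ptrace_snd m n X)"
proof (rule psd_matI_trace)
  note Xc = psd_mat_carrier[OF X]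
  show "mat_adjoint (ptrace_snd m n X) = ptrace_snd m n X"
    using ptrace_snd_adjoint[OF Xc] psd_mat_adjoint[OF X] by simp
  fix M assume M: "psd_mat m M"
  show "0 \<le> Re (mat_trace (M * ptrace_snd m n X))"
    using mat_trace_mult_psd[OF psd_mat_tensor_one[OF M] X]
      mat_trace_tensor_one_mult[OF psd_mat_carrier[OF M] Xc] by auto
qed simp

section \<open>Powers and supports\<close>

text \<open>A zero eigenvalue contributes 0 for every exponent, including z = 0. For d > 0 the
  exponential form shows that powers are entire in z.\<close>

lemma of_real_powr_eq: "0 \<le> d \<Longrightarrow> complex_of_real d powr z = (if d = 0 then 0 else exp (z * of_real (ln d)))"
  by (simp add: powr_def Ln_of_real)

context
  fixes n :: nat and X :: "complex mat"
  assumes X: "psd_mat n X"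
begin

lemma mat_powr_carrier: "mat_powr X z \<in> carrier_mat n n"
  and mat_ln_carrier: "mat_ln X \<in> carrier_mat n n"
  unfolding mat_powr_def mat_ln_def by (rule mat_fun_carrier[OF X])+

text \<open>Both sides vanish on the kernel, so the law covers negative exponents too. In particular
  X^(-1) X is the support projection X^0.\<close>

lemma mat_powr_mult: "mat_powr X a * mat_powr X b = mat_powr X (a + b)"
  unfolding mat_powr_def mat_fun_mult[OF X] by (simp add: powr_add)

lemma mat_powr_one: "mat_powr X 1 = X"
  using mat_fun_ident[OF X] mat_fun_cong[OF X, of "\<lambda>x. complex_of_real x powr 1" complex_of_real]
  unfolding mat_powr_def by simp

lemma mat_powr_adjoint: "mat_adjoint (mat_powr X z) = mat_powr X (cnj z)"
  unfolding mat_powr_def mat_fun_adjoint[OF X]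
  by (rule mat_fun_cong[OF X]) (simp add: of_real_powr_eq exp_cnj)

lemma mat_powr_zero_mult: "mat_powr X 0 * X = X" "X * mat_powr X 0 = X"
  using mat_powr_mult[of 0 1] mat_powr_mult[of 1 0] by (simp_all add: mat_powr_one)

lemma mat_powr_zero_proj:
  "mat_adjoint (mat_powr X 0) = mat_powr X 0" "mat_powr X 0 * mat_powr X 0 = mat_powr X 0"
  by (simp_all add: mat_powr_adjoint mat_powr_mult)

end

lemma proj_complement:
  fixes P :: "complex mat"
  assumes P: "P \<in> carrier_mat n n" "mat_adjoint P = P" "P * P = P"
  shows "1\<^sub>m n - P \<in> carrier_mat n n" "mat_adjoint (1\<^sub>m n - P) = 1\<^sub>m n - P"
    "(1\<^sub>m n - P) * (1\<^sub>m n - P) = 1\<^sub>m n - P" "psd_mat n (1\<^sub>m n - P)"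
proof -
  show c: "1\<^sub>m n - P \<in> carrier_mat n n" using P by auto
  show a: "mat_adjoint (1\<^sub>m n - P) = 1\<^sub>m n - P" using P by (subst mat_adjoint_minus) auto
  show m: "(1\<^sub>m n - P) * (1\<^sub>m n - P) = 1\<^sub>m n - P"
    using P c by (subst minus_mult_distrib_mat[of _ n n _ _ n])
      (auto simp: mult_minus_distrib_mat[of _ n n _ n] intro!: eq_matI)
  show "psd_mat n (1\<^sub>m n - P)" using psd_mat_mult_adjoint[OF c] a m by simp
qed

lemma cscalar_prod_adjoint:
  fixes A :: "complex mat"
  assumes A: "A \<in> carrier_mat n k" and v: "v \<in> carrier_vec k" and w: "w \<in> carrier_vec n"
  shows "(A *\<^sub>v v) \<bullet>c w = v \<bullet>c (mat_adjoint A *\<^sub>v w)"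
proof -
  have "(A *\<^sub>v v) \<bullet>c w = (\<Sum>i<n. \<Sum>j<k. A $$ (i, j) * v $ j * cnj (w $ i))"
    using A v w by (auto simp: scalar_prod_def atLeast0LessThan sum_distrib_right intro!: sum.cong)
  also have "\<dots> = (\<Sum>j<k. \<Sum>i<n. A $$ (i, j) * v $ j * cnj (w $ i))" by (rule sum.swap)
  also have "\<dots> = v \<bullet>c (mat_adjoint A *\<^sub>v w)"
    using A v w by (auto simp: scalar_prod_def atLeast0LessThan sum_distrib_left mult_ac intro!: sum.cong)
  finally show ?thesis .
qed

text \<open>A column w of P lies in supp X, hence in supp Y, and is orthogonal to ker Y. But Q w
  lies in ker Y, and the inner product of w with Q w is the squared norm of Q w; so Q kills every
  column of P.\<close>

lemma mat_supp_subset_proj: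
  assumes X: "psd_mat n X" and Y: "psd_mat n Y" and sub: "mat_supp X \<subseteq> mat_supp Y"
  shows "mat_powr Y 0 * mat_powr X 0 = mat_powr X 0"
proof -
  note Xc = psd_mat_carrier[OF X] and Yc = psd_mat_carrier[OF Y]
  define P where "P = mat_powr X 0"
  define Q where "Q = 1\<^sub>m n - mat_powr Y 0"
  have P: "P \<in> carrier_mat n n" "mat_adjoint P = P" "P * P = P"
    unfolding P_def using mat_powr_carrier[OF X] mat_powr_zero_proj[OF X] by auto
  have Q: "Q \<in> carrier_mat n n" "mat_adjoint Q = Q" "Q * Q = Q"
    unfolding Q_def using proj_complement[OF mat_powr_carrier[OF Y] mat_powr_zero_proj[OF Y]] by auto
  have YQ: "Y * Q = 0\<^sub>m n n"
    unfolding Q_def using mat_powr_carrier[OF Y] Yc mat_powr_zero_mult[OF Y]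
    by (auto simp: mult_minus_distrib_mat[of _ n n _ n])
  have "Q * P = 0\<^sub>m n n"
  proof (rule eq_matI)
    fix i j assume "i < dim_row (0\<^sub>m n n)" "j < dim_col (0\<^sub>m n n)"
    then have ij: "i < n" "j < n" by auto
    define w where "w = col P j"
    have w: "w \<in> carrier_vec n" unfolding w_def using P by (auto intro: col_carrier_vec)
    have Pw: "P *\<^sub>v w = w" unfolding w_def using P ij by (metis col_mult2)
    have "w \<in> mat_supp X"
      unfolding mat_supp_def
    proof (intro CollectI conjI ballI)
      fix k assume "k \<in> mat_kernel X"
      then have k: "k \<in> carrier_vec n" "X *\<^sub>v k = 0\<^sub>v n"
        using Xc by (auto simp: mat_kernel_def)
      \<comment> \<open>Writing X^0 as X^(-1) X shows that P annihilates ker X.\<close>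
      have "P = mat_powr X (- 1) * X" unfolding P_def using mat_powr_mult[OF X, of "- 1" 1] mat_powr_one[OF X] by simp
      then have "P *\<^sub>v k = 0\<^sub>v n"
        using k Xc mat_powr_carrier[OF X, of "- 1"] by (auto simp: assoc_mult_mat_vec[of _ n n _ n])
      then show "w \<bullet>c k = 0" using cscalar_prod_adjoint[OF P(1) w k(1)] w unfolding P(2) Pw by simp
    qed (use w Xc in auto)
    with sub have wY: "w \<in> mat_supp Y" by auto
    define u where "u = Q *\<^sub>v w"
    have u: "u \<in> carrier_vec n" unfolding u_def using Q w by auto
    have "Y *\<^sub>v u = (Y * Q) *\<^sub>v w" unfolding u_def using Yc Q w by (simp add: assoc_mult_mat_vec[of _ n n _ n])
    then have "u \<in> mat_kernel Y" using u Yc w unfolding mat_kernel_def YQ by auto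
    with wY have "w \<bullet>c u = 0" unfolding mat_supp_def by auto
    moreover have "u \<bullet>c u = w \<bullet>c u"
    proof -
      have "u \<bullet>c u = w \<bullet>c (Q *\<^sub>v u)" unfolding u_def using cscalar_prod_adjoint[OF Q(1) w u] Q(2) by (simp add: u_def)
      also have "Q *\<^sub>v u = u" unfolding u_def using Q w by (simp flip: assoc_mult_mat_vec[of _ n n _ n])
      finally show ?thesis .
    qed
    ultimately have "u = 0\<^sub>v n" using conjugate_square_eq_0_vec[OF u] by simp
    moreover have "u = col (Q * P) j"
      unfolding u_def w_def using P Q ij by (intro col_mult2[of Q n n P n, symmetric]) auto
    ultimately show "(Q * P) $$ (i, j) = 0\<^sub>m n n $$ (i, j)"
      using P Q ij by (metis col_dim index_col carrier_matD index_mult_mat(2,3) index_zero_mat(1) index_zero_vec(1))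
  qed (use P Q in auto)
  then have "P - mat_powr Y 0 * P = 0\<^sub>m n n"
    unfolding Q_def using P mat_powr_carrier[OF Y, of 0] by (simp add: minus_mult_distrib_mat[of _ n n _ _ n])
  then have "(P - mat_powr Y 0 * P) $$ (i, j) = 0" if "i < n" "j < n" for i j using that by simp
  then show ?thesis unfolding P_def[symmetric] using P mat_powr_carrier[OF Y, of 0]
    by (intro eq_matI) (auto simp del: index_mult_mat(1))
qed

section \<open>Relative entropy of diagonal matrices\<close>

lemma mat_ln_diag: "mat_ln (mat_diag k (\<lambda>x. complex_of_real (p x))) = mat_diag k (\<lambda>x. complex_of_real (ln (p x)))"
proof -
  have "mat_ln (mat_diag k (\<lambda>x. complex_of_real (p x))) = 1\<^sub>m k * mat_diag k (\<lambda>x. complex_of_real (ln (p x))) * mat_adjoint (1\<^sub>m k)"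
    unfolding mat_ln_def
    by (rule mat_fun_eq) (auto simp: unitary_mat_def square_mat_simps[where n = k])
  then show ?thesis by (simp add: square_mat_simps[where n = k])
qed

lemma mat_diag_mult_vec_index:
  "w \<in> carrier_vec k \<Longrightarrow> i < k \<Longrightarrow> (mat_diag k f *\<^sub>v w) $ i = f i * w $ i"
  by (auto simp: scalar_prod_def mat_diag_def if_distrib[of "\<lambda>x. x * _"] sum.delta cong: if_cong)

lemma mat_kernel_diag:
  "mat_kernel (mat_diag k (f :: nat \<Rightarrow> complex)) = {w \<in> carrier_vec k. \<forall>i<k. f i = 0 \<or> w $ i = 0}"
proof -
  have "mat_diag k f *\<^sub>v w = 0\<^sub>v k \<longleftrightarrow> (\<forall>i<k. f i = 0 \<or> w $ i = 0)" if "w \<in> carrier_vec k" for w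
    using mat_diag_mult_vec_index[OF that, of _ f] carrier_matD[OF mat_diag_dim[of k f]]
    by (auto simp: vec_eq_iff simp del: index_mult_mat_vec)
  then show ?thesis unfolding mat_kernel_def using carrier_matD[OF mat_diag_dim[of k f]] by auto
qed

lemma mat_supp_diag_subset:
  "mat_supp (mat_diag k (f :: nat \<Rightarrow> complex)) \<subseteq> mat_supp (mat_diag k g) \<longleftrightarrow> (\<forall>i<k. g i = 0 \<longrightarrow> f i = 0)"
proof
  assume sub: "mat_supp (mat_diag k f) \<subseteq> mat_supp (mat_diag k g)"
  show "\<forall>i<k. g i = 0 \<longrightarrow> f i = 0"
  proof (intro allI impI, rule ccontr)
    fix i assume i: "i < k" "g i = 0" "f i \<noteq> 0"
    have "unit_vec k i \<in> mat_supp (mat_diag k f)"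
      using i unfolding mat_supp_def mat_kernel_diag by (auto simp: mat_diag_def)
    with sub have "unit_vec k i \<in> mat_supp (mat_diag k g)" by auto
    moreover have "unit_vec k i \<in> mat_kernel (mat_diag k g)" using i unfolding mat_kernel_diag by auto
    ultimately have "unit_vec k i \<bullet>c (unit_vec k i :: complex vec) = 0" unfolding mat_supp_def by auto
    then show False using i by simp
  qed
next
  assume "\<forall>i<k. g i = 0 \<longrightarrow> f i = 0"
  then have "mat_kernel (mat_diag k g) \<subseteq> mat_kernel (mat_diag k f)" unfolding mat_kernel_diag by auto
  then show "mat_supp (mat_diag k f) \<subseteq> mat_supp (mat_diag k g)"
    unfolding mat_supp_def by (auto simp: mat_diag_def)
qed

text \<open>Terms with p x = 0 vanish, so the trace formula obeys the convention 0 ln 0 = 0, and the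
  support condition becomes absolute continuity.\<close>

lemma rel_entropy_diag:
  "rel_entropy (mat_diag k (\<lambda>x. complex_of_real (p x))) (mat_diag k (\<lambda>x. complex_of_real (q x))) =
    (if \<forall>x<k. q x = 0 \<longrightarrow> p x = 0 then ereal (\<Sum>x<k. p x * (ln (p x) - ln (q x))) else \<infinity>)"
proof -
  have "mat_trace (mat_diag k (\<lambda>x. complex_of_real (p x)) *
      (mat_diag k (\<lambda>x. complex_of_real (ln (p x))) - mat_diag k (\<lambda>x. complex_of_real (ln (q x))))) =
      of_real (\<Sum>x<k. p x * (ln (p x) - ln (q x)))"
    by (subst mat_diag_mult_left[of _ k k]) (auto simp: mat_trace_def mat_diag_def)
  then show ?thesis
    unfolding rel_entropy_def mat_ln_diag mat_supp_diag_subset by simp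
qed

section \<open>Matrix-valued functions on the strip\<close>

definition bounded_on_strip :: "(complex \<Rightarrow> complex) \<Rightarrow> bool" where
  "bounded_on_strip f \<longleftrightarrow> f holomorphic_on UNIV \<and> (\<exists>B. \<forall>z. 0 \<le> Re z \<longrightarrow> Re z \<le> 1 \<longrightarrow> norm (f z) \<le> B)"

lemma bounded_on_strip_const: "bounded_on_strip (\<lambda>_. c)"
  unfolding bounded_on_strip_def by auto

lemma bounded_on_strip_mult:
  assumes "bounded_on_strip f" "bounded_on_strip g"
  shows "bounded_on_strip (\<lambda>z. f z * g z)"
proof -
  obtain A B where A: "\<And>z. 0 \<le> Re z \<Longrightarrow> Re z \<le> 1 \<Longrightarrow> norm (f z) \<le> A"
    and B: "\<And>z. 0 \<le> Re z \<Longrightarrow> Re z \<le> 1 \<Longrightarrow> norm (g z) \<le> B"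
    using assms unfolding bounded_on_strip_def by metis
  have "norm (f z * g z) \<le> A * B" if "0 \<le> Re z" "Re z \<le> 1" for z
    unfolding norm_mult using A[OF that] B[OF that] order.trans[OF norm_ge_zero A[OF that]]
    by (intro mult_mono) auto
  then show ?thesis using assms unfolding bounded_on_strip_def by (blast intro: holomorphic_on_mult)
qed

lemma bounded_on_strip_add:
  assumes "bounded_on_strip f" "bounded_on_strip g"
  shows "bounded_on_strip (\<lambda>z. f z + g z)"
proof -
  obtain A B where A: "\<And>z. 0 \<le> Re z \<Longrightarrow> Re z \<le> 1 \<Longrightarrow> norm (f z) \<le> A"
    and B: "\<And>z. 0 \<le> Re z \<Longrightarrow> Re z \<le> 1 \<Longrightarrow> norm (g z) \<le> B"
    using assms unfolding bounded_on_strip_def by metis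
  have "norm (f z + g z) \<le> A + B" if "0 \<le> Re z" "Re z \<le> 1" for z
    using norm_triangle_ineq[of "f z" "g z"] A[OF that] B[OF that] by linarith
  then show ?thesis using assms unfolding bounded_on_strip_def by (blast intro: holomorphic_on_add)
qed

lemma bounded_on_strip_sum:
  "(\<And>i. i \<in> I \<Longrightarrow> bounded_on_strip (f i)) \<Longrightarrow> bounded_on_strip (\<lambda>z. \<Sum>i\<in>I. f i z)"
  by (induction I rule: infinite_finite_induct) (auto intro: bounded_on_strip_add bounded_on_strip_const)

text \<open>The rate c is real, so the modulus exp(c Re z) does not depend on Im z.\<close>

lemma bounded_on_strip_exp: "bounded_on_strip (\<lambda>z. exp (of_real c * z))"
proof -
  have "norm (exp (of_real c * z)) \<le> exp \<bar>c\<bar>" if "0 \<le> Re z" "Re z \<le> 1" for z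
  proof -
    have "\<bar>c\<bar> * Re z \<le> \<bar>c\<bar> * 1" using that by (intro mult_left_mono) auto
    moreover have "c * Re z \<le> \<bar>c\<bar> * Re z" using that by (intro mult_right_mono) auto
    ultimately show ?thesis by (simp add: norm_exp_eq_Re)
  qed
  then show ?thesis unfolding bounded_on_strip_def by (auto intro!: holomorphic_intros)
qed

text \<open>The second matrix is the derivative at \<open>0\<close>.\<close>

definition strip_mat :: "nat \<Rightarrow> (complex \<Rightarrow> complex mat) \<Rightarrow> complex mat \<Rightarrow> bool" where
  "strip_mat n F F' \<longleftrightarrow> (\<forall>z. F z \<in> carrier_mat n n) \<and> F' \<in> carrier_mat n n \<and>
     (\<forall>i<n. \<forall>j<n. bounded_on_strip (\<lambda>z. F z $$ (i, j)) \<and>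
        ((\<lambda>z. F z $$ (i, j)) has_field_derivative F' $$ (i, j)) (at 0))"

lemma strip_mat_mult:
  assumes F: "strip_mat n F F'" and G: "strip_mat n G G'"
  shows "strip_mat n (\<lambda>z. F z * G z) (F' * G 0 + F 0 * G')"
  unfolding strip_mat_def
proof (intro conjI allI impI)
  have c: "F z \<in> carrier_mat n n" "G z \<in> carrier_mat n n" "F' \<in> carrier_mat n n" "G' \<in> carrier_mat n n" for z
    using F G unfolding strip_mat_def by auto
  show "F z * G z \<in> carrier_mat n n" for z using c(1,2)[of z] by auto
  show "F' * G 0 + F 0 * G' \<in> carrier_mat n n" using c(3,4) c(1,2)[of 0] by auto
  fix i j assume ij: "i < n" "j < n"
  have e: "(F z * G z) $$ (i, j) = (\<Sum>t<n. F z $$ (i, t) * G z $$ (t, j))" for z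
    using c(1,2)[of z] ij by (rule mult_mat_index)
  show "bounded_on_strip (\<lambda>z. (F z * G z) $$ (i, j))"
    unfolding e using F G ij unfolding strip_mat_def
    by (intro bounded_on_strip_sum bounded_on_strip_mult) auto
  have "((\<lambda>z. \<Sum>t<n. F z $$ (i, t) * G z $$ (t, j)) has_field_derivative
      (\<Sum>t<n. F' $$ (i, t) * G 0 $$ (t, j) + G' $$ (t, j) * F 0 $$ (i, t))) (at 0)"
    using F G ij unfolding strip_mat_def
    by (intro DERIV_sum DERIV_mult) auto
  also have "(\<Sum>t<n. F' $$ (i, t) * G 0 $$ (t, j) + G' $$ (t, j) * F 0 $$ (i, t)) = (F' * G 0 + F 0 * G') $$ (i, j)"
    using c(3,4) c(1,2)[of 0] ij mult_mat_index[OF c(3) c(2)[of 0] ij] mult_mat_index[OF c(1)[of 0] c(4) ij]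
    by (simp add: sum.distrib mult.commute del: index_mult_mat(1))
  finally show "((\<lambda>z. (F z * G z) $$ (i, j)) has_field_derivative (F' * G 0 + F 0 * G') $$ (i, j)) (at 0)"
    unfolding e .
qed

lemma strip_mat_tensor_one:
  assumes F: "strip_mat m F F'"
  shows "strip_mat (m * n) (\<lambda>z. tensor_one n (F z)) (tensor_one n F')"
  unfolding strip_mat_def
proof (intro conjI allI impI)
  have c: "F z \<in> carrier_mat m m" "F' \<in> carrier_mat m m" for z
    using F unfolding strip_mat_def by auto
  show "tensor_one n (F z) \<in> carrier_mat (m * n) (m * n)" for z using c(1)[of z] by (intro tensor_one_carrier)
  show "tensor_one n F' \<in> carrier_mat (m * n) (m * n)" using c by (intro tensor_one_carrier)
  fix i j assume ij: "i < m * n" "j < m * n"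
  obtain a k where i: "a < m" "k < n" "i = a * n + k" using nat_less_times_E[OF ij(1)] .
  obtain b l where j: "b < m" "l < n" "j = b * n + l" using nat_less_times_E[OF ij(2)] .
  have e: "tensor_one n (F z) $$ (i, j) = (if k = l then F z $$ (a, b) else 0)" for z
    using tensor_one_index[OF c(1)] i j by simp
  have e': "tensor_one n F' $$ (i, j) = (if k = l then F' $$ (a, b) else 0)"
    using tensor_one_index[OF c(2)] i j by simp
  show "bounded_on_strip (\<lambda>z. tensor_one n (F z) $$ (i, j))"
    "((\<lambda>z. tensor_one n (F z) $$ (i, j)) has_field_derivative tensor_one n F' $$ (i, j)) (at 0)"
    unfolding e e' using F i j unfolding strip_mat_def
    by (cases "k = l"; auto intro: bounded_on_strip_const)+
qed

text \<open>For an eigenvalue d > 0 the power is exp(c z ln d), with derivative c ln d at 0. On the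
  kernel it is constantly 0, in agreement with \<open>ln 0 = 0\<close>, so the derivative is exactly
  c times \<open>mat_ln X\<close>.\<close>

lemma strip_mat_powr:
  fixes c :: real
  assumes X: "psd_mat n X"
  shows "strip_mat n (\<lambda>z. mat_powr X (of_real c * z)) (of_real c \<cdot>\<^sub>m mat_ln X)"
  unfolding strip_mat_def
proof (intro conjI allI impI)
  obtain U d where d: "\<And>i. 0 \<le> d i"
    and U: "\<And>f i j. i < n \<Longrightarrow> j < n \<Longrightarrow> mat_fun f X $$ (i, j) = (\<Sum>t<n. U $$ (i, t) * f (d t) * cnj (U $$ (j, t)))"
    using mat_fun_index[OF X] by metis
  show "mat_powr X (of_real c * z) \<in> carrier_mat n n" for z by (rule mat_powr_carrier[OF X])
  show "of_real c \<cdot>\<^sub>m mat_ln X \<in> carrier_mat n n" using mat_ln_carrier[OF X] by auto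
  fix i j assume ij: "i < n" "j < n"
  define h where "h t z = (if d t = 0 then 0 else exp (of_real (c * ln (d t)) * z))" for t and z :: complex
  have "complex_of_real (d t) powr (of_real c * z) = h t z" for t z
    unfolding h_def of_real_powr_eq[OF d] by (simp add: mult_ac)
  then have e: "mat_powr X (of_real c * z) $$ (i, j) = (\<Sum>t<n. U $$ (i, t) * h t z * cnj (U $$ (j, t)))" for z
    unfolding mat_powr_def U[OF ij] by simp
  have hb: "bounded_on_strip (h t)" for t
    unfolding h_def by (cases "d t = 0") (auto intro: bounded_on_strip_const bounded_on_strip_exp simp del: of_real_mult)
  show "bounded_on_strip (\<lambda>z. mat_powr X (of_real c * z) $$ (i, j))"
    unfolding e by (intro bounded_on_strip_sum bounded_on_strip_mult bounded_on_strip_const hb)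
  have hd: "(h t has_field_derivative of_real (c * ln (d t))) (at 0)" for t
    unfolding h_def by (cases "d t = 0") (auto intro!: derivative_eq_intros)
  have "((\<lambda>z. \<Sum>t<n. U $$ (i, t) * h t z * cnj (U $$ (j, t))) has_field_derivative
      (\<Sum>t<n. U $$ (i, t) * of_real (c * ln (d t)) * cnj (U $$ (j, t)))) (at 0)"
    by (intro DERIV_sum DERIV_cmult_right DERIV_cmult hd)
  also have "(\<Sum>t<n. U $$ (i, t) * of_real (c * ln (d t)) * cnj (U $$ (j, t))) = of_real c * mat_ln X $$ (i, j)"
    unfolding mat_ln_def U[OF ij] by (simp add: sum_distrib_left mult_ac)
  also have "\<dots> = (of_real c \<cdot>\<^sub>m mat_ln X) $$ (i, j)" using mat_ln_carrier[OF X] ij by auto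
  finally show "((\<lambda>z. mat_powr X (of_real c * z) $$ (i, j)) has_field_derivative (of_real c \<cdot>\<^sub>m mat_ln X) $$ (i, j)) (at 0)"
    unfolding e .
qed

section \<open>Averaging bounded continuous functions against the weight\<close>

text \<open>The rotated integrand contains an adjoint, which is antiholomorphic in z, so the strip
  class does not cover it. Bounded continuity along a vertical line survives conjugation and gives
  integrability against \<open>beta0\<close>.\<close>

definition bounded_continuous :: "(real \<Rightarrow> complex) \<Rightarrow> bool" where
  "bounded_continuous f \<longleftrightarrow> continuous_on UNIV f \<and> (\<exists>B. \<forall>t. norm (f t) \<le> B)"

lemma bounded_on_strip_imp_bounded_continuous:
  assumes f: "bounded_on_strip f" and c: "0 \<le> c" "c \<le> 1"
  shows "bounded_continuous (\<lambda>t. f (Complex c t))"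
proof -
  obtain B where B: "\<And>z. 0 \<le> Re z \<Longrightarrow> Re z \<le> 1 \<Longrightarrow> norm (f z) \<le> B"
    using f unfolding bounded_on_strip_def by auto
  have "norm (f (Complex c t)) \<le> B" for t using c by (intro B) auto
  moreover have "continuous_on UNIV (\<lambda>t. f (Complex c t))"
    using f unfolding bounded_on_strip_def by (intro entire_line_continuous) auto
  ultimately show ?thesis unfolding bounded_continuous_def by blast
qed

lemma bounded_continuous_const: "bounded_continuous (\<lambda>_. c)"
  unfolding bounded_continuous_def by auto

lemma bounded_continuous_cnj: "bounded_continuous f \<Longrightarrow> bounded_continuous (\<lambda>t. cnj (f t))"
  unfolding bounded_continuous_def by (auto intro: continuous_intros)

lemma bounded_continuous_mult:
  assumes "bounded_continuous f" "bounded_continuous g"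
  shows "bounded_continuous (\<lambda>z. f z * g z)"
proof -
  obtain A B where A: "\<And>z. norm (f z) \<le> A" and B: "\<And>z. norm (g z) \<le> B"
    using assms unfolding bounded_continuous_def by metis
  have "norm (f z * g z) \<le> A * B" for z
    unfolding norm_mult using A[of z] B[of z] order.trans[OF norm_ge_zero A[of z]]
    by (intro mult_mono) auto
  then show ?thesis using assms unfolding bounded_continuous_def by (blast intro: continuous_on_mult)
qed

lemma bounded_continuous_add:
  assumes "bounded_continuous f" "bounded_continuous g"
  shows "bounded_continuous (\<lambda>z. f z + g z)"
proof -
  obtain A B where A: "\<And>z. norm (f z) \<le> A" and B: "\<And>z. norm (g z) \<le> B"
    using assms unfolding bounded_continuous_def by metis
  have "norm (f z + g z) \<le> A + B" for z
    using norm_triangle_ineq[of "f z" "g z"] A[of z] B[of z] by linarith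
  then show ?thesis using assms unfolding bounded_continuous_def by (blast intro: continuous_on_add)
qed

lemma bounded_continuous_sum:
  "(\<And>i. i \<in> I \<Longrightarrow> bounded_continuous (f i)) \<Longrightarrow> bounded_continuous (\<lambda>z. \<Sum>i\<in>I. f i z)"
  by (induction I rule: infinite_finite_induct) (auto intro: bounded_continuous_add bounded_continuous_const)

lemma integrable_beta0_mult:
  assumes "bounded_continuous f"
  shows "integrable lborel (\<lambda>t. of_real (beta0 t) * f t)"
proof -
  obtain B where c: "continuous_on UNIV f" and B: "\<And>t. norm (f t) \<le> B"
    using assms unfolding bounded_continuous_def by auto
  have [measurable]: "f \<in> borel_measurable borel" using c by (rule borel_measurable_continuous_onI)
  show ?thesis
  proof (rule Bochner_Integration.integrable_bound)
    show "integrable lborel (\<lambda>t. beta0 t * B)" by (intro integrable_mult_left integrable_beta0)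
    show "AE t in lborel. norm (of_real (beta0 t) * f t) \<le> norm (beta0 t * B)"
    proof (rule AE_I2)
      fix t
      have "\<bar>beta0 t\<bar> * norm (f t) \<le> \<bar>beta0 t\<bar> * \<bar>B\<bar>"
        using B[of t] by (intro mult_left_mono) auto
      then show "norm (of_real (beta0 t) * f t) \<le> norm (beta0 t * B)" by (simp add: norm_mult abs_mult)
    qed
  qed measurable
qed

definition beta0_mean :: "nat \<Rightarrow> (real \<Rightarrow> complex mat) \<Rightarrow> complex mat" where
  "beta0_mean n F = mat n n (\<lambda>(i, j). \<integral>t. of_real (beta0 t) * F t $$ (i, j) \<partial>lborel)"

definition bounded_continuous_mat :: "nat \<Rightarrow> (real \<Rightarrow> complex mat) \<Rightarrow> bool" where
  "bounded_continuous_mat n F \<longleftrightarrow> (\<forall>t. F t \<in> carrier_mat n n) \<and> (\<forall>i<n. \<forall>j<n. bounded_continuous (\<lambda>t. F t $$ (i, j)))"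

lemma bounded_continuous_mat_const: "A \<in> carrier_mat n n \<Longrightarrow> bounded_continuous_mat n (\<lambda>_. A)"
  unfolding bounded_continuous_mat_def using bounded_continuous_const by auto

lemma bounded_continuous_mat_adjoint:
  "bounded_continuous_mat n F \<Longrightarrow> bounded_continuous_mat n (\<lambda>t. mat_adjoint (F t))"
  unfolding bounded_continuous_mat_def
proof (intro conjI allI impI)
  assume F: "(\<forall>t. F t \<in> carrier_mat n n) \<and> (\<forall>i<n. \<forall>j<n. bounded_continuous (\<lambda>t. F t $$ (i, j)))"
  show "mat_adjoint (F t) \<in> carrier_mat n n" for t using F by auto
  fix i j assume "i < n" "j < n"
  moreover from this have "mat_adjoint (F t) $$ (i, j) = cnj (F t $$ (j, i))" for t
    using F by (intro mat_adjoint_index) auto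
  ultimately show "bounded_continuous (\<lambda>t. mat_adjoint (F t) $$ (i, j))"
    using F bounded_continuous_cnj by auto
qed

lemma bounded_continuous_mat_mult:
  assumes F: "bounded_continuous_mat n F" and G: "bounded_continuous_mat n G"
  shows "bounded_continuous_mat n (\<lambda>t. F t * G t)"
  unfolding bounded_continuous_mat_def
proof (intro conjI allI impI)
  have c: "F t \<in> carrier_mat n n" "G t \<in> carrier_mat n n" for t
    using F G unfolding bounded_continuous_mat_def by auto
  show "F t * G t \<in> carrier_mat n n" for t using c[of t] by auto
  fix i j assume ij: "i < n" "j < n"
  have "(F t * G t) $$ (i, j) = (\<Sum>s<n. F t $$ (i, s) * G t $$ (s, j))" for t
    using c[of t] ij by (rule mult_mat_index)
  then show "bounded_continuous (\<lambda>t. (F t * G t) $$ (i, j))"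
    using F G ij unfolding bounded_continuous_mat_def
    by (auto intro!: bounded_continuous_sum bounded_continuous_mult)
qed

lemma bounded_continuous_mat_trace:
  "bounded_continuous_mat n F \<Longrightarrow> bounded_continuous (\<lambda>t. mat_trace (F t))"
  unfolding bounded_continuous_mat_def
  by (subst mat_trace_carrier[of _ n]) (auto intro!: bounded_continuous_sum)

lemma strip_mat_imp_bounded_continuous_mat:
  "strip_mat n F F' \<Longrightarrow> 0 \<le> c \<Longrightarrow> c \<le> 1 \<Longrightarrow> bounded_continuous_mat n (\<lambda>t. F (Complex c t))"
  unfolding strip_mat_def bounded_continuous_mat_def
  by (auto intro: bounded_on_strip_imp_bounded_continuous[where f = "\<lambda>z. F z $$ (_, _)"])

lemma beta0_mean_carrier [simp]: "beta0_mean n F \<in> carrier_mat n n"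
  unfolding beta0_mean_def by simp

lemma mat_trace_mult_beta0_mean:
  assumes M: "M \<in> carrier_mat n n" and F: "bounded_continuous_mat n F"
  shows "mat_trace (M * beta0_mean n F) = (\<integral>t. of_real (beta0 t) * mat_trace (M * F t) \<partial>lborel)"
proof -
  have Fc: "F t \<in> carrier_mat n n" for t using F unfolding bounded_continuous_mat_def by auto
  have int: "integrable lborel (\<lambda>t. of_real (beta0 t) * F t $$ (i, j))" if "i < n" "j < n" for i j
    using F that unfolding bounded_continuous_mat_def by (intro integrable_beta0_mult) auto
  have "mat_trace (M * beta0_mean n F) = (\<Sum>i<n. \<Sum>j<n. M $$ (i, j) * (\<integral>t. of_real (beta0 t) * F t $$ (j, i) \<partial>lborel))"
    by (subst mat_trace_mult[OF M beta0_mean_carrier]) (auto simp: beta0_mean_def)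
  also have "\<dots> = (\<integral>t. (\<Sum>i<n. \<Sum>j<n. M $$ (i, j) * (of_real (beta0 t) * F t $$ (j, i))) \<partial>lborel)"
    using int by (subst Bochner_Integration.integral_sum) (auto intro!: sum.cong Bochner_Integration.integrable_sum)
  also have "\<dots> = (\<integral>t. of_real (beta0 t) * mat_trace (M * F t) \<partial>lborel)"
    unfolding mat_trace_mult[OF M Fc] by (simp add: sum_distrib_left mult_ac)
  finally show ?thesis .
qed

lemma psd_mat_beta0_mean:
  assumes F: "bounded_continuous_mat n F" and psd: "\<And>t. psd_mat n (F t)"
  shows "psd_mat n (beta0_mean n F)"
proof (rule psd_matI_trace)
  have Fc: "F t \<in> carrier_mat n n" for t using psd psd_mat_carrier by auto
  have Fh: "cnj (F t $$ (i, j)) = F t $$ (j, i)" if "i < n" "j < n" for t i j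
    using mat_adjoint_index[of j "F t" i] psd_mat_adjoint[OF psd[of t]] Fc[of t] that by auto
  show "mat_adjoint (beta0_mean n F) = beta0_mean n F"
  proof (rule eq_matI)
    fix i j assume "i < dim_row (beta0_mean n F)" "j < dim_col (beta0_mean n F)"
    then have ij: "i < n" "j < n" by (auto simp: beta0_mean_def)
    have "mat_adjoint (beta0_mean n F) $$ (i, j) = cnj (\<integral>t. of_real (beta0 t) * F t $$ (j, i) \<partial>lborel)"
      using ij by (subst mat_adjoint_index) (auto simp: beta0_mean_def)
    also have "\<dots> = (\<integral>t. cnj (of_real (beta0 t) * F t $$ (j, i)) \<partial>lborel)"
      by (rule integral_bounded_linear'[OF bounded_linear_cnj bounded_linear_cnj, symmetric]) simp
    also have "\<dots> = beta0_mean n F $$ (i, j)"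
      using ij by (simp add: Fh beta0_mean_def)
    finally show "mat_adjoint (beta0_mean n F) $$ (i, j) = beta0_mean n F $$ (i, j)" .
  qed (auto simp: beta0_mean_def)
  fix M assume M: "psd_mat n M"
  note Mc = psd_mat_carrier[OF M]
  have int: "integrable lborel (\<lambda>t. of_real (beta0 t) * mat_trace (M * F t))"
    by (intro integrable_beta0_mult bounded_continuous_mat_trace[of n] bounded_continuous_mat_mult bounded_continuous_mat_const Mc F)
  have "0 \<le> Re (mat_trace (M * F t))" for t using mat_trace_mult_psd[OF M psd[of t]] by auto
  then show "0 \<le> Re (mat_trace (M * beta0_mean n F))"
    unfolding mat_trace_mult_beta0_mean[OF Mc F] integral_Re[OF int, symmetric]
    by (intro Bochner_Integration.integral_nonneg) (simp add: beta0_nonneg)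
qed simp

section \<open>Trace inequalities\<close>

lemma two_Re_mat_trace_le:
  assumes M: "psd_mat n M" and \<rho>: "psd_mat n \<rho>" and Y: "Y \<in> carrier_mat n n"
  shows "2 * Re (c * mat_trace (M * (Y * \<rho>))) \<le>
    Re (mat_trace (M * \<rho>)) + (cmod c)\<^sup>2 * Re (mat_trace (M * (Y * \<rho> * mat_adjoint Y)))"
proof -
  note Mc = psd_mat_carrier[OF M] and \<rho>c = psd_mat_carrier[OF \<rho>]
  define A where "A = Y * \<rho>"
  have A: "A \<in> carrier_mat n n" unfolding A_def using Y \<rho>c by auto
  have Ya: "mat_adjoint Y \<in> carrier_mat n n" using Y by auto
  have Aa: "mat_adjoint A = \<rho> * mat_adjoint Y"
    unfolding A_def mat_adjoint_mult[OF Y \<rho>c] psd_mat_adjoint[OF \<rho>] ..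
  \<comment> \<open>The claim is the positivity of \<open>tr[M Z \<rho> Z\<^sup>*]\<close> for \<open>Z = 1 - c Y\<close>.\<close>
  define Z where "Z = 1\<^sub>m n - c \<cdot>\<^sub>m Y"
  have Z: "Z \<in> carrier_mat n n" unfolding Z_def using Y by auto
  have Z\<rho>: "Z * \<rho> = \<rho> - c \<cdot>\<^sub>m A"
    unfolding Z_def A_def using Y \<rho>c
    by (subst minus_mult_distrib_mat[of _ n n _ _ n]) (auto simp: mult_smult_assoc_mat[of _ n n _ n])
  have Zadj: "mat_adjoint Z = 1\<^sub>m n - cnj c \<cdot>\<^sub>m mat_adjoint Y"
    unfolding Z_def using Y by (subst mat_adjoint_minus[of _ n n]) (auto simp: mat_adjoint_smult)
  have AY: "A * mat_adjoint Y \<in> carrier_mat n n" using A Ya by auto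
  have 1: "Z * \<rho> * mat_adjoint Z = (\<rho> - c \<cdot>\<^sub>m A) - (cnj c \<cdot>\<^sub>m mat_adjoint A - cnj c \<cdot>\<^sub>m (c \<cdot>\<^sub>m (A * mat_adjoint Y)))"
    unfolding Z\<rho> Zadj Aa using A Ya \<rho>c
    by (subst mult_minus_distrib_mat[of _ n n _ n])
      (auto simp: minus_mult_distrib_mat[of _ n n _ _ n] mult_smult_distrib[of _ n n _ n] mult_smult_assoc_mat[of _ n n _ n])
  \<comment> \<open>The two cross terms become complex conjugates and together give twice a real
    part.\<close>
  have tA: "mat_trace (M * mat_adjoint A) = cnj (mat_trace (M * A))"
  proof -
    have "M * mat_adjoint A = mat_adjoint (A * M)" using mat_adjoint_mult[OF A Mc] psd_mat_adjoint[OF M] by simp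
    then have "mat_trace (M * mat_adjoint A) = cnj (mat_trace (A * M))"
      using A Mc by (simp add: mat_trace_adjoint[of _ n] mult_carrier_mat[of _ n n _ n])
    then show ?thesis using mat_trace_comm[OF A Mc] by simp
  qed
  have "mat_trace (M * (Z * \<rho> * mat_adjoint Z)) =
      mat_trace (M * \<rho>) - c * mat_trace (M * A) - cnj c * (mat_trace (M * mat_adjoint A) - c * mat_trace (M * (A * mat_adjoint Y)))"
    unfolding 1 using Mc \<rho>c A AY mat_adjoint_carrier[OF A]
    by (simp add: mult_minus_distrib_mat[of _ n n _ n] mult_smult_distrib[of _ n n _ n] mat_trace_minus[of _ n]
        mat_trace_smult[of _ n] mult_carrier_mat[of _ n n _ n] minus_carrier_mat right_diff_distrib)
  note expand = this
  have "Re (mat_trace (M * (Z * \<rho> * mat_adjoint Z))) =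
      Re (mat_trace (M * \<rho>)) - 2 * Re (c * mat_trace (M * A)) + (cmod c)\<^sup>2 * Re (mat_trace (M * (A * mat_adjoint Y)))"
  proof -
    have "Re (a - c * b - cnj c * (cnj b - c * d)) = Re a - 2 * Re (c * b) + (cmod c)\<^sup>2 * Re d" for a b d
      by (simp add: cmod_power2) (simp add: power2_eq_square algebra_simps)
    then show ?thesis unfolding expand tA .
  qed
  moreover have "0 \<le> Re (mat_trace (M * (Z * \<rho> * mat_adjoint Z)))"
    using mat_trace_mult_psd[OF M psd_mat_conj[OF \<rho> Z]] by auto
  ultimately show ?thesis unfolding A_def by simp
qed

text \<open>S is a partial isometry with initial projection P. By cyclicity the left side is the
  trace of P W, and the missing part is the trace of (1 - P) W, which is nonnegative.\<close>

lemma mat_trace_conj_le: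
  assumes S: "S \<in> carrier_mat n n" and P: "mat_adjoint P = P" "P * P = P" "mat_adjoint S * S = P" and W: "psd_mat n W"
  shows "Re (mat_trace (S * W * mat_adjoint S)) \<le> Re (mat_trace W)"
proof -
  note Wc = psd_mat_carrier[OF W]
  have Pc: "P \<in> carrier_mat n n" using S P(3) by (metis mat_adjoint_carrier mult_carrier_mat)
  have "mat_trace (S * W * mat_adjoint S) = mat_trace (mat_adjoint S * (S * W))"
    using S Wc by (intro mat_trace_comm[of _ n n]) auto
  also have "mat_adjoint S * (S * W) = P * W"
    unfolding P(3)[symmetric] using S Wc by (intro assoc_mult_mat[symmetric, of _ n n _ n _ n]) auto
  also have "mat_trace (P * W) = mat_trace W - mat_trace ((1\<^sub>m n - P) * W)"
    using Pc Wc by (simp add: minus_mult_distrib_mat[of _ n n _ _ n] mat_trace_minus[of _ n] mult_carrier_mat[of _ n n _ n])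
  finally show ?thesis
    using mat_trace_mult_psd[OF proj_complement(4)[OF Pc P(1,2)] W] by auto
qed

lemma povm_psd: "povm n k M \<Longrightarrow> x < k \<Longrightarrow> psd_mat n (M x)"
  unfolding povm_def by auto

lemma povm_sum_trace:
  assumes M: "povm n k M" and X: "X \<in> carrier_mat n n"
  shows "(\<Sum>x<k. mat_trace (M x * X)) = mat_trace X"
proof -
  have s: "(\<Sum>x<k. M x $$ (i, j)) = (if i = j then 1 else 0)" if "i < n" "j < n" for i j
  proof -
    have "mat n n (\<lambda>(i, j). \<Sum>x<k. M x $$ (i, j)) $$ (i, j) = 1\<^sub>m n $$ (i, j)"
      using M unfolding povm_def by simp
    then show ?thesis using that by simp
  qed
  have "(\<Sum>x<k. mat_trace (M x * X)) = (\<Sum>x<k. \<Sum>i<n. \<Sum>j<n. M x $$ (i, j) * X $$ (j, i))"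
    by (intro sum.cong refl mat_trace_mult[OF psd_mat_carrier[OF povm_psd[OF M]] X]) auto
  also have "\<dots> = (\<Sum>i<n. \<Sum>x<k. \<Sum>j<n. M x $$ (i, j) * X $$ (j, i))" by (rule sum.swap)
  also have "\<dots> = (\<Sum>i<n. \<Sum>j<n. \<Sum>x<k. M x $$ (i, j) * X $$ (j, i))" by (intro sum.cong refl sum.swap)
  also have "\<dots> = (\<Sum>i<n. \<Sum>j<n. (if i = j then 1 else 0) * X $$ (j, i))"
    by (intro sum.cong refl) (simp add: s flip: sum_distrib_right)
  also have "\<dots> = mat_trace X" using X by (simp add: mat_trace_carrier[of X n] if_distrib[of "\<lambda>x. x * _"] cong: if_cong)
  finally show ?thesis .
qed

lemma povm_channel_eq:
  assumes M: "povm n k M" and X: "psd_mat n X"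
  shows "povm_channel k M X = mat_diag k (\<lambda>x. complex_of_real (Re (mat_trace (M x * X))))"
  unfolding povm_channel_def
proof (rule eq_matI)
  have "mat_trace (M x * X) = complex_of_real (Re (mat_trace (M x * X)))" if "x < k" for x
    using mat_trace_mult_psd[OF povm_psd[OF M that] X] by auto
  then show "mat_diag k (\<lambda>x. mat_trace (M x * X)) $$ (i, j) =
      mat_diag k (\<lambda>x. complex_of_real (Re (mat_trace (M x * X)))) $$ (i, j)"
    if "i < dim_row (mat_diag k (\<lambda>x. complex_of_real (Re (mat_trace (M x * X)))))"
      "j < dim_col (mat_diag k (\<lambda>x. complex_of_real (Re (mat_trace (M x * X)))))" for i j
    using that by (simp add: mat_diag_def)
qed (auto simp: mat_diag_def)

lemma povm_tensor_one:
  assumes M: "povm m k M"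
  shows "povm (m * n) k (\<lambda>x. tensor_one n (M x))"
  unfolding povm_def
proof (intro conjI allI impI)
  show "psd_mat (m * n) (tensor_one n (M x))" if "x < k" for x
    by (intro psd_mat_tensor_one povm_psd[OF M that])
  have c: "M x \<in> carrier_mat m m" if "x < k" for x using psd_mat_carrier[OF povm_psd[OF M that]] .
  have one: "mat m m (\<lambda>(i, j). \<Sum>x<k. M x $$ (i, j)) = 1\<^sub>m m" using M unfolding povm_def by auto
  show "mat (m * n) (m * n) (\<lambda>(i, j). \<Sum>x<k. tensor_one n (M x) $$ (i, j)) = 1\<^sub>m (m * n)"
    unfolding tensor_one_one[symmetric]
  proof (rule tensor_one_eqI[where a = m and b = m and n = n])
    fix i a j b assume ij: "i < m" "a < n" "j < m" "b < n"
    have "(\<Sum>x<k. tensor_one n (M x) $$ (i * n + a, j * n + b)) = (if a = b then \<Sum>x<k. M x $$ (i, j) else 0)"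
      using ij by (auto intro!: sum.cong sum.neutral simp: tensor_one_index[OF c])
    also have "(\<Sum>x<k. M x $$ (i, j)) = 1\<^sub>m m $$ (i, j)" using ij unfolding one[symmetric] by simp
    finally show "mat (m * n) (m * n) (\<lambda>(i, j). \<Sum>x<k. tensor_one n (M x) $$ (i, j)) $$ (i * n + a, j * n + b) =
        tensor_one n (1\<^sub>m m) $$ (i * n + a, j * n + b)"
      using ij by (simp add: times_add_less tensor_one_index[of _ m m])
  qed (auto intro: tensor_one_carrier)
qed

section \<open>Classical relative entropies\<close>

text \<open>The second argument enters through -ln, which is decreasing. Where q' vanishes and p
  does not, the right side is infinite, so termwise comparison is left to the absolutely continuous
  case.\<close>

lemma rel_entropy_diag_antimono:
  assumes "\<And>x. x < k \<Longrightarrow> 0 \<le> p x" "\<And>x. x < k \<Longrightarrow> 0 \<le> q' x" "\<And>x. x < k \<Longrightarrow> q' x \<le> q x"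
  shows "rel_entropy (mat_diag k (\<lambda>x. complex_of_real (p x))) (mat_diag k (\<lambda>x. complex_of_real (q x)))
    \<le> rel_entropy (mat_diag k (\<lambda>x. complex_of_real (p x))) (mat_diag k (\<lambda>x. complex_of_real (q' x)))"
proof (cases "\<forall>x<k. q' x = 0 \<longrightarrow> p x = 0")
  case True
  have "q x = 0 \<longrightarrow> p x = 0" if "x < k" for x
    using True assms[OF that] that by force
  moreover have "p x * (ln (p x) - ln (q x)) \<le> p x * (ln (p x) - ln (q' x))" if "x < k" for x
  proof (cases "p x = 0")
    case False
    then have "0 < q' x" using True assms(2)[OF that] that by force
    then show ?thesis using assms(1,3)[OF that] by (intro mult_left_mono) auto
  qed simp
  ultimately show ?thesis using True unfolding rel_entropy_diag by (auto intro!: sum_mono)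
next
  case False
  then show ?thesis unfolding rel_entropy_diag[of k p q'] if_not_P[OF False] by simp
qed

lemma rel_entropy_diag_le:
  fixes p q :: "nat \<Rightarrow> real"
  assumes p: "\<And>x. x < k \<Longrightarrow> 0 \<le> p x" "(\<Sum>x<k. p x) = 1" and q: "\<And>x. x < k \<Longrightarrow> 0 \<le> q x"
    and var: "\<And>l. (\<Sum>x<k. l x * p x) - D \<le> (\<Sum>x<k. exp (l x) * q x) - 1"
  shows "rel_entropy (mat_diag k (\<lambda>x. complex_of_real (p x))) (mat_diag k (\<lambda>x. complex_of_real (q x))) \<le> ereal D"
proof -
  have ac: "p x = 0" if x: "x < k" "q x = 0" for x
  proof (rule ccontr)
    assume "p x \<noteq> 0"
    then have px: "0 < p x" using p(1)[OF x(1)] by simp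
    \<comment> \<open>Letting \<open>l\<^sub>x\<close> grow makes the left side of the hypothesis unbounded while the right side stays fixed.\<close>
    define L where "L = ((\<Sum>y<k. q y) + D) / p x"
    have "(\<Sum>y<k. (if y = x then L else 0) * p y) = L * p x"
      using x(1) by (simp add: if_distrib[of "\<lambda>a. a * _"] cong: if_cong)
    moreover have "(\<Sum>y<k. exp (if y = x then L else 0) * q y) = (\<Sum>y<k. q y)"
      using x(2) by (intro sum.cong) auto
    ultimately have "L * p x - D \<le> (\<Sum>y<k. q y) - 1" using var[of "\<lambda>y. if y = x then L else 0"] by simp
    then show False unfolding L_def using px by simp
  qed
  define E where "E = (\<Sum>x<k. p x * (ln (p x) - ln (q x)))"
  define Q where "Q = (\<Sum>x<k. q x)"
  have Q: "0 \<le> Q" unfolding Q_def using q by (intro sum_nonneg) auto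
  have eps: "E - D \<le> \<epsilon> * Q" if \<epsilon>: "0 < \<epsilon>" for \<epsilon>
  proof -
    \<comment> \<open>The optimal l is ln(p x / q x). Where p x = 0 it would be minus infinity; ln
      \<epsilon> replaces it and adds \<epsilon> times q x to the right side.\<close>
    define l where "l x = (if p x = 0 then ln \<epsilon> else ln (p x) - ln (q x))" for x
    have "(\<Sum>x<k. l x * p x) = E" unfolding E_def l_def by (intro sum.cong) auto
    moreover have "(\<Sum>x<k. exp (l x) * q x) \<le> (\<Sum>x<k. p x + \<epsilon> * q x)"
    proof (rule sum_mono)
      fix x assume "x \<in> {..<k}"
      then have x: "x < k" by simp
      show "exp (l x) * q x \<le> p x + \<epsilon> * q x"
      proof (cases "p x = 0")
        case False
        then have "0 < p x" "0 < q x" using p(1)[OF x] q[OF x] ac[OF x] by force+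
        then show ?thesis using \<epsilon> unfolding l_def by (simp add: exp_diff)
      qed (use \<epsilon> in \<open>simp add: l_def\<close>)
    qed
    moreover have "(\<Sum>x<k. p x + \<epsilon> * q x) = 1 + \<epsilon> * Q"
      unfolding Q_def sum.distrib p(2) by (simp add: sum_distrib_left)
    ultimately show ?thesis using var[of l] by simp
  qed
  have "E \<le> D"
  proof (rule ccontr)
    assume "\<not> E \<le> D"
    \<comment> \<open>With this \<epsilon> the bound \<epsilon> Q falls short of E - D; the
      denominator Q + 1 is positive even if Q = 0.\<close>
    then have "0 < (E - D) / (Q + 1)" using Q by simp
    from eps[OF this] have "(E - D) * (Q + 1) \<le> (E - D) * Q" using Q by (simp add: field_simps)
    then show False using \<open>\<not> E \<le> D\<close> by (simp add: algebra_simps)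
  qed
  then show ?thesis unfolding rel_entropy_diag E_def using ac by auto
qed

section \<open>The variational inequality for the rotated state\<close>

locale rotated_extension =
  fixes m n :: nat and \<rho> \<sigma> :: "complex mat"
  assumes \<rho>: "density_mat (m * n) \<rho>" and \<sigma>: "density_mat m \<sigma>"
begin

abbreviation "N \<equiv> m * n"
abbreviation "\<rho>A \<equiv> ptrace_snd m n \<rho>"
abbreviation "\<sigma>AB \<equiv> sigma_bar m n \<rho> \<sigma>"
abbreviation "R \<equiv> rotated_integrand m n \<rho> \<sigma>"

lemma psd: "psd_mat N \<rho>" "psd_mat m \<sigma>" "psd_mat m \<rho>A"
  and trace_\<rho>: "mat_trace \<rho> = 1" and trace_\<sigma>: "mat_trace \<sigma> = 1"
  using \<rho> \<sigma> psd_mat_ptrace_snd unfolding density_mat_def by auto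

lemma carrier: "\<rho> \<in> carrier_mat N N" "\<sigma> \<in> carrier_mat m m" "\<rho>A \<in> carrier_mat m m"
  using psd psd_mat_carrier by auto

text \<open>The exponent is kept as a real multiple of z to match \<open>strip_mat_powr\<close>. At
  z = 1 + i t, \<open>S\<close> and \<open>T\<close> are the two factors to the left of
  \<open>\<rho>\<close> in the rotated integrand.\<close>

definition S :: "complex \<Rightarrow> complex mat" where
  "S z = tensor_one n (mat_powr \<sigma> (of_real (1 / 2) * z))"

definition T :: "complex \<Rightarrow> complex mat" where
  "T z = tensor_one n (mat_powr \<rho>A (of_real (- 1 / 2) * z))"

lemma S_carrier: "S z \<in> carrier_mat N N" and T_carrier: "T z \<in> carrier_mat N N"
  unfolding S_def T_def using psd by (auto intro: tensor_one_carrier mat_powr_carrier)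

lemma tensor_powr_mult:
  assumes "psd_mat m X"
  shows "tensor_one n (mat_powr X a) * tensor_one n (mat_powr X b) = tensor_one n (mat_powr X (a + b))"
  using mat_powr_carrier[OF assms] by (subst tensor_one_mult[of _ m m _ m]) (auto simp: mat_powr_mult[OF assms])

lemma tensor_powr_adjoint:
  assumes "psd_mat m X"
  shows "mat_adjoint (tensor_one n (mat_powr X a)) = tensor_one n (mat_powr X (cnj a))"
  using tensor_one_adjoint[OF mat_powr_carrier[OF assms]] mat_powr_adjoint[OF assms] by simp

text \<open>For imaginary z an exponent and its conjugate cancel, so the adjoint times the operator
  is its value at 0, a support projection. Hence \<open>S z\<close> and \<open>T z\<close> are
  partial isometries.\<close>

lemma trace_S_conj_le:
  assumes "Re z = 0" "psd_mat N W"
  shows "Re (mat_trace (S z * W * mat_adjoint (S z))) \<le> Re (mat_trace W)"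
    and "Re (mat_trace (T z * W * mat_adjoint (T z))) \<le> Re (mat_trace W)"
proof -
  have z: "cnj (of_real c * z) + of_real c * z = 0" for c :: real using assms(1) by (simp add: complex_eq_iff)
  have z2: "mat_adjoint (S z) * S z = S 0" "mat_adjoint (T z) * T z = T 0"
    unfolding S_def T_def tensor_powr_adjoint[OF psd(2)] tensor_powr_adjoint[OF psd(3)]
      tensor_powr_mult[OF psd(2)] tensor_powr_mult[OF psd(3)] z by simp_all
  have P: "mat_adjoint (S 0) = S 0" "S 0 * S 0 = S 0" "mat_adjoint (T 0) = T 0" "T 0 * T 0 = T 0"
    unfolding S_def T_def
    by (simp_all add: tensor_powr_adjoint[OF psd(2)] tensor_powr_adjoint[OF psd(3)]
        tensor_powr_mult[OF psd(2)] tensor_powr_mult[OF psd(3)])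
  show "Re (mat_trace (S z * W * mat_adjoint (S z))) \<le> Re (mat_trace W)"
    by (rule mat_trace_conj_le[OF S_carrier P(1,2) z2(1) assms(2)])
  show "Re (mat_trace (T z * W * mat_adjoint (T z))) \<le> Re (mat_trace W)"
    by (rule mat_trace_conj_le[OF T_carrier P(3,4) z2(2) assms(2)])
qed

definition Y :: "complex \<Rightarrow> complex mat" where "Y z = S z * T z"

lemma Y_carrier: "Y z \<in> carrier_mat N N"
  unfolding Y_def by (rule mult_carrier_mat[OF S_carrier T_carrier])

text \<open>The product rule at 0 for sigma_A^(z/2) rho_A^(-z/2). The support projections
  \<open>T 0\<close> and \<open>S 0\<close> stay until \<open>\<rho>\<close> absorbs them.\<close>

definition Y' :: "complex mat" where
  "Y' = tensor_one n (of_real (1 / 2) \<cdot>\<^sub>m mat_ln \<sigma>) * T 0 + S 0 * tensor_one n (of_real (- 1 / 2) \<cdot>\<^sub>m mat_ln \<rho>A)"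

lemma strip_mat_Y: "strip_mat N Y Y'"
proof -
  have "strip_mat N S (tensor_one n (of_real (1 / 2) \<cdot>\<^sub>m mat_ln \<sigma>))"
    unfolding S_def[abs_def] by (intro strip_mat_tensor_one strip_mat_powr psd)
  moreover have "strip_mat N T (tensor_one n (of_real (- 1 / 2) \<cdot>\<^sub>m mat_ln \<rho>A))"
    unfolding T_def[abs_def] by (intro strip_mat_tensor_one strip_mat_powr psd)
  ultimately show ?thesis unfolding Y_def[abs_def] Y'_def by (rule strip_mat_mult)
qed

text \<open>On the line z = 1 + i t the exponents to the right of \<open>\<rho>\<close> are the
  conjugates of those to the left, so the right factors are adjoints of the left ones. Positivity of
  the integrand follows.\<close>

lemma rotated_integrand_eq: "R t = Y (Complex 1 t) * \<rho> * mat_adjoint (Y (Complex 1 t))"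
proof -
  let ?z = "Complex 1 t"
  have z: "(1 + \<i> * complex_of_real t) / 2 = of_real (1 / 2) * ?z"
    "- ((1 + \<i> * complex_of_real t) / 2) = of_real (- 1 / 2) * ?z"
    "(1 - \<i> * complex_of_real t) / 2 = cnj (of_real (1 / 2) * ?z)"
    "- ((1 - \<i> * complex_of_real t) / 2) = cnj (of_real (- 1 / 2) * ?z)"
    by (simp_all add: complex_eq_iff)
  have "R t = S ?z * T ?z * \<rho> * mat_adjoint (T ?z) * mat_adjoint (S ?z)"
    unfolding rotated_integrand_def Let_def z(2,4) unfolding z(1,3)
    unfolding S_def T_def tensor_powr_adjoint[OF psd(2)] tensor_powr_adjoint[OF psd(3)] ..
  also have "\<dots> = Y ?z * \<rho> * mat_adjoint (Y ?z)"
    unfolding Y_def mat_adjoint_mult[OF S_carrier T_carrier]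
    using S_carrier[of ?z] T_carrier[of ?z] carrier
    by (intro assoc_mult_mat[of _ N N _ N _ N]) (auto simp: mult_carrier_mat[of _ N N _ N])
  finally show ?thesis .
qed

lemma psd_R: "psd_mat N (R t)"
  unfolding rotated_integrand_eq by (rule psd_mat_conj[OF psd(1) Y_carrier])

lemma bounded_continuous_mat_R: "bounded_continuous_mat N R"
  unfolding rotated_integrand_eq[abs_def]
  by (intro bounded_continuous_mat_mult bounded_continuous_mat_adjoint bounded_continuous_mat_const carrier
      strip_mat_imp_bounded_continuous_mat[OF strip_mat_Y]) auto

lemma sigma_bar_eq: "\<sigma>AB = beta0_mean N R"
  unfolding sigma_bar_def beta0_mean_def ..

lemma psd_sigma_bar: "psd_mat N \<sigma>AB"
  unfolding sigma_bar_eq by (rule psd_mat_beta0_mean[OF bounded_continuous_mat_R psd_R])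

lemma integrable_trace_R:
  "M \<in> carrier_mat N N \<Longrightarrow> integrable lborel (\<lambda>t. beta0 t * Re (mat_trace (M * R t)))"
  and Re_trace_sigma_bar:
  "M \<in> carrier_mat N N \<Longrightarrow> Re (mat_trace (M * \<sigma>AB)) = (\<integral>t. beta0 t * Re (mat_trace (M * R t)) \<partial>lborel)"
proof -
  assume M: "M \<in> carrier_mat N N"
  have int: "integrable lborel (\<lambda>t. of_real (beta0 t) * mat_trace (M * R t))"
    by (intro integrable_beta0_mult bounded_continuous_mat_trace[of N] bounded_continuous_mat_mult
        bounded_continuous_mat_const M bounded_continuous_mat_R)
  show "integrable lborel (\<lambda>t. beta0 t * Re (mat_trace (M * R t)))" using integrable_Re[OF int] by simp
  show "Re (mat_trace (M * \<sigma>AB)) = (\<integral>t. beta0 t * Re (mat_trace (M * R t)) \<partial>lborel)"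
    unfolding sigma_bar_eq mat_trace_mult_beta0_mean[OF M bounded_continuous_mat_R] integral_Re[OF int, symmetric] by simp
qed

text \<open>The support of \<open>\<rho>\<close> lies in supp rho_A tensor B: for the complementary
  projection Q, the expectation of Q tensor 1 in \<open>\<rho>\<close> is tr[Q rho_A] = 0, which
  forces the product with \<open>\<rho>\<close> to vanish.\<close>

lemma T_zero_mult_\<rho>: "T 0 * \<rho> = \<rho>"
proof -
  define Q where "Q = 1\<^sub>m m - mat_powr \<rho>A 0"
  have P: "mat_powr \<rho>A 0 \<in> carrier_mat m m" by (rule mat_powr_carrier[OF psd(3)])
  have Q: "Q \<in> carrier_mat m m" "mat_adjoint Q = Q" "Q * Q = Q"
    unfolding Q_def using proj_complement[OF P mat_powr_zero_proj[OF psd(3)]] by auto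
  note Qc = tensor_one_carrier[OF Q(1), of n]
  have "Q * \<rho>A = 0\<^sub>m m m"
    unfolding Q_def using P carrier mat_powr_zero_mult[OF psd(3)]
    by (simp add: minus_mult_distrib_mat[of _ m m _ _ m] left_mult_one_mat[OF carrier(3)])
  then have "mat_trace (tensor_one n Q * \<rho>) = 0"
    unfolding mat_trace_tensor_one_mult[OF Q(1) carrier(1)] by (simp add: mat_trace_def)
  then have "tensor_one n Q * \<rho> = 0\<^sub>m N N"
    using Qc Q by (intro mat_trace_mult_psd_eq_0 psd) (auto simp: tensor_one_adjoint[of _ m m] tensor_one_mult[of _ m m _ m])
  moreover have "tensor_one n Q = 1\<^sub>m N - T 0"
    unfolding Q_def T_def using P by (simp add: tensor_one_minus[of _ m m] tensor_one_one)
  ultimately have 0: "\<rho> - T 0 * \<rho> = 0\<^sub>m N N"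
    using T_carrier[of 0] carrier by (simp add: minus_mult_distrib_mat[of _ N N _ _ N])
  have c: "T 0 * \<rho> \<in> carrier_mat N N" using T_carrier[of 0] carrier by auto
  show ?thesis
  proof (rule eq_matI)
    fix i j assume "i < dim_row \<rho>" "j < dim_col \<rho>"
    then have ij: "i < N" "j < N" using carrier by auto
    have "(\<rho> - T 0 * \<rho>) $$ (i, j) = 0" unfolding 0 using ij by simp
    then show "(T 0 * \<rho>) $$ (i, j) = \<rho> $$ (i, j)" using ij carrier T_carrier[of 0] by (simp del: index_mult_mat(1))
  qed (use c carrier in auto)
qed

context
  assumes supp: "mat_supp \<rho>A \<subseteq> mat_supp \<sigma>"
begin

text \<open>The support inclusion makes the projection of sigma_A act as the identity on that of
  rho_A, and the latter already fixes \<open>\<rho>\<close>.\<close>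

lemma S_zero_mult_\<rho>: "S 0 * \<rho> = \<rho>"
proof -
  have "S 0 * T 0 = T 0"
    unfolding S_def T_def using mat_powr_carrier[OF psd(2)] mat_powr_carrier[OF psd(3)] mat_supp_subset_proj[OF psd(3,2) supp]
    by (simp add: tensor_one_mult[of _ m m _ m])
  then show ?thesis
    using assoc_mult_mat[OF S_carrier[of 0] T_carrier[of 0] carrier(1)] T_zero_mult_\<rho> by simp
qed

lemma \<rho>_mult_S_zero: "\<rho> * S 0 = \<rho>"
proof -
  have "mat_adjoint (S 0) = S 0" unfolding S_def by (simp add: tensor_powr_adjoint[OF psd(2)])
  then show ?thesis
    using arg_cong[OF S_zero_mult_\<rho>, of mat_adjoint] mat_adjoint_mult[OF S_carrier[of 0] carrier(1)] psd_mat_adjoint[OF psd(1)]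
    by simp
qed

lemma Y_zero_mult_\<rho>: "Y 0 * \<rho> = \<rho>"
  unfolding Y_def using assoc_mult_mat[OF S_carrier[of 0] T_carrier[of 0] carrier(1)] T_zero_mult_\<rho> S_zero_mult_\<rho> by simp

text \<open>\<open>\<rho>\<close> absorbs \<open>T 0\<close> directly and \<open>S 0\<close> after a
  cyclic shift; duality with the partial trace then moves the logarithms to rho_A. The factor 2
  undoes the halved exponents.\<close>

lemma trace_Y'_mult_\<rho>:
  "2 * Re (mat_trace (Y' * \<rho>)) = - Re (mat_trace (\<rho>A * (mat_ln \<rho>A - mat_ln \<sigma>)))"
proof -
  note ln\<sigma> = mat_ln_carrier[OF psd(2)] and ln\<rho> = mat_ln_carrier[OF psd(3)]
  define A where "A = tensor_one n (of_real (1 / 2) \<cdot>\<^sub>m mat_ln \<sigma>)"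
  define B where "B = tensor_one n (of_real (- 1 / 2) \<cdot>\<^sub>m mat_ln \<rho>A)"
  have A: "A \<in> carrier_mat N N" and B: "B \<in> carrier_mat N N"
    unfolding A_def B_def using ln\<sigma> ln\<rho> by (auto intro!: tensor_one_carrier)
  have c: "A * T 0 \<in> carrier_mat N N" "S 0 * B \<in> carrier_mat N N" "B * \<rho> \<in> carrier_mat N N"
    using A B S_carrier[of 0] T_carrier[of 0] carrier by auto
  have "mat_trace (Y' * \<rho>) = mat_trace (A * T 0 * \<rho>) + mat_trace (S 0 * B * \<rho>)"
    unfolding Y'_def A_def[symmetric] B_def[symmetric] add_mult_distrib_mat[OF c(1,2) carrier(1)]
    using c carrier by (intro mat_trace_add[of _ N]) auto
  also have "A * T 0 * \<rho> = A * \<rho>"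
    using assoc_mult_mat[OF A T_carrier[of 0] carrier(1)] T_zero_mult_\<rho> by simp
  also have "mat_trace (S 0 * B * \<rho>) = mat_trace (B * \<rho> * S 0)"
    using mat_trace_comm[OF S_carrier[of 0] c(3)] assoc_mult_mat[OF S_carrier[of 0] B carrier(1)] by simp
  also have "B * \<rho> * S 0 = B * \<rho>"
    using assoc_mult_mat[OF B carrier(1) S_carrier[of 0]] \<rho>_mult_S_zero by simp
  also have "mat_trace (A * \<rho>) = of_real (1 / 2) * mat_trace (\<rho>A * mat_ln \<sigma>)"
    unfolding A_def using ln\<sigma> carrier mat_trace_comm[OF ln\<sigma> carrier(3)]
    by (subst mat_trace_tensor_one_mult)
      (auto simp: mult_smult_assoc_mat[of _ m m _ m] mat_trace_smult[of _ m] mult_carrier_mat[of _ m m _ m])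
  also have "mat_trace (B * \<rho>) = of_real (- 1 / 2) * mat_trace (\<rho>A * mat_ln \<rho>A)"
    unfolding B_def using ln\<rho> carrier mat_trace_comm[OF ln\<rho> carrier(3)]
    by (subst mat_trace_tensor_one_mult)
      (auto simp: mult_smult_assoc_mat[of _ m m _ m] mat_trace_smult[of _ m] mult_carrier_mat[of _ m m _ m])
  finally have "2 * Re (mat_trace (Y' * \<rho>)) = Re (mat_trace (\<rho>A * mat_ln \<sigma>)) - Re (mat_trace (\<rho>A * mat_ln \<rho>A))"
    by simp
  moreover have "mat_trace (\<rho>A * (mat_ln \<rho>A - mat_ln \<sigma>)) = mat_trace (\<rho>A * mat_ln \<rho>A) - mat_trace (\<rho>A * mat_ln \<sigma>)"
    unfolding mult_minus_distrib_mat[OF carrier(3) ln\<rho> ln\<sigma>]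
    by (intro mat_trace_minus[of _ m] mult_carrier_mat[OF carrier(3)] ln\<rho> ln\<sigma>)
  ultimately show ?thesis by simp
qed

theorem variational_bound:
  assumes M: "povm N k M"
  shows "(\<Sum>x<k. l x * Re (mat_trace (M x * \<rho>))) - Re (mat_trace (\<rho>A * (mat_ln \<rho>A - mat_ln \<sigma>)))
    \<le> (\<Sum>x<k. exp (l x) * Re (mat_trace (M x * \<sigma>AB))) - 1"
proof -
  have Mc: "M x \<in> carrier_mat N N" and Mp: "psd_mat N (M x)" if "x < k" for x
    using povm_psd[OF M that] psd_mat_carrier by auto
  \<comment> \<open>Cyclicity isolates the z-dependent factor, so \<open>g\<close> becomes a fixed
    linear combination of the entries of \<open>Y z\<close> and inherits holomorphy, bounds and
    derivative.\<close>
  have cyc: "mat_trace (\<rho> * M x * X) = mat_trace (M x * (X * \<rho>))" if "x < k" "X \<in> carrier_mat N N" for x X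
  proof -
    have "mat_trace (\<rho> * M x * X) = mat_trace (\<rho> * (M x * X))"
      using assoc_mult_mat[OF carrier(1) Mc[OF that(1)] that(2)] by simp
    also have "\<dots> = mat_trace (M x * X * \<rho>)"
      using Mc[OF that(1)] that(2) carrier by (intro mat_trace_comm[of _ N N]) auto
    finally show ?thesis using assoc_mult_mat[OF Mc[OF that(1)] that(2) carrier(1)] by simp
  qed
  define g where "g x z = mat_trace (M x * (Y z * \<rho>))" for x z
  define f where "f z = (\<Sum>x<k. exp (of_real (l x / 2) * z) * g x z)" for z
  define f' where "f' = (\<Sum>x<k. of_real (l x / 2) * mat_trace (M x * \<rho>)) + mat_trace (Y' * \<rho>)"
  have Y'c: "Y' \<in> carrier_mat N N" using strip_mat_Y unfolding strip_mat_def by auto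
  have g_eq: "g x z = (\<Sum>i<N. \<Sum>j<N. (\<rho> * M x) $$ (i, j) * Y z $$ (j, i))" if "x < k" for x z
    unfolding g_def cyc[OF that Y_carrier, symmetric]
    using Mc[OF that] carrier Y_carrier by (intro mat_trace_mult) auto
  have g_strip: "bounded_on_strip (g x)" if "x < k" for x
    unfolding g_eq[OF that, abs_def] using strip_mat_Y unfolding strip_mat_def
    by (intro bounded_on_strip_sum bounded_on_strip_mult bounded_on_strip_const) auto
  have g_deriv: "(g x has_field_derivative mat_trace (M x * (Y' * \<rho>))) (at 0)" if "x < k" for x
  proof -
    have "mat_trace (M x * (Y' * \<rho>)) = (\<Sum>i<N. \<Sum>j<N. (\<rho> * M x) $$ (i, j) * Y' $$ (j, i))"
      unfolding cyc[OF that Y'c, symmetric] using Mc[OF that] carrier Y'c by (intro mat_trace_mult) auto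
    then show ?thesis
      unfolding g_eq[OF that, abs_def] using strip_mat_Y unfolding strip_mat_def
      by (auto intro!: DERIV_sum DERIV_cmult)
  qed
  have g0: "g x 0 = mat_trace (M x * \<rho>)" for x unfolding g_def Y_zero_mult_\<rho> ..
  have f_strip: "bounded_on_strip f"
    unfolding f_def[abs_def] by (intro bounded_on_strip_sum bounded_on_strip_mult bounded_on_strip_exp g_strip) auto
  have f0: "f 0 = 1"
    unfolding f_def g0 using povm_sum_trace[OF M carrier(1)] trace_\<rho> by simp
  have "((\<lambda>z. exp (of_real (l x / 2) * z)) has_field_derivative of_real (l x / 2)) (at 0)" for x
    by (auto intro!: derivative_eq_intros)
  then have "(f has_field_derivative (\<Sum>x<k. of_real (l x / 2) * g x 0 +
      mat_trace (M x * (Y' * \<rho>)) * exp (of_real (l x / 2) * 0))) (at 0)"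
    unfolding f_def[abs_def] using g_deriv by (intro DERIV_sum DERIV_mult) auto
  also have "(\<Sum>x<k. of_real (l x / 2) * g x 0 + mat_trace (M x * (Y' * \<rho>)) * exp (of_real (l x / 2) * 0)) = f'"
    unfolding f'_def g0 sum.distrib using povm_sum_trace[OF M, of "Y' * \<rho>"] Y'c carrier by simp
  finally have f_deriv: "(f has_field_derivative f') (at 0)" .
  have f'_Re: "2 * Re f' = (\<Sum>x<k. l x * Re (mat_trace (M x * \<rho>))) - Re (mat_trace (\<rho>A * (mat_ln \<rho>A - mat_ln \<sigma>)))"
    using trace_Y'_mult_\<rho> unfolding f'_def by (simp add: sum_distrib_left)
  \<comment> \<open>The modulus of the weight is squared in \<open>two_Re_mat_trace_le\<close>, so
    exp(l x z / 2) becomes exp(l x Re z): 1 on the left edge and exp(l x) on the right edge, for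
    every t.\<close>
  have f_le: "2 * Re (f z) \<le> 1 + (\<Sum>x<k. exp (l x * Re z) * Re (mat_trace (M x * (Y z * \<rho> * mat_adjoint (Y z)))))" for z
  proof -
    have "2 * Re (exp (of_real (l x / 2) * z) * g x z) \<le> Re (mat_trace (M x * \<rho>)) +
        exp (l x * Re z) * Re (mat_trace (M x * (Y z * \<rho> * mat_adjoint (Y z))))" if "x < k" for x
    proof -
      have "(cmod (exp (of_real (l x / 2) * z)))\<^sup>2 = exp (l x * Re z)"
        by (simp add: norm_exp_eq_Re flip: exp_double)
      then show ?thesis
        using two_Re_mat_trace_le[OF Mp[OF that] psd(1) Y_carrier, of "exp (of_real (l x / 2) * z)"] unfolding g_def by simp
    qed
    then have "(\<Sum>x<k. 2 * Re (exp (of_real (l x / 2) * z) * g x z)) \<le> (\<Sum>x<k. Re (mat_trace (M x * \<rho>)) +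
        exp (l x * Re z) * Re (mat_trace (M x * (Y z * \<rho> * mat_adjoint (Y z)))))"
      by (intro sum_mono) auto
    moreover have "(\<Sum>x<k. Re (mat_trace (M x * \<rho>))) = 1"
      using povm_sum_trace[OF M carrier(1)] trace_\<rho> by (simp flip: Re_sum)
    ultimately show ?thesis unfolding f_def Re_sum sum.distrib by (simp add: sum_distrib_left)
  qed
  have left: "Re (f (Complex 0 t)) \<le> 1" for t
  proof -
    let ?z = "Complex 0 t"
    have W: "psd_mat N (T ?z * \<rho> * mat_adjoint (T ?z))" by (rule psd_mat_conj[OF psd(1) T_carrier])
    \<comment> \<open>Conjugation by \<open>Y\<close> is conjugation by \<open>T\<close> and then by
      \<open>S\<close>, neither of which raises the trace. Since all weights are 1 here, summing
      over the outcomes leaves only this trace.\<close>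
    have "Y ?z * \<rho> * mat_adjoint (Y ?z) = S ?z * (T ?z * \<rho> * mat_adjoint (T ?z)) * mat_adjoint (S ?z)"
      unfolding Y_def mat_adjoint_mult[OF S_carrier T_carrier]
      using S_carrier[of ?z] T_carrier[of ?z] carrier by (simp add: square_mat_simps[where n = N])
    then have "Re (mat_trace (Y ?z * \<rho> * mat_adjoint (Y ?z))) \<le> 1"
      using trace_S_conj_le(1)[OF _ W, of ?z] trace_S_conj_le(2)[OF _ psd(1), of ?z] trace_\<rho> by simp
    moreover have "(\<Sum>x<k. Re (mat_trace (M x * (Y ?z * \<rho> * mat_adjoint (Y ?z))))) = Re (mat_trace (Y ?z * \<rho> * mat_adjoint (Y ?z)))"
      using povm_sum_trace[OF M psd_mat_carrier[OF psd_mat_conj[OF psd(1) Y_carrier]]] by (simp flip: Re_sum)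
    ultimately show ?thesis using f_le[of ?z] by simp
  qed
  obtain B where B: "\<And>z. 0 \<le> Re z \<Longrightarrow> Re z \<le> 1 \<Longrightarrow> norm (f z) \<le> B"
    using f_strip unfolding bounded_on_strip_def by auto
  have "Re f' \<le> (\<integral>t. beta0 t * (Re (f (Complex 1 t)) - 1) \<partial>lborel)"
    using f_strip B f0 left f_deriv unfolding bounded_on_strip_def
    by (intro strip_derivative_bound[of f B]) auto
  \<comment> \<open>At Re z = 1 the bound \<open>f_le\<close> is 2 Re f <= 1 + sum; subtract 2 and
    halve.\<close>
  also have "\<dots> \<le> (\<integral>t. beta0 t * (((\<Sum>x<k. exp (l x) * Re (mat_trace (M x * R t))) - 1) / 2) \<partial>lborel)"
  proof (rule integral_mono)
    have "integrable lborel (\<lambda>t. of_real (beta0 t) * (f (Complex 1 t) + (- 1)))"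
      by (intro integrable_beta0_mult bounded_continuous_add bounded_continuous_const
          bounded_on_strip_imp_bounded_continuous f_strip) auto
    from integrable_Re[OF this] show "integrable lborel (\<lambda>t. beta0 t * (Re (f (Complex 1 t)) - 1))" by simp
    have "integrable lborel (\<lambda>t. ((\<Sum>x<k. exp (l x) * (beta0 t * Re (mat_trace (M x * R t)))) - beta0 t) / 2)"
      by (intro Bochner_Integration.integrable_diff integrable_divide Bochner_Integration.integrable_sum
          integrable_mult_right integrable_beta0 integrable_trace_R Mc) auto
    then show "integrable lborel (\<lambda>t. beta0 t * (((\<Sum>x<k. exp (l x) * Re (mat_trace (M x * R t))) - 1) / 2))"
      by (simp add: right_diff_distrib diff_divide_distrib sum_distrib_left mult_ac)
    fix t
    show "beta0 t * (Re (f (Complex 1 t)) - 1) \<le> beta0 t * (((\<Sum>x<k. exp (l x) * Re (mat_trace (M x * R t))) - 1) / 2)"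
      using f_le[of "Complex 1 t"] unfolding rotated_integrand_eq by (intro mult_left_mono beta0_nonneg) simp
  qed
  also have "\<dots> = (\<integral>t. ((\<Sum>x<k. exp (l x) * (beta0 t * Re (mat_trace (M x * R t)))) - beta0 t) / 2 \<partial>lborel)"
    by (simp add: right_diff_distrib diff_divide_distrib sum_distrib_left mult_ac)
  also have "\<dots> = ((\<Sum>x<k. exp (l x) * Re (mat_trace (M x * \<sigma>AB))) - 1) / 2"
  proof -
    have "(\<integral>t. ((\<Sum>x<k. exp (l x) * (beta0 t * Re (mat_trace (M x * R t)))) - beta0 t) \<partial>lborel) =
        (\<integral>t. (\<Sum>x<k. exp (l x) * (beta0 t * Re (mat_trace (M x * R t)))) \<partial>lborel) - (\<integral>t. beta0 t \<partial>lborel)"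
      by (intro Bochner_Integration.integral_diff Bochner_Integration.integrable_sum
          integrable_mult_right integrable_beta0 integrable_trace_R Mc) auto
    also have "(\<integral>t. (\<Sum>x<k. exp (l x) * (beta0 t * Re (mat_trace (M x * R t)))) \<partial>lborel) =
        (\<Sum>x<k. \<integral>t. exp (l x) * (beta0 t * Re (mat_trace (M x * R t))) \<partial>lborel)"
      by (intro Bochner_Integration.integral_sum integrable_mult_right integrable_trace_R Mc) auto
    finally show ?thesis using Mc by (simp add: integral_beta0 Re_trace_sigma_bar)
  qed
  finally show ?thesis using f'_Re by simp
qed

end

section \<open>The extension property and the lower bound\<close>

text \<open>The powers of rho_A around its own marginal collapse to the projection rho_A^0, so t
  survives only in the powers of sigma_A. Both the extension property and the domination by sigma_A
  start from this form.\<close>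

lemma ptrace_R:
  "ptrace_snd m n (R t) = mat_powr \<sigma> (Complex (1 / 2) (t / 2)) * mat_powr \<rho>A 0 * mat_adjoint (mat_powr \<sigma> (Complex (1 / 2) (t / 2)))"
proof -
  let ?z = "Complex 1 t"
  define A where "A = mat_powr \<sigma> (of_real (1 / 2) * ?z)"
  define B where "B = mat_powr \<rho>A (of_real (- 1 / 2) * ?z)"
  have A: "A \<in> carrier_mat m m" "mat_adjoint A \<in> carrier_mat m m" and B: "B \<in> carrier_mat m m" "mat_adjoint B \<in> carrier_mat m m"
    unfolding A_def B_def using mat_powr_carrier psd by auto
  note AB = tensor_one_carrier[OF A(1), of n] tensor_one_carrier[OF A(2), of n]
    tensor_one_carrier[OF B(1), of n] tensor_one_carrier[OF B(2), of n]
  have "R t = tensor_one n A * (tensor_one n B * (\<rho> * (tensor_one n (mat_adjoint B) * tensor_one n (mat_adjoint A))))"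
    unfolding rotated_integrand_eq Y_def mat_adjoint_mult[OF S_carrier T_carrier]
    unfolding S_def T_def A_def[symmetric] B_def[symmetric] tensor_one_adjoint[OF A(1)] tensor_one_adjoint[OF B(1)]
    using AB carrier by (simp add: square_mat_simps[where n = N])
  also have "\<dots> = tensor_one n A * (tensor_one n B * (\<rho> * tensor_one n (mat_adjoint B * mat_adjoint A)))"
    using tensor_one_mult[OF B(2) A(2)] by simp
  also have "ptrace_snd m n \<dots> = A * (B * (\<rho>A * (mat_adjoint B * mat_adjoint A)))"
    using A B AB carrier tensor_one_carrier[OF mult_carrier_mat[OF B(2) A(2)], of n]
    by (simp add: ptrace_snd_mult_left ptrace_snd_mult_right mult_carrier_mat[of _ m m _ m] mult_carrier_mat[of _ N N _ N])
  also have "\<dots> = A * (B * \<rho>A * mat_adjoint B) * mat_adjoint A"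
    using A B carrier by (simp add: square_mat_simps[where n = m])
  also have "B * \<rho>A * mat_adjoint B = mat_powr \<rho>A 0"
  proof -
    have "B * \<rho>A * mat_adjoint B = mat_powr \<rho>A (of_real (- 1 / 2) * ?z) * mat_powr \<rho>A 1 * mat_powr \<rho>A (cnj (of_real (- 1 / 2) * ?z))"
      unfolding B_def mat_powr_adjoint[OF psd(3)] mat_powr_one[OF psd(3)] ..
    also have "\<dots> = mat_powr \<rho>A (of_real (- 1 / 2) * ?z + 1 + cnj (of_real (- 1 / 2) * ?z))"
      unfolding mat_powr_mult[OF psd(3)] ..
    also have "of_real (- 1 / 2) * ?z + 1 + cnj (of_real (- 1 / 2) * ?z) = 0" by (simp add: complex_eq_iff)
    finally show ?thesis .
  qed
  finally have "ptrace_snd m n (R t) = A * mat_powr \<rho>A 0 * mat_adjoint A" .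
  moreover have "of_real (1 / 2) * ?z = Complex (1 / 2) (t / 2)" by (simp add: complex_eq_iff)
  ultimately show ?thesis unfolding A_def by simp
qed


lemma extension_sigma_bar:
  assumes supp: "mat_supp \<sigma> \<subseteq> mat_supp \<rho>A"
  shows "is_extension m n \<sigma>AB \<sigma>"
proof -
  have Rc: "R t \<in> carrier_mat N N" for t using psd_R psd_mat_carrier by blast
  have pR: "ptrace_snd m n (R t) = \<sigma>" for t
  proof -
    let ?z = "Complex (1 / 2) (t / 2)"
    have s: "mat_powr \<sigma> z \<in> carrier_mat m m" for z by (rule mat_powr_carrier[OF psd(2)])
    have r: "mat_powr \<rho>A 0 \<in> carrier_mat m m" by (rule mat_powr_carrier[OF psd(3)])
    \<comment> \<open>Splitting sigma^0 off the last factor exposes rho_A^0 sigma^0, which equals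
      sigma^0 by the support inclusion. The remaining exponents add up to 1 for every t.\<close>
    have "ptrace_snd m n (R t) = mat_powr \<sigma> ?z * mat_powr \<rho>A 0 * (mat_powr \<sigma> 0 * mat_powr \<sigma> (cnj ?z))"
      unfolding ptrace_R mat_powr_adjoint[OF psd(2)] mat_powr_mult[OF psd(2)] by simp
    also have "\<dots> = mat_powr \<sigma> ?z * (mat_powr \<rho>A 0 * mat_powr \<sigma> 0) * mat_powr \<sigma> (cnj ?z)"
      using s[of ?z] s[of 0] s[of "cnj ?z"] r by (simp add: square_mat_simps[where n = m])
    also have "\<dots> = mat_powr \<sigma> (?z + 0 + cnj ?z)"
      unfolding mat_supp_subset_proj[OF psd(2,3) supp] mat_powr_mult[OF psd(2)] ..
    also have "?z + 0 + cnj ?z = 1" by (simp add: complex_eq_iff)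
    finally show ?thesis unfolding mat_powr_one[OF psd(2)] .
  qed
  have int: "integrable lborel (\<lambda>t. of_real (beta0 t) * R t $$ (i, j))" if "i < N" "j < N" for i j
    using bounded_continuous_mat_R that unfolding bounded_continuous_mat_def by (intro integrable_beta0_mult) auto
  have "ptrace_snd m n \<sigma>AB = \<sigma>"
  proof (rule eq_matI)
    fix i j assume "i < dim_row \<sigma>" "j < dim_col \<sigma>"
    then have ij: "i < m" "j < m" using carrier by auto
    have "ptrace_snd m n \<sigma>AB $$ (i, j) = (\<Sum>k<n. \<integral>t. of_real (beta0 t) * R t $$ (i * n + k, j * n + k) \<partial>lborel)"
      using ij by (simp add: ptrace_snd_index sigma_bar_eq beta0_mean_def times_add_less)
    also have "\<dots> = (\<integral>t. (\<Sum>k<n. of_real (beta0 t) * R t $$ (i * n + k, j * n + k)) \<partial>lborel)"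
      using ij by (intro Bochner_Integration.integral_sum[symmetric] int times_add_less) auto
    also have "\<dots> = (\<integral>t. of_real (beta0 t) * \<sigma> $$ (i, j) \<partial>lborel)"
    proof -
      have "(\<Sum>k<n. R t $$ (i * n + k, j * n + k)) = \<sigma> $$ (i, j)" for t
        using ptrace_snd_index[OF ij, of n "R t"] pR[of t] by simp
      then show ?thesis by (simp flip: sum_distrib_left)
    qed
    also have "\<dots> = \<sigma> $$ (i, j)"
      using integral_of_real[of lborel beta0, where 'a = complex] integral_beta0 by simp
    finally show "ptrace_snd m n \<sigma>AB $$ (i, j) = \<sigma> $$ (i, j)" .
  qed (use carrier in \<open>auto simp: ptrace_snd_def\<close>)
  moreover from this have "mat_trace \<sigma>AB = 1"
    using mat_trace_ptrace_snd[OF psd_mat_carrier[OF psd_sigma_bar]] trace_\<sigma> by simp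
  ultimately show ?thesis unfolding is_extension_def density_mat_def using psd_sigma_bar by simp
qed

text \<open>The marginal of each \<open>R t\<close> is W P W^* with W W^* = sigma and P a
  projection. The gap W (1 - P) W^* is positive, so domination holds for each t and survives
  averaging with mass 1.\<close>

lemma trace_tensor_sigma_bar_le:
  assumes M: "psd_mat m M"
  shows "Re (mat_trace (tensor_one n M * \<sigma>AB)) \<le> Re (mat_trace (M * \<sigma>))"
proof -
  note Mc = psd_mat_carrier[OF M]
  have Rc: "R t \<in> carrier_mat N N" for t using psd_R psd_mat_carrier by blast
  have le: "Re (mat_trace (tensor_one n M * R t)) \<le> Re (mat_trace (M * \<sigma>))" for t
  proof -
    define W where "W = mat_powr \<sigma> (Complex (1 / 2) (t / 2))"
    define P where "P = mat_powr \<rho>A 0"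
    have W: "W \<in> carrier_mat m m" "mat_adjoint W \<in> carrier_mat m m"
      unfolding W_def using mat_powr_carrier[OF psd(2)] by auto
    have P: "P \<in> carrier_mat m m" unfolding P_def by (rule mat_powr_carrier[OF psd(3)])
    have Q: "psd_mat m (1\<^sub>m m - P)"
      unfolding P_def using proj_complement(4) mat_powr_carrier[OF psd(3)] mat_powr_zero_proj[OF psd(3)] by blast
    have "Complex (1 / 2) (t / 2) + cnj (Complex (1 / 2) (t / 2)) = 1" by (simp add: complex_eq_iff)
    then have WW: "W * mat_adjoint W = \<sigma>"
      unfolding W_def mat_powr_adjoint[OF psd(2)] mat_powr_mult[OF psd(2)] by (simp add: mat_powr_one[OF psd(2)])
    have "W * (1\<^sub>m m - P) * mat_adjoint W = \<sigma> - W * P * mat_adjoint W"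
      unfolding WW[symmetric] using W P
      by (simp add: mult_minus_distrib_mat[of _ m m _ m] minus_mult_distrib_mat[of _ m m _ _ m] mult_carrier_mat[of _ m m _ m])
    then have "mat_trace (M * (W * (1\<^sub>m m - P) * mat_adjoint W)) = mat_trace (M * \<sigma>) - mat_trace (M * (W * P * mat_adjoint W))"
      using W P Mc carrier
      by (simp add: mult_minus_distrib_mat[of _ m m _ m] mat_trace_minus[of _ m] square_mat_simps[where n = m])
    moreover have "0 \<le> Re (mat_trace (M * (W * (1\<^sub>m m - P) * mat_adjoint W)))"
      using mat_trace_mult_psd[OF M psd_mat_conj[OF Q W(1)]] by auto
    moreover have "mat_trace (tensor_one n M * R t) = mat_trace (M * (W * P * mat_adjoint W))"
      unfolding mat_trace_tensor_one_mult[OF Mc Rc] ptrace_R W_def P_def ..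
    ultimately show ?thesis by simp
  qed
  note Mt = tensor_one_carrier[OF Mc, of n]
  have "Re (mat_trace (tensor_one n M * \<sigma>AB)) = (\<integral>t. beta0 t * Re (mat_trace (tensor_one n M * R t)) \<partial>lborel)"
    by (rule Re_trace_sigma_bar[OF Mt])
  also have "\<dots> \<le> (\<integral>t. beta0 t * Re (mat_trace (M * \<sigma>)) \<partial>lborel)"
    by (intro integral_mono integrable_trace_R[OF Mt] integrable_mult_left integrable_beta0 mult_left_mono le beta0_nonneg)
  finally show ?thesis by (simp add: integral_beta0)
qed

lemma measured_rel_entropy_lower:
  "measured_rel_entropy m \<rho>A \<sigma> \<le> measured_rel_entropy N \<rho> \<sigma>AB"
  unfolding measured_rel_entropy_def
proof (rule SUP_least)
  fix kM assume "kM \<in> {(k, M). povm m k M}"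
  then obtain k M where kM: "kM = (k, M)" and M: "povm m k M" by auto
  let ?M = "\<lambda>x. tensor_one n (M x)"
  have M': "povm N k ?M" by (rule povm_tensor_one[OF M])
  have Mp: "psd_mat m (M x)" if "x < k" for x using povm_psd[OF M that] .
  \<comment> \<open>The first argument is unaffected: M tensor 1 has on \<open>\<rho>\<close> the
    outcome distribution of M on the marginal.\<close>
  have "povm_channel k ?M \<rho> = povm_channel k M \<rho>A"
    unfolding povm_channel_def
    by (rule eq_matI) (auto simp: mat_diag_def mat_trace_tensor_one_mult[OF psd_mat_carrier[OF Mp] carrier(1)])
  moreover have "rel_entropy (povm_channel k M \<rho>A) (povm_channel k M \<sigma>) \<le> rel_entropy (povm_channel k M \<rho>A) (povm_channel k ?M \<sigma>AB)"
    unfolding povm_channel_eq[OF M psd(3)] povm_channel_eq[OF M psd(2)] povm_channel_eq[OF M' psd_sigma_bar]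
  proof (rule rel_entropy_diag_antimono)
    fix x assume x: "x < k"
    show "0 \<le> Re (mat_trace (M x * \<rho>A))" using mat_trace_mult_psd[OF Mp[OF x] psd(3)] by auto
    show "0 \<le> Re (mat_trace (?M x * \<sigma>AB))" using mat_trace_mult_psd[OF povm_psd[OF M' x] psd_sigma_bar] by auto
    show "Re (mat_trace (?M x * \<sigma>AB)) \<le> Re (mat_trace (M x * \<sigma>))" by (rule trace_tensor_sigma_bar_le[OF Mp[OF x]])
  qed
  ultimately have "rel_entropy (povm_channel k M \<rho>A) (povm_channel k M \<sigma>) \<le> rel_entropy (povm_channel k ?M \<rho>) (povm_channel k ?M \<sigma>AB)"
    by simp
  also have "\<dots> \<le> (SUP (k, M)\<in>{(k, M). povm N k M}. rel_entropy (povm_channel k M \<rho>) (povm_channel k M \<sigma>AB))"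
    using M' by (intro SUP_upper2[of "(k, ?M)"]) auto
  finally show "(case kM of (k, M) \<Rightarrow> rel_entropy (povm_channel k M \<rho>A) (povm_channel k M \<sigma>)) \<le>
      (SUP (k, M)\<in>{(k, M). povm N k M}. rel_entropy (povm_channel k M \<rho>) (povm_channel k M \<sigma>AB))"
    unfolding kM by simp
qed

text \<open>Without the support inclusion the right side is infinite. With it, the variational
  inequality holds for all l and is optimised for each POVM separately.\<close>

lemma measured_rel_entropy_upper:
  "measured_rel_entropy N \<rho> \<sigma>AB \<le> rel_entropy \<rho>A \<sigma>"
proof (cases "mat_supp \<rho>A \<subseteq> mat_supp \<sigma>")
  case True
  show ?thesis
    unfolding measured_rel_entropy_def
  proof (rule SUP_least)
    fix kM assume "kM \<in> {(k, M). povm N k M}"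
    then obtain k M where kM: "kM = (k, M)" and M: "povm N k M" by auto
    have "rel_entropy (povm_channel k M \<rho>) (povm_channel k M \<sigma>AB) \<le> ereal (Re (mat_trace (\<rho>A * (mat_ln \<rho>A - mat_ln \<sigma>))))"
      unfolding povm_channel_eq[OF M psd(1)] povm_channel_eq[OF M psd_sigma_bar]
    proof (rule rel_entropy_diag_le)
      fix x assume x: "x < k"
      show "0 \<le> Re (mat_trace (M x * \<rho>))" using mat_trace_mult_psd[OF povm_psd[OF M x] psd(1)] by auto
      show "0 \<le> Re (mat_trace (M x * \<sigma>AB))" using mat_trace_mult_psd[OF povm_psd[OF M x] psd_sigma_bar] by auto
    next
      show "(\<Sum>x<k. Re (mat_trace (M x * \<rho>))) = 1"
        using povm_sum_trace[OF M carrier(1)] trace_\<rho> by (simp flip: Re_sum)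
    qed (rule variational_bound[OF True M])
    then show "(case kM of (k, M) \<Rightarrow> rel_entropy (povm_channel k M \<rho>) (povm_channel k M \<sigma>AB)) \<le> rel_entropy \<rho>A \<sigma>"
      unfolding kM rel_entropy_def[of \<rho>A \<sigma>] using True by simp
  qed
qed (simp add: rel_entropy_def)

end

lemma prob_space_beta0: "prob_space (density lborel (\<lambda>t. ennreal (beta0 t)))"
proof (rule prob_spaceI)
  have "emeasure (density lborel (\<lambda>t. ennreal (beta0 t))) (space (density lborel (\<lambda>t. ennreal (beta0 t)))) = (\<integral>\<^sup>+t. ennreal (beta0 t) \<partial>lborel)"
    by (simp add: emeasure_density)
  also have "\<dots> = ennreal (\<integral>t. beta0 t \<partial>lborel)"
    by (intro nn_integral_eq_integral integrable_beta0) (simp add: beta0_nonneg)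
  finally show "emeasure (density lborel (\<lambda>t. ennreal (beta0 t))) (space (density lborel (\<lambda>t. ennreal (beta0 t)))) = 1"
    by (simp add: integral_beta0)
qed

theorem mainTheorem6:
  fixes m n :: nat and \<rho> \<sigma> :: "complex mat"
  assumes "density_mat (m * n) \<rho>" and "density_mat m \<sigma>"
  shows "prob_space (density lborel (\<lambda>t. ennreal (beta0 t))) \<and>
    (mat_supp \<sigma> \<subseteq> mat_supp (ptrace_snd m n \<rho>) \<longrightarrow>
       is_extension m n (sigma_bar m n \<rho> \<sigma>) \<sigma>) \<and>
    measured_rel_entropy m (ptrace_snd m n \<rho>) \<sigma>
      \<le> measured_rel_entropy (m * n) \<rho> (sigma_bar m n \<rho> \<sigma>) \<and>
    measured_rel_entropy (m * n) \<rho> (sigma_bar m n \<rho> \<sigma>)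
      \<le> rel_entropy (ptrace_snd m n \<rho>) \<sigma>"
proof -
  interpret rotated_extension m n \<rho> \<sigma> using assms by unfold_locales
  show ?thesis
    using prob_space_beta0 extension_sigma_bar measured_rel_entropy_lower measured_rel_entropy_upper by blast
qed

end
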